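(* Let $\delta>0$ and let $(U,c)$ be the family of periodic travelling waves described in the context; fix $(k_\star,M_\star)$ and let the subscript $\star$ denote evaluation at $(k_\star,M_\star)$. Consider the Bloch eigenvalue problem, for $\nu\in i\mathbb{R}$, $\lambda\in\mathbb{C}$ and $\hat u$ $1$-periodic, $$k_\star(\tfrac{d}{dx}+\nu)\big((6U_\star-c_\star)\hat u\big)+k_\star^3(\tfrac{d}{dx}+\nu)^3\hat u+\delta\big[k_\star^2(\tfrac{d}{dx}+\nu)^2\hat u+k_\star^4(\tfrac{d}{dx}+\nu)^4\hat u\big]=-\lambda\hat u .\qquad(B)$$ (i) Let $\lambda(\nu)$, $\hat u(\nu)$ be a smooth solution curve of $(B)$ near $\nu=0$ with expansions $\lambda=\nu k_\star\tilde\lambda_0+O(\nu^2)$, $\hat u=\hat u_0+\nu\hat u_1+O(\nu^2)$, $\hat u_0\neq0$. Then there is a constant $k_0\ne0$ such that, with $M_0=\langle\hat u_1\rangle$, $\hat u_0=\frac{k_0}{k_\star}U_\star'$ and $$\tilde\lambda_0k_0+k_\star\big(\partial_kc_\star\,k_0+\partial_Mc_\star\,M_0\big)=0,\qquad \partial_k\langle3U^2\rangle_\star\,k_0+\big(\tilde\lambda_0-c_\star+\partial_M\langle3U^2\rangle_\star\big)M_0=0 .$$ Equivalently, $e^{\nu(X+\tilde\lambda_0T)}(k_0,M_0)$ solves the linearization about $(k_\star,M_\star)$, in the co-moving frame $(X-c_\star T,T)$, of Whitham's system $$\partial_Tk+\partial_X(k\,c(k,M))=0,\qquad\partial_TM+\partial_X\langle3U^2\rangle=0.\qquad(W)$$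 In particular $$\tilde\lambda_0^2+\big(k_\star c^{(0)\prime}(k_\star)-c^{(0)}(k_\star)\big)\tilde\lambda_0-\big(k_\star c^{(0)}(k_\star)c^{(0)\prime}(k_\star)+6k_\star\bar q^{(0)\prime}(k_\star)\big)=0 ,$$ where $\bar q^{(0)}(k)=3\langle (U^{(0)}(\cdot\,;k))^2\rangle$, and the two roots of this equation are real and distinct if $\big(c^{(0)}(k_\star)+k_\star c^{(0)\prime}(k_\star)\big)^2+24k_\star\bar q^{(0)\prime}(k_\star)>0$. (ii) If the wave $U_\star$ is spectrally stable, i.e. for every $\nu\in i\mathbb{R}$ every $\lambda$ for which $(B)$ has a nonzero $1$-periodic solution satisfies $\operatorname{Re}\lambda\le0$, then the system $(W)$ is hyperbolic at $(k_\star,M_\star)$, in the sense that its characteristic speeds there are real.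
   Context: $\langle f\rangle=\int_0^1 f(y)\,dy$ for $1$-periodic $f$. $(B)$ arises from the generalized Kuramoto-Sivashinsky equation $\partial_tu+6u\,\partial_xu+\partial_x^3u+\delta(\partial_x^2u+\partial_x^4u)=0$ linearized about the wave in a co-moving frame with $x$ rescaled by $k_\star$, with perturbations $e^{\lambda t+\nu x}\hat u(x)$. Travelling wave family: for $(k,M)$ in an open set with $k>0$, $U(\cdot\,;k,M)$ is a smooth non-constant $1$-periodic function and $c(k,M)\in\mathbb{R}$, both depending smoothly on $(k,M)$, with $\langle U\rangle=M$ and $$-kcU'+6kUU'+k^3U'''+\delta(k^2U''+k^4U'''')=0,$$ normalized so that $U(\cdot\,;k,M)=M+U^{(0)}(\cdot\,;k)$ and $c(k,M)=6M+c^{(0)}(k)$. Standing assumption: for the operator on $1$-periodic functions $$\mathcal{L}_{k,M}f=k\big((6U-c)f\big)'+k^3f'''+\delta(k^2f''+k^4f'''')$$ the kernel is one-dimensional, spanned by $U'$, and the eigenvalue $0$ has algebraic multiplicity $2$, with generalized eigenvector the constant function $1$ (indeed $\mathcal{L}_{k,M}[1]=6kU'$). *)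

theory Defs
  imports "HOL-Analysis.Analysis" "HOL-Library.Function_Algebras"
begin

text \<open>Continuous differentiability of order \<open>n\<close> and of every order; meant for open \<open>S\<close>
  in a finite-dimensional space, where it suffices to test each direction \<open>v\<close> separately.\<close>

primrec Ck_on :: "nat \<Rightarrow> 'a::real_normed_vector set \<Rightarrow> ('a \<Rightarrow> 'b::real_normed_vector) \<Rightarrow> bool" where
  "Ck_on 0 S f \<longleftrightarrow> continuous_on S f"
| "Ck_on (Suc n) S f \<longleftrightarrow> (\<forall>x\<in>S. f differentiable (at x)) \<and>
     (\<forall>v. Ck_on n S (\<lambda>x. frechet_derivative f (at x) v))"

definition smooth_on :: "'a::real_normed_vector set \<Rightarrow> ('a \<Rightarrow> 'b::real_normed_vector) \<Rightarrow> bool" where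
  "smooth_on S f \<longleftrightarrow> (\<forall>n. Ck_on n S f)"

definition periodic1 :: "(real \<Rightarrow> 'a) \<Rightarrow> bool" where
  "periodic1 f \<longleftrightarrow> (\<forall>x. f (x + 1) = f x)"

text \<open>All operators below have smooth coefficients and leading part \<open>\<delta> k\<^sup>4 d\<^sup>4/dx\<^sup>4\<close>
  with \<open>\<delta> k\<^sup>4 \<noteq> 0\<close>, so (generalized) eigenfunctions in any Sobolev or \<open>C\<^sup>n\<close> space of
  periodic functions are smooth; hence smooth functions serve as the common domain.\<close>

definition per_smooth :: "(real \<Rightarrow> complex) \<Rightarrow> bool" where
  "per_smooth f \<longleftrightarrow> smooth_on UNIV f \<and> periodic1 f"

definition avg :: "(real \<Rightarrow> 'a::real_normed_vector) \<Rightarrow> 'a" where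
  "avg f = integral {0..1} f"

definition Dx :: "(real \<Rightarrow> 'a::real_normed_vector) \<Rightarrow> real \<Rightarrow> 'a" where
  "Dx f x = vector_derivative f (at x)"

text \<open>In the following, \<open>V\<close> is a wave profile, \<open>s\<close> its speed and \<open>k\<close> its wave number.\<close>

definition profile_eq :: "real \<Rightarrow> real \<Rightarrow> (real \<Rightarrow> real) \<Rightarrow> real \<Rightarrow> bool" where
  "profile_eq \<delta> k V s \<longleftrightarrow> (\<forall>x.
     - k * s * Dx V x + 6 * k * V x * Dx V x + k^3 * (Dx ^^ 3) V x
     + \<delta> * (k^2 * (Dx ^^ 2) V x + k^4 * (Dx ^^ 4) V x) = 0)"

definition lin_op :: "real \<Rightarrow> real \<Rightarrow> (real \<Rightarrow> real) \<Rightarrow> real \<Rightarrow> (real \<Rightarrow> complex) \<Rightarrow> real \<Rightarrow> complex" where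
  "lin_op \<delta> k V s f = (\<lambda>x.
     of_real k * Dx (\<lambda>y. of_real (6 * V y - s) * f y) x + of_real (k^3) * (Dx ^^ 3) f x
     + of_real \<delta> * (of_real (k^2) * (Dx ^^ 2) f x + of_real (k^4) * (Dx ^^ 4) f x))"

definition Dnu :: "complex \<Rightarrow> (real \<Rightarrow> complex) \<Rightarrow> real \<Rightarrow> complex" where
  "Dnu \<nu> f = (\<lambda>x. Dx f x + \<nu> * f x)"

definition bloch_op ::
  "real \<Rightarrow> real \<Rightarrow> (real \<Rightarrow> real) \<Rightarrow> real \<Rightarrow> complex \<Rightarrow> (real \<Rightarrow> complex) \<Rightarrow> real \<Rightarrow> complex" where
  "bloch_op \<delta> k V s \<nu> f = (\<lambda>x.
     of_real k * Dnu \<nu> (\<lambda>y. of_real (6 * V y - s) * f y) x + of_real (k^3) * (Dnu \<nu> ^^ 3) f x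
     + of_real \<delta> * (of_real (k^2) * (Dnu \<nu> ^^ 2) f x + of_real (k^4) * (Dnu \<nu> ^^ 4) f x))"

definition bloch_eq ::
  "real \<Rightarrow> real \<Rightarrow> (real \<Rightarrow> real) \<Rightarrow> real \<Rightarrow> complex \<Rightarrow> complex \<Rightarrow> (real \<Rightarrow> complex) \<Rightarrow> bool" where
  "bloch_eq \<delta> k V s \<nu> l f \<longleftrightarrow> (\<forall>x. bloch_op \<delta> k V s \<nu> f x = - l * f x)"

interpretation cfun: vector_space "\<lambda>(a::complex) (f::real \<Rightarrow> complex) x. a * f x"
  by unfold_locales (auto simp: fun_eq_iff algebra_simps)

definition ker0 :: "((real \<Rightarrow> complex) \<Rightarrow> real \<Rightarrow> complex) \<Rightarrow> (real \<Rightarrow> complex) set" where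
  "ker0 L = {f. per_smooth f \<and> L f = (\<lambda>x. 0)}"

definition gen_ker0 :: "((real \<Rightarrow> complex) \<Rightarrow> real \<Rightarrow> complex) \<Rightarrow> (real \<Rightarrow> complex) set" where
  "gen_ker0 L = {f. per_smooth f \<and> (\<exists>n. (L ^^ n) f = (\<lambda>x. 0))}"

definition spectral_assumption :: "real \<Rightarrow> real \<Rightarrow> (real \<Rightarrow> real) \<Rightarrow> real \<Rightarrow> bool" where
  "spectral_assumption \<delta> k V s \<longleftrightarrow>
     ker0 (lin_op \<delta> k V s) = cfun.span {\<lambda>x. of_real (Dx V x)} \<and>
     cfun.dim (ker0 (lin_op \<delta> k V s)) = 1 \<and>
     cfun.dim (gen_ker0 (lin_op \<delta> k V s)) = 2 \<and>
     (\<lambda>x. 1) \<in> gen_ker0 (lin_op \<delta> k V s) - ker0 (lin_op \<delta> k V s)"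

text \<open>The parameter \<open>\<nu> = \<i> \<xi>\<close> runs through the imaginary axis only; a smooth curve of
  periodic functions is a jointly smooth function of \<open>(\<xi>, x)\<close>.\<close>

definition bloch_curve ::
  "real \<Rightarrow> real \<Rightarrow> (real \<Rightarrow> real) \<Rightarrow> real \<Rightarrow> real \<Rightarrow>
     (complex \<Rightarrow> complex) \<Rightarrow> (complex \<Rightarrow> real \<Rightarrow> complex) \<Rightarrow> bool" where
  "bloch_curve \<delta> k V s \<epsilon> lam uhat \<longleftrightarrow> 0 < \<epsilon> \<and>
     smooth_on {-\<epsilon><..<\<epsilon>} (\<lambda>\<xi>. lam (\<i> * of_real \<xi>)) \<and>
     smooth_on ({-\<epsilon><..<\<epsilon>} \<times> UNIV) (\<lambda>(\<xi>, x). uhat (\<i> * of_real \<xi>) x) \<and>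
     (\<forall>\<xi>\<in>{-\<epsilon><..<\<epsilon>}. periodic1 (uhat (\<i> * of_real \<xi>)) \<and>
        bloch_eq \<delta> k V s (\<i> * of_real \<xi>) (lam (\<i> * of_real \<xi>)) (uhat (\<i> * of_real \<xi>)))"

definition curve_expansions ::
  "real \<Rightarrow> (complex \<Rightarrow> complex) \<Rightarrow> (complex \<Rightarrow> real \<Rightarrow> complex) \<Rightarrow>
     complex \<Rightarrow> (real \<Rightarrow> complex) \<Rightarrow> (real \<Rightarrow> complex) \<Rightarrow> bool" where
  "curve_expansions k lam uhat l0 u0 u1 \<longleftrightarrow>
     (\<exists>C. \<forall>\<^sub>F \<xi> in nhds (0::real).
        cmod (lam (\<i> * of_real \<xi>) - \<i> * of_real \<xi> * of_real k * l0) \<le> C * \<bar>\<xi>\<bar>^2) \<and>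
     (\<exists>C. \<forall>\<^sub>F \<xi> in nhds (0::real). \<forall>x.
        cmod (uhat (\<i> * of_real \<xi>) x - (u0 x + \<i> * of_real \<xi> * u1 x)) \<le> C * \<bar>\<xi>\<bar>^2)"

definition spectrally_stable :: "real \<Rightarrow> real \<Rightarrow> (real \<Rightarrow> real) \<Rightarrow> real \<Rightarrow> bool" where
  "spectrally_stable \<delta> k V s \<longleftrightarrow>
     (\<forall>\<nu> l f. Re \<nu> = 0 \<and> per_smooth f \<and> (\<exists>x. f x \<noteq> 0) \<and> bloch_eq \<delta> k V s \<nu> l f \<longrightarrow> Re l \<le> 0)"

definition modulation_eqs ::
  "(real \<Rightarrow> real \<Rightarrow> real \<Rightarrow> real) \<Rightarrow> (real \<Rightarrow> real \<Rightarrow> real) \<Rightarrow> real \<Rightarrow> real \<Rightarrow>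
     complex \<Rightarrow> complex \<Rightarrow> complex \<Rightarrow> bool" where
  "modulation_eqs U c ks Ms l \<kappa> \<mu> \<longleftrightarrow>
     l * \<kappa> + of_real ks * (of_real (deriv (\<lambda>k. c k Ms) ks) * \<kappa>
                          + of_real (deriv (\<lambda>M. c ks M) Ms) * \<mu>) = 0 \<and>
     of_real (deriv (\<lambda>k. avg (\<lambda>x. 3 * (U k Ms x)^2)) ks) * \<kappa>
       + (l - of_real (c ks Ms) + of_real (deriv (\<lambda>M. avg (\<lambda>x. 3 * (U ks M x)^2)) Ms)) * \<mu> = 0"

text \<open>Systems of conservation laws \<open>\<partial>\<^sub>T w + \<partial>\<^sub>X F(w) = 0\<close> for \<open>w = (k, M)\<close>:
  complexified derivative of the flux, linearization about a constant state, hyperbolicity.\<close>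

definition whitham_flux ::
  "(real \<Rightarrow> real \<Rightarrow> real \<Rightarrow> real) \<Rightarrow> (real \<Rightarrow> real \<Rightarrow> real) \<Rightarrow> real \<times> real \<Rightarrow> real \<times> real" where
  "whitham_flux U c = (\<lambda>(k, M). (k * c k M, avg (\<lambda>x. 3 * (U k M x)^2)))"

definition cderiv ::
  "(real \<times> real \<Rightarrow> real \<times> real) \<Rightarrow> real \<times> real \<Rightarrow> complex \<times> complex \<Rightarrow> complex \<times> complex" where
  "cderiv F p w =
     (let a = frechet_derivative F (at p) (Re (fst w), Re (snd w));
          b = frechet_derivative F (at p) (Im (fst w), Im (snd w))
      in (Complex (fst a) (fst b), Complex (snd a) (snd b)))"

definition solves_linearization ::
  "(real \<times> real \<Rightarrow> real \<times> real) \<Rightarrow> real \<times> real \<Rightarrow> (real \<Rightarrow> real \<Rightarrow> complex \<times> complex) \<Rightarrow> bool" where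
  "solves_linearization F p w \<longleftrightarrow> (\<forall>X T. \<exists>wT wX.
     ((\<lambda>t. w X t) has_vector_derivative wT) (at T) \<and>
     ((\<lambda>y. w y T) has_vector_derivative wX) (at X) \<and>
     wT + cderiv F p wX = 0)"

text \<open>Here \<open>w\<close> is given in the coordinates \<open>(Y, T) = (X - s T, T)\<close>.\<close>

definition solves_linearization_comoving ::
  "(real \<times> real \<Rightarrow> real \<times> real) \<Rightarrow> real \<times> real \<Rightarrow> real \<Rightarrow>
     (real \<Rightarrow> real \<Rightarrow> complex \<times> complex) \<Rightarrow> bool" where
  "solves_linearization_comoving F p s w \<longleftrightarrow>
     solves_linearization F p (\<lambda>X T. w (X - s * T) T)"

definition plane_wave ::
  "complex \<Rightarrow> complex \<Rightarrow> complex \<Rightarrow> complex \<Rightarrow> real \<Rightarrow> real \<Rightarrow> complex \<times> complex" where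
  "plane_wave \<nu> l \<kappa> \<mu> = (\<lambda>Y T.
     (exp (\<nu> * (of_real Y + l * of_real T)) * \<kappa>, exp (\<nu> * (of_real Y + l * of_real T)) * \<mu>))"

definition characteristic_speed :: "(real \<times> real \<Rightarrow> real \<times> real) \<Rightarrow> real \<times> real \<Rightarrow> complex \<Rightarrow> bool" where
  "characteristic_speed F p s \<longleftrightarrow> (\<exists>w. w \<noteq> 0 \<and> cderiv F p w = (s * fst w, s * snd w))"

definition hyperbolic_at :: "(real \<times> real \<Rightarrow> real \<times> real) \<Rightarrow> real \<times> real \<Rightarrow> bool" where
  "hyperbolic_at F p \<longleftrightarrow> (\<forall>s. characteristic_speed F p s \<longrightarrow> s \<in> \<real>)"

definition qbar0 :: "(real \<Rightarrow> real \<Rightarrow> real) \<Rightarrow> real \<Rightarrow> real" where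
  "qbar0 U0 k = 3 * avg (\<lambda>x. (U0 k x)^2)"

definition dispersion_poly ::
  "(real \<Rightarrow> real) \<Rightarrow> (real \<Rightarrow> real \<Rightarrow> real) \<Rightarrow> real \<Rightarrow> complex \<Rightarrow> complex" where
  "dispersion_poly c0 U0 k z =
     z^2 + of_real (k * deriv c0 k - c0 k) * z
     - of_real (k * c0 k * deriv c0 k + 6 * k * deriv (qbar0 U0) k)"

end

(* Integrating the Bloch equation over a period is exact: the adjoint kernel of the linearization
   consists of the constants.  Differentiating the profile equation in k expresses the first
   corrector through the k-derivative of the wave; hence the solvability condition at first order is
   the linearized conservation of waves, and the averaged equation at second order is the linearized
   conservation of mass.

   For the hyperbolicity statement, a non-real root z0 of the (real) dispersion polynomial is simple.
   Since the linearization is boundedly invertible from mean-zero functions onto functions vanishing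
   at a suitable point, a Lyapunov-Schmidt ansatz with a contraction in (z, corrector) turns z0 into
   genuine eigenvalues lambda = nu k z with z near z0, for nu = +-i tau^2 small.  As Im z0 is
   nonzero, one sign of nu gives Re lambda > 0. *)

theory Submission
  imports Defs
begin

section \<open>Global Picard theorem for Lipschitz right-hand sides\<close>

text \<open>The Bloch operator differs from L by \<nu> times an operator of order three, while
  inverting L gains four derivatives. Sup-norm control of derivatives up to order three therefore
  closes the iteration, and ordinary differential equations supply it: L is a total derivative, one
  integration leaves a third-order equation with a free constant, and this constant balances the one
  extra condition that pins the solution at a point where V' is non-zero. Injectivity of a finite
  square system takes the place of Fredholm theory. The eigenvalue 0 of L is defective, so generic
  perturbations of size \<nu> split it like a square root; the ansatz V' + \<nu> (constant +
  corrector) with the unknown z rescales this degeneracy away, and the mean-zero condition on the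
  residual at order \<nu>^2 becomes the dispersion polynomial plus small terms. With |\<nu>| =
  \<tau>^2 and the unknown part of the corrector written as \<tau> v, the forcing of v has size
  \<tau>, so all unknowns stay in fixed balls.\<close>

lemma has_integral_exp_weight:
  fixes x0 :: real
  assumes "K > 0" "x0 \<le> x"
  shows "((\<lambda>t. K * exp (2 * K * (t - x0))) has_integral ((exp (2 * K * (x - x0)) - 1) / 2)) {x0..x}"
proof -
  have "((\<lambda>t. K * exp (2 * K * (t - x0))) has_integral (exp (2 * K * (x - x0)) / 2 - exp (2 * K * (x0 - x0)) / 2)) {x0..x}"
    by (rule fundamental_theorem_of_calculus)
      (use assms in \<open>auto intro!: derivative_eq_intros has_vector_derivative_at_within
         simp flip: has_real_derivative_iff_has_vector_derivative\<close>)
  then show ?thesis by (simp add: diff_divide_distrib)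
qed

text \<open>The oriented integral from \<open>x0\<close> to x. Integrals over reversed intervals are
  0, so exactly one of the two terms is active on each side of \<open>x0\<close>.\<close>

definition volt :: "real \<Rightarrow> (real \<Rightarrow> 'a::banach) \<Rightarrow> real \<Rightarrow> 'a" where
  "volt x0 g x = integral {x0..x} g - integral {x..x0} g"

lemma volt_has_derivative:
  assumes c: "continuous_on UNIV g"
  shows "(volt x0 g has_vector_derivative g x) (at x)"
proof -
  \<comment> \<open>A base point to the left of both x and \<open>x0\<close> turns both signs of x -
    x0 into one ordinary indefinite integral, up to a constant.\<close>
  define a where "a = min x x0 - 1" define b where "b = max x x0 + 1"
  have ic: "g integrable_on {u..v}" for u v
    by (intro integrable_continuous_interval continuous_on_subset[OF c]) auto
  have "volt x0 g y = integral {a..y} g - integral {a..x0} g" if "y \<in> {a..b}" for y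
  proof (cases "y \<ge> x0")
    case True
    have "integral {y..x0} g = 0" using True by (cases "y = x0") auto
    moreover have "integral {a..x0} g + integral {x0..y} g = integral {a..y} g"
      by (rule Henstock_Kurzweil_Integration.integral_combine) (use True ic in \<open>auto simp: a_def\<close>)
    ultimately show ?thesis by (simp add: volt_def algebra_simps)
  next
    case False
    have "integral {x0..y} g = 0" using False by auto
    moreover have "integral {a..y} g + integral {y..x0} g = integral {a..x0} g"
      by (rule Henstock_Kurzweil_Integration.integral_combine) (use False that ic in \<open>auto simp: a_def\<close>)
    ultimately show ?thesis by (simp add: volt_def algebra_simps)
  qed
  moreover have x: "x \<in> {a..b}" by (auto simp: a_def b_def)
  moreover have "((\<lambda>y. integral {a..y} g - integral {a..x0} g) has_vector_derivative g x) (at x within {a..b})"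
    using integral_has_vector_derivative[OF continuous_on_subset[OF c] x]
    by (simp add: has_vector_derivative_diff_const)
  ultimately have "(volt x0 g has_vector_derivative g x) (at x within {a..b})"
    by (intro has_vector_derivative_transform[of x "{a..b}" "volt x0 g" "\<lambda>y. integral {a..y} g - integral {a..x0} g"])
  moreover have "x \<in> interior {a..b}" by (auto simp: a_def b_def)
  ultimately show ?thesis using at_within_interior[of x "{a..b}"] by simp
qed

lemma volt_same: "volt x0 g x0 = 0" by (simp add: volt_def)

text \<open>The weight grows at rate 2K, so integrating K times the weight returns only half of it;
  this 1/2 is the later contraction factor. The constant m integrates to linear growth, which 2K t
  \<le> exp (2K t) absorbs into the weight.\<close>

lemma volt_bound:
  assumes c: "continuous_on UNIV g" and K: "K > 0"
    and b: "\<And>x. norm (g x) \<le> K * B * exp (2 * K * \<bar>x - x0\<bar>) + m" "B \<ge> 0" "m \<ge> 0"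
  shows "norm (volt x0 g x) \<le> (B / 2 + m / (2 * K)) * exp (2 * K * \<bar>x - x0\<bar>)"
proof -
  define e where "e = exp (2 * K * \<bar>x - x0\<bar>)"
  have ic: "g integrable_on {u..v}" for u v
    by (intro integrable_continuous_interval continuous_on_subset[OF c]) auto
  have fin: "B * ((e - 1) / 2) + m * \<bar>x - x0\<bar> \<le> (B / 2 + m / (2 * K)) * e"
  proof -
    have "1 + 2 * K * \<bar>x - x0\<bar> \<le> e" unfolding e_def by (rule exp_ge_add_one_self)
    then have "\<bar>x - x0\<bar> \<le> e / (2 * K)" using K by (simp add: field_simps)
    then have "m * \<bar>x - x0\<bar> \<le> m * (e / (2 * K))" using b(3) by (rule mult_left_mono)
    moreover have "B * ((e - 1) / 2) \<le> B * (e / 2)" using b(2) by (intro mult_left_mono) auto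
    ultimately have "B * ((e - 1) / 2) + m * \<bar>x - x0\<bar> \<le> B * (e / 2) + m * (e / (2 * K))"
      by (rule add_mono[rotated])
    also have "\<dots> = (B / 2 + m / (2 * K)) * e" using K by (simp add: field_simps)
    finally show ?thesis .
  qed
  show ?thesis
  proof (cases "x0 \<le> x")
    case True
    have I: "((\<lambda>t. B * (K * exp (2 * K * (t - x0))) + m) has_integral (B * ((exp (2 * K * (x - x0)) - 1) / 2) + m * (x - x0))) {x0..x}"
      using has_integral_add[OF has_integral_mult_right[OF has_integral_exp_weight[OF K True], of B] has_integral_const_real[of m x0 x]] True
      by (simp add: mult.commute)
    have bt: "norm (g t) \<le> B * (K * exp (2 * K * (t - x0))) + m" if "t \<in> {x0..x}" for t
    proof -
      have "\<bar>t - x0\<bar> = t - x0" using that by simp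
      then show ?thesis using b(1)[of t] by (simp only: mult_ac)
    qed
    have "volt x0 g x = integral {x0..x} g" using True by (cases "x = x0") (auto simp: volt_def)
    also have "norm \<dots> \<le> integral {x0..x} (\<lambda>t. B * (K * exp (2 * K * (t - x0))) + m)"
      by (rule integral_norm_bound_integral[OF ic has_integral_integrable[OF I]])
        (rule bt)
    also have "\<dots> = B * ((e - 1) / 2) + m * \<bar>x - x0\<bar>" using integral_unique[OF I] True by (simp add: e_def)
    finally show ?thesis using fin by (simp add: e_def)
  next
    case False
    then have "x \<le> x0" by simp
    \<comment> \<open>To the left of \<open>x0\<close> the weight is the mirror image, so its
      integral comes from the formula on the right by reflection.\<close>
    have "((\<lambda>t. K * exp (2 * K * (t - - x0))) has_integral (exp (2 * K * (- x - - x0)) - 1) / 2) {- x0.. - x}"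
      using has_integral_exp_weight[OF K, of "-x0" "-x"] \<open>x \<le> x0\<close> by simp
    then have "((\<lambda>t. K * exp (2 * K * (- t - - x0))) has_integral (exp (2 * K * (- x - - x0)) - 1) / 2) {x.. x0}"
      by (subst has_integral_reflect_real[symmetric]) simp
    from has_integral_add[OF has_integral_mult_right[OF this, of B] has_integral_const_real[of m x x0]]
    have I: "((\<lambda>t. B * (K * exp (2 * K * (x0 - t))) + m) has_integral (B * ((exp (2 * K * (x0 - x)) - 1) / 2) + m * (x0 - x))) {x..x0}"
      using False by (simp add: mult.commute algebra_simps)
    have bt: "norm (g t) \<le> B * (K * exp (2 * K * (x0 - t))) + m" if "t \<in> {x..x0}" for t
    proof -
      have "\<bar>t - x0\<bar> = x0 - t" using that by simp
      then show ?thesis using b(1)[of t] by (simp only: mult_ac)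
    qed
    have "volt x0 g x = - integral {x..x0} g" using False by (auto simp: volt_def)
    also have "norm \<dots> = norm (integral {x..x0} g)" by simp
    also have "\<dots> \<le> integral {x..x0} (\<lambda>t. B * (K * exp (2 * K * (x0 - t))) + m)"
      by (rule integral_norm_bound_integral[OF ic has_integral_integrable[OF I]])
        (rule bt)
    also have "\<dots> = B * ((e - 1) / 2) + m * \<bar>x - x0\<bar>" using integral_unique[OF I] False by (simp add: e_def)
    finally show ?thesis using fin by (simp add: e_def)
  qed
qed

text \<open>The Volterra operator is a contraction for the norm weighted by
  \<open>exp (- 2 K \<bar>x - x0\<bar>)\<close>.\<close>

lemma lipschitz_ode_solution:
  fixes f :: "real \<Rightarrow> 'a::banach \<Rightarrow> 'a"
  assumes cont: "continuous_on UNIV (\<lambda>(x, y). f x y)"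
    and lip: "\<And>x y z. norm (f x y - f x z) \<le> K * norm (y - z)"
    and bd: "\<And>x. norm (f x 0) \<le> m" and K: "K > 0"
  obtains y where "y x0 = p" "\<And>x. (y has_vector_derivative f x (y x)) (at x)"
    "\<And>x. norm (y x) \<le> 2 * (norm p + m / (2 * K)) * exp (2 * K * \<bar>x - x0\<bar>)"
proof -
  define E where "E x = exp (2 * K * \<bar>x - x0\<bar>)" for x
  have E: "E x \<ge> 1" "E x > 0" for x using K by (auto simp: E_def)
  have contE: "continuous_on S E" for S unfolding E_def by (intro continuous_intros)
  have m: "m \<ge> 0" using bd[of 0] norm_ge_zero[of "f 0 0"] by linarith
  have contf: "continuous_on UNIV (\<lambda>x. f x (y x))" if "continuous_on UNIV y" for y
    using continuous_on_compose2[OF cont, of UNIV "\<lambda>x. (x, y x)"] that by (simp add: continuous_on_Pair)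
  \<comment> \<open>The Picard map conjugated by the weight, with v = y / E: a solution y of
    exponential growth becomes a bounded v, and the contraction takes place among bounded continuous
    functions with the sup norm.\<close>
  define T where "T v x = (1 / E x) *\<^sub>R (p + volt x0 (\<lambda>t. f t (E t *\<^sub>R v t)) x)" for v x
  \<comment> \<open>This estimate has two uses: T preserves boundedness, and applied to the fixed
    point itself it gives the growth bound of the conclusion.\<close>
  have Tb: "norm (T v x - (1 / E x) *\<^sub>R p) \<le> B / 2 + m / (2 * K)" 
    if v: "continuous_on UNIV v" "\<And>x. norm (v x) \<le> B" "B \<ge> 0" for v B x
  proof -
    have "norm (f t (E t *\<^sub>R v t)) \<le> K * B * E t + m" for t
    proof -
      have "norm (f t (E t *\<^sub>R v t)) \<le> norm (f t (E t *\<^sub>R v t) - f t 0) + norm (f t 0)"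
        using norm_triangle_ineq[of "f t (E t *\<^sub>R v t) - f t 0" "f t 0"] by simp
      also have "\<dots> \<le> K * norm (E t *\<^sub>R v t - 0) + m" using lip bd by (intro add_mono)
      also have "norm (E t *\<^sub>R v t - 0) \<le> B * E t" using v(2)[of t] E(2)[of t] by (simp add: mult.commute)
      finally show ?thesis using K by (simp add: mult_left_mono mult.assoc)
    qed
    then have "norm (volt x0 (\<lambda>t. f t (E t *\<^sub>R v t)) x) \<le> (B / 2 + m / (2 * K)) * E x"
      unfolding E_def by (intro volt_bound[OF _ K] contf[unfolded E_def] v m)
        (auto intro!: continuous_intros v contf)
    moreover have "T v x - (1 / E x) *\<^sub>R p = (1 / E x) *\<^sub>R volt x0 (\<lambda>t. f t (E t *\<^sub>R v t)) x"
      by (simp add: T_def scaleR_add_right)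
    ultimately show ?thesis using E(2)[of x] by (simp add: field_simps)
  qed
  have Tc: "continuous_on UNIV (T v)" if v: "continuous_on UNIV v" for v
  proof -
    have "continuous_on UNIV (volt x0 (\<lambda>t. f t (E t *\<^sub>R v t)))"
      by (intro continuous_at_imp_continuous_on ballI has_vector_derivative_continuous[OF volt_has_derivative] contf
          continuous_intros contE v)
    then show ?thesis unfolding T_def using E by (intro continuous_intros contE) (auto simp: less_imp_neq[symmetric])
  qed
  have Tbc: "T v \<in> bcontfun" if "v \<in> bcontfun" for v
  proof -
    from that have v: "continuous_on UNIV v" and "bounded (range v)" by (auto simp: bcontfun_def)
    then obtain B where B: "B > 0" "\<And>x. norm (v x) \<le> B" by (auto simp: bounded_pos)
    have "norm (T v x) \<le> B / 2 + m / (2 * K) + norm p" for x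
    proof -
      have "norm ((1 / E x) *\<^sub>R p) \<le> norm p" using E(2)[of x] mult_right_mono[OF E(1), of "norm p" x] by (simp add: field_simps)
      then show ?thesis using Tb[OF v B(2), of x] B(1) norm_triangle_sub[of "T v x" "(1 / E x) *\<^sub>R p"] by simp
    qed
    then show ?thesis using Tc[OF v] by (auto simp: bcontfun_def bounded_iff)
  qed
  define TT where "TT v = Bcontfun (T (apply_bcontfun v))" for v
  have TT: "apply_bcontfun (TT v) = T v" for v
    unfolding TT_def by (rule Bcontfun_inverse) (simp add: Tbc apply_bcontfun)
  have "dist (TT v) (TT w) \<le> 1/2 * dist v w" for v w
  proof (rule dist_bound)
    fix x
    let ?g = "\<lambda>v t. f t (E t *\<^sub>R apply_bcontfun v t)"
    have c: "continuous_on UNIV (?g v)" for v by (auto intro!: contf continuous_intros contE)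
    have "norm (?g v t - ?g w t) \<le> K * dist v w * exp (2 * K * \<bar>t - x0\<bar>) + 0" for t
    proof -
      have "norm (?g v t - ?g w t) \<le> K * norm (E t *\<^sub>R v t - E t *\<^sub>R w t)" by (rule lip)
      also have "norm (E t *\<^sub>R v t - E t *\<^sub>R w t) = E t * dist (v t) (w t)"
        using E(2)[of t] by (simp add: dist_norm flip: scaleR_diff_right)
      also have "\<dots> \<le> E t * dist v w" using E(2)[of t] by (intro mult_left_mono dist_bounded) auto
      finally show ?thesis using K by (simp add: E_def algebra_simps)
    qed
    then have "norm (volt x0 (\<lambda>t. ?g v t - ?g w t) x) \<le> (dist v w / 2 + 0 / (2 * K)) * exp (2 * K * \<bar>x - x0\<bar>)"
      by (intro volt_bound K continuous_on_diff c) auto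
    moreover have "volt x0 (\<lambda>t. ?g v t - ?g w t) x = volt x0 (?g v) x - volt x0 (?g w) x"
      unfolding volt_def using c
      by (subst (1 2) integral_diff) (auto intro!: integrable_continuous_interval intro: continuous_on_subset)
    ultimately have le: "norm (volt x0 (?g v) x - volt x0 (?g w) x) \<le> dist v w / 2 * E x" by (simp add: E_def)
    have "dist (TT v x) (TT w x) = norm ((1 / E x) *\<^sub>R (volt x0 (?g v) x - volt x0 (?g w) x))"
      unfolding TT dist_norm T_def by (simp flip: scaleR_diff_right)
    also have "\<dots> = (1 / E x) * norm (volt x0 (?g v) x - volt x0 (?g w) x)"
      using E(2)[of x] unfolding norm_scaleR by (simp add: abs_of_pos)
    also have "\<dots> \<le> (1 / E x) * (dist v w / 2 * E x)"
      using E(2)[of x] by (intro mult_left_mono[OF le]) simp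
    also have "\<dots> = 1/2 * dist v w" using E(2)[of x] by simp
    finally show "dist (TT v x) (TT w x) \<le> 1/2 * dist v w" .
  qed
  then obtain v where v: "TT v = v"
    using ex1_implies_ex[OF banach_fix_type[of "1/2" TT]] by auto
  then have Tv: "T v = v" using TT[of v] by simp
  define y where "y x = E x *\<^sub>R v x" for x
  have y: "y x = p + volt x0 (\<lambda>t. f t (y t)) x" for x
  proof -
    have "y x = E x *\<^sub>R T v x" by (simp add: y_def Tv)
    then show ?thesis using E(2)[of x] by (simp add: T_def y_def)
  qed
  have cy: "continuous_on UNIV y" unfolding y_def by (auto intro!: continuous_intros contE)
  show thesis
  proof (rule that[of y])
    show "y x0 = p" by (subst y) (simp add: volt_same)
    show "(y has_vector_derivative f x (y x)) (at x)" for x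
    proof -
      have "((\<lambda>x. p + volt x0 (\<lambda>t. f t (y t)) x) has_vector_derivative 0 + f x (y x)) (at x)"
        by (rule has_vector_derivative_add[OF has_vector_derivative_const volt_has_derivative[OF contf[OF cy]]])
      moreover have "(\<lambda>x. p + volt x0 (\<lambda>t. f t (y t)) x) = y" by (rule ext) (rule y[symmetric])
      ultimately show ?thesis by (simp only: add_0)
    qed
    show "norm (y x) \<le> 2 * (norm p + m / (2 * K)) * exp (2 * K * \<bar>x - x0\<bar>)" for x
    proof -
      have nb: "norm (v t) \<le> norm v / 2 + m / (2 * K) + norm p" for t
      proof -
        have "norm (T v t - (1 / E t) *\<^sub>R p) \<le> norm v / 2 + m / (2 * K)" by (rule Tb) (auto simp: norm_bounded)
        moreover have "norm ((1 / E t) *\<^sub>R p) \<le> norm p" using E(2)[of t] mult_right_mono[OF E(1), of "norm p" t] by (simp add: field_simps)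
        ultimately show ?thesis using norm_triangle_sub[of "T v t" "(1 / E t) *\<^sub>R p"] by (simp add: Tv)
      qed
      have "norm v \<le> norm v / 2 + m / (2 * K) + norm p" by (rule norm_bound) (rule nb)
      \<comment> \<open>Absorbing the half of \<open>norm v\<close> on the right is the origin of
        the factor 2 in the growth bound.\<close>
      then have "norm v \<le> 2 * (norm p + m / (2 * K))" by simp
      then have "norm (v x) \<le> 2 * (norm p + m / (2 * K))" using norm_bounded[of v x] by linarith
      then have "norm (v x) * E x \<le> 2 * (norm p + m / (2 * K)) * E x"
        by (rule mult_right_mono) (use E(2)[of x] in simp)
      moreover have "norm (y x) = norm (v x) * E x" using E(2)[of x] by (simp add: y_def)
      ultimately show ?thesis by (simp only: E_def)
    qed
  qed
qed

text \<open>Gronwall for the squared norm: |d|^2 exp (s x) is monotone because |d \<bullet> d'|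
  \<le> K |d|^2, with s = -2K to the right of \<open>x0\<close> and s = 2K to the left. It is
  non-negative and at most its value 0 at \<open>x0\<close>.\<close>

lemma ode_unique:
  fixes d :: "real \<Rightarrow> 'a::real_inner"
  assumes der: "\<And>x. (d has_vector_derivative d' x) (at x)" and b: "\<And>x. norm (d' x) \<le> K * norm (d x)"
    and 0: "d x0 = 0"
  shows "d x = 0"
proof -
  have D: "((\<lambda>x. (d x \<bullet> d x) * exp (s * x)) has_real_derivative (2 * (d x \<bullet> d' x) + s * (d x \<bullet> d x)) * exp (s * x)) (at x)" for x s
  proof -
    have "((\<lambda>x. d x \<bullet> d x) has_vector_derivative d x \<bullet> d' x + d' x \<bullet> d x) (at x)"
      by (rule bounded_bilinear.has_vector_derivative[OF bounded_bilinear_inner der der])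
    then have 1: "((\<lambda>x. d x \<bullet> d x) has_real_derivative 2 * (d x \<bullet> d' x)) (at x)"
      by (simp add: has_real_derivative_iff_has_vector_derivative inner_commute)
    show ?thesis
      by (auto intro!: derivative_eq_intros 1 simp: algebra_simps)
  qed
  have i: "\<bar>d x \<bullet> d' x\<bar> \<le> K * (d x \<bullet> d x)" for x
  proof -
    have "\<bar>d x \<bullet> d' x\<bar> \<le> norm (d x) * norm (d' x)" by (rule Cauchy_Schwarz_ineq2)
    also have "\<dots> \<le> norm (d x) * (K * norm (d x))" using b by (intro mult_left_mono) auto
    finally show ?thesis by (simp add: power2_norm_eq_inner[symmetric] power2_eq_square algebra_simps)
  qed
  have "(d x \<bullet> d x) * exp (s * x) \<le> 0" if "s = (if x0 \<le> x then - 2 * K else 2 * K)" for s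
  proof (cases "x0 \<le> x")
    case True
    have "(d x \<bullet> d x) * exp (s * x) \<le> (d x0 \<bullet> d x0) * exp (s * x0)"
    proof (rule DERIV_nonpos_imp_nonincreasing[OF True])
      show "\<exists>y. ((\<lambda>x. (d x \<bullet> d x) * exp (s * x)) has_real_derivative y) (at t) \<and> y \<le> 0" for t
        using i[of t] True that by (intro exI[of _ "(2 * (d t \<bullet> d' t) + s * (d t \<bullet> d t)) * exp (s * t)"] conjI D)
          (auto intro!: mult_nonpos_nonneg)
    qed
    then show ?thesis using 0 by simp
  next
    case False
    have "(d x \<bullet> d x) * exp (s * x) \<le> (d x0 \<bullet> d x0) * exp (s * x0)"
    proof (rule DERIV_nonneg_imp_nondecreasing[of x x0])
      show "\<exists>y. ((\<lambda>x. (d x \<bullet> d x) * exp (s * x)) has_real_derivative y) (at t) \<and> 0 \<le> y" for t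
        using i[of t] False that by (intro exI[of _ "(2 * (d t \<bullet> d' t) + s * (d t \<bullet> d t)) * exp (s * t)"] conjI D)
          (auto intro!: mult_nonneg_nonneg)
    qed (use False in auto)
    then show ?thesis using 0 by simp
  qed
  then have "d x \<bullet> d x \<le> 0" by (simp add: mult_le_0_iff)
  then have "d x \<bullet> d x = 0" using inner_ge_zero[of "d x"] by linarith
  then show ?thesis by simp
qed

section \<open>Smooth and periodic functions of one variable\<close>

text \<open>One-variable counterpart of \<open>Ck_on\<close> in terms of \<open>Dx\<close>. Level n
  asks only that n derivatives exist; their continuity is supplied by the next level, which is why
  \<open>ndiff (Suc n)\<close> yields \<open>Ck_on n\<close>.\<close>

primrec ndiff :: "nat \<Rightarrow> (real \<Rightarrow> 'a::real_normed_vector) \<Rightarrow> bool" where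
  "ndiff 0 f \<longleftrightarrow> True"
| "ndiff (Suc n) f \<longleftrightarrow> (\<forall>x. f differentiable (at x)) \<and> ndiff n (Dx f)"

definition smooth1 :: "(real \<Rightarrow> 'a::real_normed_vector) \<Rightarrow> bool" where
  "smooth1 f \<longleftrightarrow> (\<forall>n. ndiff n f)"

lemma Dx_eqI: "(f has_vector_derivative d) (at x) \<Longrightarrow> Dx f x = d"
  unfolding Dx_def by (rule vector_derivative_at)

lemma Dx_ext: "(\<And>x. (f has_vector_derivative d x) (at x)) \<Longrightarrow> Dx f = d"
  by (auto simp: fun_eq_iff intro: Dx_eqI)

lemma Dx_works: "f differentiable (at x) \<Longrightarrow> (f has_vector_derivative Dx f x) (at x)"
  unfolding Dx_def by (simp add: vector_derivative_works)

lemma ndiff_Suc_I: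
  "(\<And>x. (f has_vector_derivative g x) (at x)) \<Longrightarrow> ndiff n g \<Longrightarrow> ndiff (Suc n) f"
  using Dx_ext[of f g] differentiableI_vector by auto

lemma ndiff_SucD: "ndiff (Suc n) f \<Longrightarrow> (f has_vector_derivative Dx f x) (at x)"
  by (auto intro: Dx_works)

lemma ndiff_mono: "ndiff n f \<Longrightarrow> m \<le> n \<Longrightarrow> ndiff m f"
proof (induction n arbitrary: f m)
  case (Suc n) then show ?case by (cases m) auto
qed auto

lemma ndiff_const: "ndiff n (\<lambda>x. a)"
proof (induction n arbitrary: a)
  case (Suc n)
  show ?case by (rule ndiff_Suc_I[of _ "\<lambda>x. 0"]) (use Suc in auto)
qed auto

lemma ndiff_add: "ndiff n f \<Longrightarrow> ndiff n g \<Longrightarrow> ndiff n (\<lambda>x. f x + g x)"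
proof (induction n arbitrary: f g)
  case (Suc n)
  show ?case
    by (rule ndiff_Suc_I[of _ "\<lambda>x. Dx f x + Dx g x"])
      (use Suc in \<open>auto intro!: has_vector_derivative_add Dx_works\<close>)
qed auto

lemma ndiff_bounded_linear:
  assumes "bounded_linear T"
  shows "ndiff n f \<Longrightarrow> ndiff n (\<lambda>x. T (f x))"
proof (induction n arbitrary: f)
  case (Suc n)
  show ?case
    by (rule ndiff_Suc_I[of _ "\<lambda>x. T (Dx f x)"])
      (use Suc in \<open>auto intro!: bounded_linear.has_vector_derivative[OF assms] Dx_works\<close>)
qed auto

lemma ndiff_mult:
  fixes f g :: "real \<Rightarrow> 'a::real_normed_algebra"
  shows "ndiff n f \<Longrightarrow> ndiff n g \<Longrightarrow> ndiff n (\<lambda>x. f x * g x)"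
proof (induction n arbitrary: f g)
  case (Suc n)
  have "ndiff n f" "ndiff n g" using Suc.prems ndiff_mono[of "Suc n" _ n] by auto
  then have "ndiff n (\<lambda>x. f x * Dx g x + Dx f x * g x)"
    using Suc by (intro ndiff_add Suc.IH) auto
  then show ?case
    by (rule ndiff_Suc_I[rotated])
      (use Suc.prems in \<open>auto intro!: has_vector_derivative_mult Dx_works\<close>)
qed auto

lemma smooth1_const: "smooth1 (\<lambda>x. a)"
  and smooth1_add: "smooth1 f \<Longrightarrow> smooth1 g \<Longrightarrow> smooth1 (\<lambda>x. f x + g x)"
  and smooth1_bl: "bounded_linear T \<Longrightarrow> smooth1 f \<Longrightarrow> smooth1 (\<lambda>x. T (f x))"
  by (auto simp: smooth1_def ndiff_const ndiff_add ndiff_bounded_linear)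

lemma smooth1_mult:
  fixes f g :: "real \<Rightarrow> 'a::real_normed_algebra"
  shows "smooth1 f \<Longrightarrow> smooth1 g \<Longrightarrow> smooth1 (\<lambda>x. f x * g x)"
  by (auto simp: smooth1_def ndiff_mult)

lemma smooth1_minus: "smooth1 f \<Longrightarrow> smooth1 (\<lambda>x. - f x)"
  using smooth1_bl[OF bounded_linear_minus[OF bounded_linear_ident]] by auto

lemma smooth1_diff: "smooth1 f \<Longrightarrow> smooth1 g \<Longrightarrow> smooth1 (\<lambda>x. f x - g x)"
  using smooth1_add[of f "\<lambda>x. - g x"] smooth1_minus[of g] by auto

lemma smooth1_of_real:
  "smooth1 f \<Longrightarrow> smooth1 (\<lambda>x. of_real (f x) :: 'a::{real_normed_algebra_1,real_inner})"
  by (rule smooth1_bl[OF bounded_linear_of_real])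

lemma smooth1_Dx: "smooth1 f \<Longrightarrow> smooth1 (Dx f)"
  unfolding smooth1_def using ndiff.simps(2) by blast

lemma smooth1_D: "smooth1 f \<Longrightarrow> (f has_vector_derivative Dx f x) (at x)"
  unfolding smooth1_def using ndiff_SucD by blast

lemmas smooth1_intros = smooth1_const smooth1_add smooth1_mult smooth1_minus smooth1_diff
  smooth1_of_real smooth1_Dx

lemma smooth1_continuous: "smooth1 f \<Longrightarrow> continuous_on S f"
  by (meson continuous_at_imp_continuous_on has_vector_derivative_continuous smooth1_D)

lemma Dx_const: "Dx (\<lambda>x. a) = (\<lambda>x. 0)"
  by (rule Dx_ext) auto

lemma Dx_cmult:
  fixes f :: "real \<Rightarrow> 'a::real_normed_algebra"
  shows "smooth1 f \<Longrightarrow> Dx (\<lambda>x. a * f x) = (\<lambda>x. a * Dx f x)"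
  by (rule Dx_ext) (intro has_vector_derivative_mult_right smooth1_D)

lemma Dx_of_real:
  "smooth1 f \<Longrightarrow> Dx (\<lambda>x. of_real (f x) :: 'a::{real_normed_algebra_1,real_inner}) = (\<lambda>x. of_real (Dx f x))"
  by (rule Dx_ext) (auto intro!: bounded_linear.has_vector_derivative[OF bounded_linear_of_real] smooth1_D)

lemma frechet_Dx:
  assumes "f differentiable (at x)" shows "frechet_derivative f (at x) v = v *\<^sub>R Dx f x"
  using frechet_derivative_at[OF Dx_works[OF assms, unfolded has_vector_derivative_def]]
  by (metis (mono_tags))

lemma ndiff_Ck_on_UNIV: "ndiff (Suc n) f \<Longrightarrow> Ck_on n UNIV f"
proof (induction n arbitrary: f)
  case 0
  then show ?case
    by (auto intro!: continuous_at_imp_continuous_on differentiable_imp_continuous_within)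
next
  case (Suc n)
  have "(\<lambda>x. frechet_derivative f (at x) v) = (\<lambda>x. v *\<^sub>R Dx f x)" for v
    using Suc.prems by (auto simp: frechet_Dx)
  moreover have "Ck_on n UNIV (\<lambda>x. v *\<^sub>R Dx f x)" for v
    by (rule Suc.IH) (use Suc.prems ndiff_bounded_linear[OF bounded_linear_scaleR_right, of "Suc n" "Dx f"] in auto)
  ultimately show ?case using Suc.prems by auto
qed

lemma per_smoothI: "smooth1 f \<Longrightarrow> periodic1 f \<Longrightarrow> per_smooth f"
  by (simp add: per_smooth_def smooth_on_def smooth1_def ndiff_Ck_on_UNIV del: ndiff.simps)

lemma has_vector_derivative_shift1: "((\<lambda>x. x + 1) has_vector_derivative (1::real)) (at x)"
  by (auto intro!: derivative_eq_intros)

lemma periodic1_derivative: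
  assumes f: "\<And>x. (f has_vector_derivative f' x) (at x)" and p: "periodic1 f"
  shows "periodic1 f'"
  unfolding periodic1_def
proof
  fix x
  have "((\<lambda>x. f (x + 1)) has_vector_derivative f' (x + 1)) (at x)"
    using vector_diff_chain_at[OF has_vector_derivative_shift1 f] by (simp add: o_def)
  then have "(f has_vector_derivative f' (x + 1)) (at x)" using p by (simp add: periodic1_def)
  from vector_derivative_unique_at[OF this f] show "f' (x + 1) = f' x" .
qed

lemma periodic1_Dx: "periodic1 f \<Longrightarrow> smooth1 f \<Longrightarrow> periodic1 (Dx f)"
  by (rule periodic1_derivative[OF smooth1_D])

section \<open>The Bloch operator as a polynomial in \<nu>\<close>

lemma Dnu_lincomb:
  assumes f: "smooth1 f"
  shows "Dnu \<nu> (\<lambda>x. a * Dx (Dx (Dx f)) x + b * Dx (Dx f) x + c * Dx f x + d * f x) =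
    (\<lambda>x. a * Dx (Dx (Dx (Dx f))) x + (b + \<nu> * a) * Dx (Dx (Dx f)) x + (c + \<nu> * b) * Dx (Dx f) x
      + (d + \<nu> * c) * Dx f x + \<nu> * d * f x)"
proof -
  have "Dx (\<lambda>x. a * Dx (Dx (Dx f)) x + b * Dx (Dx f) x + c * Dx f x + d * f x) =
    (\<lambda>x. a * Dx (Dx (Dx (Dx f))) x + b * Dx (Dx (Dx f)) x + c * Dx (Dx f) x + d * Dx f x)"
    by (rule Dx_ext)
      (intro has_vector_derivative_add has_vector_derivative_mult_right smooth1_D smooth1_Dx f)
  then show ?thesis by (simp add: Dnu_def fun_eq_iff algebra_simps)
qed

text \<open>Each power of d/dx + \<nu> arises from the preceding one by \<open>Dnu_lincomb\<close>,
  which produces the binomial coefficients. In this form all expansions in \<nu> become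
  commutative-ring identities at a point x.\<close>

lemma bloch_op_expand:
  assumes f: "smooth1 f" and V: "smooth1 V"
  shows "bloch_op \<delta> k V s \<nu> f x =
    of_real k * (of_real (6 * V x - s) * Dx f x + of_real (6 * Dx V x) * f x + \<nu> * of_real (6 * V x - s) * f x)
    + of_real (k^3) * (Dx (Dx (Dx f)) x + 3 * \<nu> * Dx (Dx f) x + 3 * \<nu>^2 * Dx f x + \<nu>^3 * f x)
    + of_real \<delta> * (of_real (k^2) * (Dx (Dx f) x + 2 * \<nu> * Dx f x + \<nu>^2 * f x)
      + of_real (k^4) * (Dx (Dx (Dx (Dx f))) x + 4 * \<nu> * Dx (Dx (Dx f)) x + 6 * \<nu>^2 * Dx (Dx f) x
         + 4 * \<nu>^3 * Dx f x + \<nu>^4 * f x))"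
proof -
  note L = Dnu_lincomb[OF f, of \<nu>]
  have 2: "(Dnu \<nu> ^^ 2) f = (\<lambda>x. Dx (Dx f) x + 2 * \<nu> * Dx f x + \<nu>^2 * f x)"
  proof -
    have "Dnu \<nu> f = (\<lambda>x. Dx f x + \<nu> * f x)" by (simp add: Dnu_def fun_eq_iff)
    then have "(Dnu \<nu> ^^ 2) f = Dnu \<nu> (\<lambda>x. Dx f x + \<nu> * f x)" by (simp add: numeral_2_eq_2)
    then show ?thesis using L[of 0 0 1 \<nu>]
      by (simp add: fun_eq_iff) (simp add: algebra_simps power2_eq_square)
  qed
  moreover have 3: "(Dnu \<nu> ^^ 3) f = (\<lambda>x. Dx (Dx (Dx f)) x + 3 * \<nu> * Dx (Dx f) x + 3 * \<nu>^2 * Dx f x + \<nu>^3 * f x)"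
  proof -
    have "(Dnu \<nu> ^^ 3) f = Dnu \<nu> ((Dnu \<nu> ^^ 2) f)" by (simp add: numeral_3_eq_3 numeral_2_eq_2)
    then show ?thesis using L[of 0 1 "2 * \<nu>" "\<nu>^2"] unfolding 2
      by (simp add: fun_eq_iff) (simp add: algebra_simps power2_eq_square power3_eq_cube)
  qed
  moreover have "(Dnu \<nu> ^^ 4) f = (\<lambda>x. Dx (Dx (Dx (Dx f))) x + 4 * \<nu> * Dx (Dx (Dx f)) x + 6 * \<nu>^2 * Dx (Dx f) x
         + 4 * \<nu>^3 * Dx f x + \<nu>^4 * f x)"
  proof -
    have "(Dnu \<nu> ^^ 4) f = Dnu \<nu> ((Dnu \<nu> ^^ 3) f)" by (simp add: eval_nat_numeral)
    then show ?thesis using L[of 1 "3 * \<nu>" "3 * \<nu>^2" "\<nu>^3"] unfolding 3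
      by (simp add: fun_eq_iff) (simp add: algebra_simps power2_eq_square power3_eq_cube power4_eq_xxxx)
  qed
  moreover have "Dnu \<nu> (\<lambda>y. of_real (6 * V y - s) * f y) x =
    of_real (6 * V x - s) * Dx f x + of_real (6 * Dx V x) * f x + \<nu> * of_real (6 * V x - s) * f x"
  proof -
    have "((\<lambda>y. of_real (6 * V y - s) * f y) has_vector_derivative of_real (6 * V x - s) * Dx f x + of_real (6 * Dx V x) * f x) (at x)"
      by (rule has_vector_derivative_mult[OF bounded_linear.has_vector_derivative[OF bounded_linear_of_real]])
        (auto intro!: derivative_eq_intros smooth1_D f V)
    then show ?thesis by (simp add: Dnu_def Dx_eqI)
  qed
  ultimately show ?thesis by (simp add: bloch_op_def)
qed

lemma lin_op_bloch_op: "lin_op \<delta> k V s f = bloch_op \<delta> k V s 0 f"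
proof -
  have "Dnu 0 = Dx" by (simp add: Dnu_def fun_eq_iff)
  then show ?thesis by (simp add: lin_op_def bloch_op_def)
qed

lemma lin_op_expand:
  assumes f: "smooth1 f" and V: "smooth1 V"
  shows "lin_op \<delta> k V s f x =
    of_real k * (of_real (6 * V x - s) * Dx f x + of_real (6 * Dx V x) * f x)
    + of_real (k^3) * Dx (Dx (Dx f)) x
    + of_real \<delta> * (of_real (k^2) * Dx (Dx f) x + of_real (k^4) * Dx (Dx (Dx (Dx f))) x)"
  by (simp add: lin_op_bloch_op bloch_op_expand[OF assms])

text \<open>If f, f1, f2, f3 are n times differentiable, so is the right-hand side of the last
  equation, and then all four are n + 1 times differentiable. This serves kernel elements and Bloch
  eigenfunctions alike.\<close>

lemma ode4_bootstrap:
  fixes f :: "real \<Rightarrow> 'a::real_normed_algebra"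
  assumes 0: "\<And>x. (f has_vector_derivative f1 x) (at x)" and 1: "\<And>x. (f1 has_vector_derivative f2 x) (at x)"
    and 2: "\<And>x. (f2 has_vector_derivative f3 x) (at x)"
    and 3: "\<And>x. (f3 has_vector_derivative a0 x * f x + a1 x * f1 x + a2 x * f2 x + a3 x * f3 x) (at x)"
    and a: "smooth1 a0" "smooth1 a1" "smooth1 a2" "smooth1 a3"
  shows "smooth1 f"
proof -
  have "ndiff n f \<and> ndiff n f1 \<and> ndiff n f2 \<and> ndiff n f3" for n
  proof (induction n)
    case (Suc n)
    have "ndiff n (\<lambda>x. a0 x * f x + a1 x * f1 x + a2 x * f2 x + a3 x * f3 x)"
      using a Suc by (intro ndiff_add ndiff_mult) (auto simp: smooth1_def)
    then show ?case using Suc ndiff_Suc_I[OF 0] ndiff_Suc_I[OF 1] ndiff_Suc_I[OF 2] ndiff_Suc_I[OF 3]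
      by blast
  qed auto
  then show ?thesis by (auto simp: smooth1_def)
qed

section \<open>Averages over a period and periodic antiderivatives\<close>

lemma avg_integral_Dx:
  fixes f :: "real \<Rightarrow> 'a::banach"
  assumes "\<And>x. (f has_vector_derivative g x) (at x)" "periodic1 f"
  shows "avg g = 0"
proof -
  have "(g has_integral (f 1 - f 0)) {0..1}"
    by (rule fundamental_theorem_of_calculus) (auto intro: assms(1) has_vector_derivative_at_within)
  moreover have "f 1 = f 0" using assms(2)[unfolded periodic1_def, rule_format, of 0] by simp
  ultimately show ?thesis by (simp add: avg_def integral_unique)
qed

lemma avg_add: "continuous_on UNIV f \<Longrightarrow> continuous_on UNIV g \<Longrightarrow> avg (\<lambda>x. f x + g x) = avg f + avg (g::real\<Rightarrow>'a::banach)"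
  and avg_diff: "continuous_on UNIV f \<Longrightarrow> continuous_on UNIV g \<Longrightarrow> avg (\<lambda>x. f x - g x) = avg f - avg (g::real\<Rightarrow>'a::banach)"
  unfolding avg_def
  by (auto intro!: integral_add integral_diff integrable_continuous_interval intro: continuous_on_subset)

lemma avg_const: "avg (\<lambda>x. a) = a" by (simp add: avg_def)

lemma avg_cmult: "avg (\<lambda>x. a * f x) = a * avg (f::real\<Rightarrow>complex)"
  unfolding avg_def by (rule integral_mult_right)

lemma avg_cmult_real: "avg (\<lambda>x. a * f x) = a * avg (f::real\<Rightarrow>real)"
  unfolding avg_def by (rule integral_mult_right)

lemma avg_of_real:
  "continuous_on UNIV f \<Longrightarrow> avg (\<lambda>x. of_real (f x)) = (of_real (avg f) :: complex)"
  unfolding avg_def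
  by (intro integral_unique has_integral_of_real integrable_integral integrable_continuous_interval)
    (auto intro: continuous_on_subset)

lemma avg_bound:
  assumes "continuous_on UNIV f" "\<And>x. norm (f x) \<le> B"
  shows "norm (avg (f::real\<Rightarrow>'a::banach)) \<le> B"
  using integral_bound[of 0 1 f B] assms unfolding avg_def
  by (auto intro: continuous_on_subset)

lemma periodic1_int: assumes "periodic1 f" shows "f (x + of_int n) = f x"
proof -
  have nat: "f (x + of_nat m) = f x" for m x
  proof (induction m)
    case (Suc m)
    have "f (x + of_nat (Suc m)) = f ((x + of_nat m) + 1)" by (simp add: algebra_simps)
    also have "\<dots> = f (x + of_nat m)" using assms unfolding periodic1_def by blast
    finally show ?case using Suc by simp
  qed simp
  show ?thesis
    using nat[of x "nat n"] nat[of "x + of_int n" "nat (-n)"] by (cases "n \<ge> 0") auto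
qed

lemma periodic1_reduce: assumes "periodic1 f" obtains x' where "x0 \<le> x'" "x' \<le> x0 + 1" "f x = f x'"
proof
  let ?x = "x + of_int (- \<lfloor>x - x0\<rfloor>)"
  show "f x = f ?x" using periodic1_int[OF assms] by metis
  show "x0 \<le> ?x" "?x \<le> x0 + 1" by linarith+
qed

lemma periodic1_bounded:
  fixes f :: "real \<Rightarrow> 'a::real_normed_vector"
  assumes "continuous_on UNIV f" "periodic1 f"
  obtains B where "B > 0" "\<And>x. norm (f x) \<le> B"
proof -
  have "bounded (f ` {0..1})"
    using assms by (intro compact_imp_bounded compact_continuous_image) (auto intro: continuous_on_subset)
  then obtain B where B: "B > 0" "\<And>x. x \<in> {0..1} \<Longrightarrow> norm (f x) \<le> B"
    by (auto simp: bounded_pos)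
  show ?thesis
  proof
    show "norm (f x) \<le> B" for x
    proof -
      obtain y where "0 \<le> y" "y \<le> 0 + 1" "f x = f y" by (rule periodic1_reduce[OF assms(2)])
      then show ?thesis using B(2)[of y] by simp
    qed
  qed (use B in auto)
qed

text \<open>The increment of an antiderivative over one period is constant and equals the mean of h,
  so mean zero is what makes H periodic. Starting H at 0 and reducing to one period of length 1
  keeps the bound B.\<close>

lemma periodic_antiderivative:
  fixes h :: "real \<Rightarrow> 'a::banach"
  assumes c: "continuous_on UNIV h" and p: "periodic1 h" and a: "avg h = 0"
    and B: "\<And>x. norm (h x) \<le> B"
  obtains H where "\<And>x. (H has_vector_derivative h x) (at x)" "periodic1 H" "\<And>x. norm (H x) \<le> B"
proof -
  define H where "H = volt 0 h"
  have d: "(H has_vector_derivative h x) (at x)" for x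
    unfolding H_def by (rule volt_has_derivative[OF c])
  have p: "periodic1 H"
  proof -
    have "((\<lambda>x. H (x + 1)) has_vector_derivative h x) (at x)" for x
      using vector_diff_chain_at[OF has_vector_derivative_shift1 d] p by (simp add: o_def periodic1_def)
    then have "((\<lambda>x. H (x + 1) - H x) has_vector_derivative h x - h x) (at x within UNIV)" for x
      by (rule has_vector_derivative_diff[OF _ d])
    then have "((\<lambda>x. H (x + 1) - H x) has_vector_derivative 0) (at x within UNIV)" for x
      by simp
    from has_vector_derivative_zero_constant[OF convex_UNIV this]
    obtain C where C: "H (x + 1) - H x = C" for x
      by auto
    have "H 1 - H 0 = 0" using a by (simp add: H_def volt_def avg_def)
    then have "C = 0" using C[of 0] by simp
    then show ?thesis using C by (simp add: periodic1_def)
  qed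
  moreover have "norm (H x) \<le> B" for x
  proof -
    obtain y where y: "0 \<le> y" "y \<le> 1" "H x = H y" using periodic1_reduce[OF p, of 0 x] by (metis add_0)
    have B0: "B \<ge> 0" using B[of 0] norm_ge_zero[of "h 0"] by linarith
    have "H y = integral {0..y} h" using y by (cases "y = 0") (auto simp: H_def volt_def)
    also have "norm \<dots> \<le> B * (y - 0)"
      by (rule integral_bound) (use y B c in \<open>auto intro: continuous_on_subset\<close>)
    also have "\<dots> \<le> B" using y B0 by (simp add: mult_left_le)
    finally show ?thesis using y by simp
  qed
  ultimately show ?thesis using d that[of H] by simp
qed

section \<open>Periodic solutions of third-order linear equations\<close>

lemma norm_fst_le_norm: "norm (fst z) \<le> norm z" and norm_snd_le_norm: "norm (snd z) \<le> norm z"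
  by (cases z, simp add: norm_fst_le norm_snd_le)+

text \<open>Companion form of w''' = q0 w + q1 w' + q2 w'' + g for the state (w, w', w''). Only q0
  varies with x, because the wave profile enters the once-integrated linearization only in its
  zeroth-order coefficient.\<close>

definition comp_rhs :: "(real \<Rightarrow> complex) \<Rightarrow> complex \<Rightarrow> complex \<Rightarrow> (real \<Rightarrow> complex) \<Rightarrow> real \<Rightarrow>
    complex \<times> complex \<times> complex \<Rightarrow> complex \<times> complex \<times> complex" where
  "comp_rhs q0 q1 q2 g x y = (fst (snd y), snd (snd y), q0 x * fst y + q1 * fst (snd y) + q2 * snd (snd y) + g x)"

lemma comp_rhs_diff: "comp_rhs q0 q1 q2 g x y - comp_rhs q0 q1 q2 h x z = comp_rhs q0 q1 q2 (\<lambda>x. g x - h x) x (y - z)"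
  and comp_rhs_add: "comp_rhs q0 q1 q2 g x y + comp_rhs q0 q1 q2 h x z = comp_rhs q0 q1 q2 (\<lambda>x. g x + h x) x (y + z)"
  and comp_rhs_scale: "r *\<^sub>R comp_rhs q0 q1 q2 g x y = comp_rhs q0 q1 q2 (\<lambda>x. r *\<^sub>R g x) x (r *\<^sub>R y)"
  by (simp_all add: comp_rhs_def algebra_simps prod_eq_iff)

lemma comp_rhs_bound:
  assumes "\<And>x. norm (q0 x) \<le> A"
  shows "norm (comp_rhs q0 q1 q2 (\<lambda>x. 0) x y) \<le> (2 + A + norm q1 + norm q2) * norm y"
proof -
  have n: "norm (fst y) \<le> norm y" "norm (fst (snd y)) \<le> norm y" "norm (snd (snd y)) \<le> norm y"
    using norm_fst_le_norm[of y] norm_snd_le_norm[of y] norm_fst_le_norm[of "snd y"] norm_snd_le_norm[of "snd y"] by auto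
  have A: "A \<ge> 0" using assms[of x] norm_ge_zero[of "q0 x"] by linarith
  have "norm (comp_rhs q0 q1 q2 (\<lambda>x. 0) x y) \<le>
    norm (fst (snd y)) + (norm (snd (snd y)) + norm (q0 x * fst y + q1 * fst (snd y) + q2 * snd (snd y)))"
    unfolding comp_rhs_def by (intro order_trans[OF norm_Pair_le] add_left_mono) (simp add: norm_Pair_le)
  also have "norm (q0 x * fst y + q1 * fst (snd y) + q2 * snd (snd y)) \<le>
    norm (q0 x) * norm (fst y) + norm q1 * norm (fst (snd y)) + norm q2 * norm (snd (snd y))"
    by (intro order_trans[OF norm_triangle_ineq] add_mono) (simp_all add: norm_mult)
  also have "\<dots> \<le> A * norm y + norm q1 * norm y + norm q2 * norm y"
    using assms[of x] n A by (intro add_mono mult_mono) auto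
  finally show ?thesis using n by (simp add: algebra_simps)
qed

lemma comp_ode_unique:
  assumes A: "\<And>x. norm (q0 x) \<le> A"
    and y: "\<And>x. (y has_vector_derivative comp_rhs q0 q1 q2 g x (y x)) (at x)"
    and z: "\<And>x. (z has_vector_derivative comp_rhs q0 q1 q2 g x (z x)) (at x)"
    and e: "y x0 = z x0"
  shows "y x = z x"
proof -
  have "((\<lambda>x. y x - z x) has_vector_derivative comp_rhs q0 q1 q2 (\<lambda>x. 0) x (y x - z x)) (at x)" for x
    using has_vector_derivative_diff[OF y z, of x] unfolding comp_rhs_diff by simp
  from ode_unique[OF this comp_rhs_bound[OF A], of x0 x] e show ?thesis by simp
qed

lemma comp_ode_exists:
  fixes q1 q2 :: complex
  assumes q0: "continuous_on UNIV q0" and A: "\<And>x. norm (q0 x) \<le> A" 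
    and g: "continuous_on UNIV g" "\<And>x. norm (g x) \<le> m" and K: "K = 2 + A + norm q1 + norm q2"
  obtains y where "y x0 = p" "\<And>x. (y has_vector_derivative comp_rhs q0 q1 q2 g x (y x)) (at x)"
    "\<And>x. norm (y x) \<le> 2 * (norm p + m / (2 * K)) * exp (2 * K * \<bar>x - x0\<bar>)"
proof (rule lipschitz_ode_solution[of "comp_rhs q0 q1 q2 g" K m x0 p])
  have "A \<ge> 0" using A[of 0] norm_ge_zero[of "q0 0"] by linarith
  then show "K > 0" unfolding K using norm_ge_zero[of q1] norm_ge_zero[of q2] by linarith
  show "continuous_on UNIV (\<lambda>(x, y). comp_rhs q0 q1 q2 g x y)"
    unfolding comp_rhs_def case_prod_beta
    by (intro continuous_intros continuous_on_compose2[OF q0] continuous_on_compose2[OF g(1)]) auto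
  show "norm (comp_rhs q0 q1 q2 g x y - comp_rhs q0 q1 q2 g x z) \<le> K * norm (y - z)" for x y z
    unfolding comp_rhs_diff using comp_rhs_bound[OF A, where y = "y - z" and x = x] by (simp add: K)
  show "norm (comp_rhs q0 q1 q2 g x 0) \<le> m" for x
    using g(2)[of x] by (simp add: comp_rhs_def norm_Pair)
qed (use that in blast)

lemma comp_ode_components:
  assumes "(y has_vector_derivative comp_rhs q0 q1 q2 g x (y x)) (at x)"
  shows "((\<lambda>x. fst (y x)) has_vector_derivative fst (snd (y x))) (at x)"
    "((\<lambda>x. fst (snd (y x))) has_vector_derivative snd (snd (y x))) (at x)"
    "((\<lambda>x. snd (snd (y x))) has_vector_derivative
       q0 x * fst (y x) + q1 * fst (snd (y x)) + q2 * snd (snd (y x)) + g x) (at x)"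
proof -
  have "bounded_linear (\<lambda>y::complex \<times> complex \<times> complex. fst (snd y))"
    "bounded_linear (\<lambda>y::complex \<times> complex \<times> complex. snd (snd y))"
    by (auto intro: bounded_linear_fst_comp bounded_linear_snd_comp bounded_linear_snd bounded_linear_ident)
  note this[THEN bounded_linear.has_vector_derivative, OF assms]
    bounded_linear.has_vector_derivative[OF bounded_linear_fst assms]
  then show "((\<lambda>x. fst (y x)) has_vector_derivative fst (snd (y x))) (at x)"
    "((\<lambda>x. fst (snd (y x))) has_vector_derivative snd (snd (y x))) (at x)"
    "((\<lambda>x. snd (snd (y x))) has_vector_derivative
       q0 x * fst (y x) + q1 * fst (snd (y x)) + q2 * snd (snd (y x)) + g x) (at x)"
    by (simp_all add: comp_rhs_def)
qed

text \<open>The augmented monodromy map \<open>(p, C) \<mapsto> (y(x0 + 1) - p, p\<^sub>0)\<close> is linear and injective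
  on a finite-dimensional space, hence boundedly invertible.\<close>

lemma periodic_third_order_solvable:
  fixes q1 q2 :: complex
  assumes q0: "continuous_on UNIV q0" "periodic1 q0"
    and inj: "\<And>w w1 w2 C. (\<And>x. (w has_vector_derivative w1 x) (at x)) \<Longrightarrow>
      (\<And>x. (w1 has_vector_derivative w2 x) (at x)) \<Longrightarrow>
      (\<And>x. (w2 has_vector_derivative q0 x * w x + q1 * w1 x + q2 * w2 x + C) (at x)) \<Longrightarrow>
      periodic1 w \<Longrightarrow> w x0 = 0 \<Longrightarrow> C = 0 \<and> (\<forall>x. w x = 0)"
  obtains B where "B > 0" "\<And>g m. continuous_on UNIV g \<Longrightarrow> periodic1 g \<Longrightarrow> (\<And>x. norm (g x) \<le> m) \<Longrightarrow>
    \<exists>w w1 w2 C. (\<forall>x. (w has_vector_derivative w1 x) (at x)) \<and>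
      (\<forall>x. (w1 has_vector_derivative w2 x) (at x)) \<and>
      (\<forall>x. (w2 has_vector_derivative q0 x * w x + q1 * w1 x + q2 * w2 x + g x + C) (at x)) \<and>
      periodic1 w \<and> w x0 = 0 \<and> (\<forall>x. norm (w x) \<le> B * m \<and> norm (w1 x) \<le> B * m \<and> norm (w2 x) \<le> B * m)
      \<and> norm C \<le> B * m"
proof -
  obtain A where A: "A > 0" "\<And>x. norm (q0 x) \<le> A" using periodic1_bounded[OF q0] by blast
  define K where "K = 2 + A + norm q1 + norm q2"
  have K: "K > 0" unfolding K_def using A(1) norm_ge_zero[of q1] norm_ge_zero[of q2] by linarith
  define bc where "bc g \<longleftrightarrow> continuous_on UNIV g \<and> bounded (range g)" for g :: "real \<Rightarrow> complex"
  \<comment> \<open>The solution with data p at \<open>x0\<close> and forcing g, fixed by choice.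
    Uniqueness makes it additive in (p, g) and turns the return to p at x0 + 1 into
    periodicity.\<close>
  define sol where "sol p g = (SOME y. y x0 = p \<and> (\<forall>x. (y has_vector_derivative comp_rhs q0 q1 q2 g x (y x)) (at x)))" for p g
  have sol: "sol p g x0 = p" "(sol p g has_vector_derivative comp_rhs q0 q1 q2 g x (sol p g x)) (at x)" if "bc g" for p g x
  proof -
    from that obtain m where g: "continuous_on UNIV g" "\<And>x. norm (g x) \<le> m" by (auto simp: bc_def bounded_iff)
    obtain y where "y x0 = p" "\<And>x. (y has_vector_derivative comp_rhs q0 q1 q2 g x (y x)) (at x)"
      using comp_ode_exists[OF q0(1) A(2) g refl] by blast
    then have "\<exists>y. y x0 = p \<and> (\<forall>x. (y has_vector_derivative comp_rhs q0 q1 q2 g x (y x)) (at x))" by blast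
    from someI_ex[OF this] show "sol p g x0 = p" "(sol p g has_vector_derivative comp_rhs q0 q1 q2 g x (sol p g x)) (at x)"
      unfolding sol_def by auto
  qed
  have uniq: "y x = sol p g x" if "bc g" "y x0 = p" "\<And>x. (y has_vector_derivative comp_rhs q0 q1 q2 g x (y x)) (at x)" for y p g x
    using comp_ode_unique[OF A(2) that(3) sol(2)[OF that(1)], of x0 p x] that(2) sol(1)[OF that(1)] by simp
  have bcc: "bc (\<lambda>x. C)" for C by (simp add: bc_def image_def)
  have sol_add: "sol p g x + sol p' g' x = sol (p + p') (\<lambda>x. g x + g' x) x" if "bc g" "bc g'" for p p' g g' x
  proof (rule uniq)
    show "bc (\<lambda>x. g x + g' x)" using that by (auto simp: bc_def intro!: continuous_intros bounded_plus_comp)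
    show "((\<lambda>x. sol p g x + sol p' g' x) has_vector_derivative comp_rhs q0 q1 q2 (\<lambda>x. g x + g' x) x (sol p g x + sol p' g' x)) (at x)" for x
      unfolding comp_rhs_add[symmetric] by (intro has_vector_derivative_add sol that)
  qed (simp add: sol that)
  have sol_scale: "r *\<^sub>R sol p (\<lambda>x. C) x = sol (r *\<^sub>R p) (\<lambda>x. r *\<^sub>R C) x" for r p C x
  proof (rule uniq)
    show "((\<lambda>x. r *\<^sub>R sol p (\<lambda>x. C) x) has_vector_derivative comp_rhs q0 q1 q2 (\<lambda>x. r *\<^sub>R C) x (r *\<^sub>R sol p (\<lambda>x. C) x)) (at x)" for x
      unfolding comp_rhs_scale[symmetric]
      by (rule bounded_linear.has_vector_derivative[OF bounded_linear_scaleR_right]) (intro sol bcc)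
  qed (simp_all add: sol bcc)
  have per: "sol p g (x + 1) = sol p g x" if "bc g" "periodic1 g" "sol p g (x0 + 1) = p" for p g x
  proof (rule uniq[where y = "\<lambda>x. sol p g (x + 1)"])
    show "((\<lambda>x. sol p g (x + 1)) has_vector_derivative comp_rhs q0 q1 q2 g x (sol p g (x + 1))) (at x)" for x
      using vector_diff_chain_at[OF has_vector_derivative_shift1 sol(2)[OF that(1)], of p x] that(2) q0(2)
      by (simp add: o_def comp_rhs_def periodic1_def)
  qed (use that in auto)
  \<comment> \<open>Four complex unknowns, namely three initial values and the constant forcing,
    against four equations, namely closing the orbit after one period and vanishing at
    \<open>x0\<close>. The square shape lets injectivity give surjectivity.\<close>
  define N where "N z = (sol (fst z) (\<lambda>x. snd z) (x0 + 1) - fst z, fst (fst z))"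
    for z :: "(complex \<times> complex \<times> complex) \<times> complex"
  have lin: "linear N"
  proof (rule linearI)
    show "N (z + z') = N z + N z'" for z z'
      using sol_add[OF bcc bcc, of "fst z" "snd z" "x0 + 1" "fst z'" "snd z'"] by (simp add: N_def)
    show "N (r *\<^sub>R z) = r *\<^sub>R N z" for r z
      using sol_scale[of r "fst z" "snd z" "x0 + 1"] by (simp add: N_def scaleR_diff_right)
  qed
  have "inj N"
    unfolding linear_injective_0[OF lin]
  proof (intro allI impI)
    fix z assume z: "N z = 0"
    define y where "y = sol (fst z) (\<lambda>x. snd z)"
    have "y (x0 + 1) = fst z" using z by (simp add: N_def y_def prod_eq_iff)
    then have p: "y (x + 1) = y x" for x
      unfolding y_def by (intro per bcc) (auto simp: periodic1_def)
    have y: "(y has_vector_derivative comp_rhs q0 q1 q2 (\<lambda>x. snd z) x (y x)) (at x)" for x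
      unfolding y_def by (intro sol bcc)
    have y0: "y x0 = fst z" unfolding y_def by (intro sol bcc)
    have *: "snd z = 0 \<and> (\<forall>x. fst (y x) = 0)"
      by (rule inj[of _ "\<lambda>x. fst (snd (y x))" "\<lambda>x. snd (snd (y x))"])
        (use comp_ode_components[OF y] p y0 z in \<open>auto simp: periodic1_def N_def prod_eq_iff\<close>)
    have w0: "(\<lambda>x. fst (y x)) = (\<lambda>x. 0)" using * by auto
    have w1: "(\<lambda>x. fst (snd (y x))) = (\<lambda>x. 0)"
    proof
      show "fst (snd (y x)) = 0" for x
        using comp_ode_components(1)[OF y, of x] unfolding w0
        by (metis has_vector_derivative_const vector_derivative_at)
    qed
    have w2: "snd (snd (y x)) = 0" for x
      using comp_ode_components(2)[OF y, of x] unfolding w1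
      by (metis has_vector_derivative_const vector_derivative_at)
    have "y x0 = 0" using w0 w1 w2 by (simp add: prod_eq_iff fun_eq_iff)
    then show "z = 0" using * y0 by (simp add: prod_eq_iff)
  qed
  then obtain b where b: "b > 0" "\<And>z. b * norm z \<le> norm (N z)" using linear_inj_bounded_below_pos[OF lin] by blast
  have "surj N" using lin \<open>inj N\<close> by (rule linear_inj_imp_surj)
  define E where "E = exp (2 * K)"
  have E: "E > 0" "exp (2 * K * \<bar>x - x0\<bar>) \<le> E" if "x0 \<le> x" "x \<le> x0 + 1" for x
    using that K by (auto simp: E_def mult_left_le)
  have "E > 0" by (simp add: E_def)
  \<comment> \<open>With zero data the solution has size at most m E / K at x0 + 1; dividing by the
    lower bound b of N bounds the correcting data and constant by c m.\<close>
  define c where "c = E / (K * b)"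
  have c: "c > 0" using \<open>E > 0\<close> K b by (simp add: c_def)
  \<comment> \<open>The growth estimate over one period with data c m and forcing (1 + c) m; the
    added c covers the constant C.\<close>
  define B where "B = 2 * (c + (1 + c) / (2 * K)) * E + c"
  have BB: "2 * (c + (1 + c) / (2 * K)) * E \<le> B" "c \<le> B" using c K \<open>E > 0\<close> by (auto simp: B_def)
  show thesis
  proof (rule that[of B])
    show "B > 0" using BB c by linarith
    fix g :: "real \<Rightarrow> complex" and m :: real
    assume g: "continuous_on UNIV g" "periodic1 g" "\<And>x. norm (g x) \<le> m"
    have m: "m \<ge> 0" using g(3)[of 0] norm_ge_zero[of "g 0"] by linarith
    have bg: "bc g" using g by (auto simp: bc_def bounded_iff)
    \<comment> \<open>The correction is chosen so that its defect after one period cancels that of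
      the solution with zero data, while its value at \<open>x0\<close> stays 0.\<close>
    obtain z where z: "N z = (- sol 0 g (x0 + 1), 0)" using \<open>surj N\<close> by (metis surjD)
    have nz: "norm z \<le> c * m"
    proof -
      obtain y where y: "y x0 = 0" "\<And>x. (y has_vector_derivative comp_rhs q0 q1 q2 g x (y x)) (at x)"
        "\<And>x. norm (y x) \<le> 2 * (norm (0::complex \<times> complex \<times> complex) + m / (2 * K)) * exp (2 * K * \<bar>x - x0\<bar>)"
        using comp_ode_exists[OF q0(1) A(2) g(1,3) K_def] by blast
      have "norm (sol 0 g (x0 + 1)) \<le> m / K * E"
        using y(3)[of "x0 + 1"] uniq[OF bg y(1,2)] by (simp add: E_def)
      then have "b * norm z \<le> m / K * E" using b(2)[of z] by (simp add: z norm_Pair)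
      then show ?thesis using b(1) K by (simp add: c_def field_simps)
    qed
    let ?C = "snd z"
    define y where "y = sol (fst z) (\<lambda>x. g x + ?C)"
    have bgC: "bc (\<lambda>x. g x + ?C)" using bg bcc by (auto simp: bc_def intro!: continuous_intros bounded_plus_comp)
    have y: "(y has_vector_derivative comp_rhs q0 q1 q2 (\<lambda>x. g x + ?C) x (y x)) (at x)" for x
      unfolding y_def by (intro sol bgC)
    have y0: "y x0 = fst z" unfolding y_def by (intro sol bgC)
    have "sol 0 g (x0 + 1) + sol (fst z) (\<lambda>x. ?C) (x0 + 1) = y (x0 + 1)"
      unfolding y_def using sol_add[OF bg bcc, of 0 "x0 + 1" "fst z" ?C] by simp
    moreover have "sol (fst z) (\<lambda>x. ?C) (x0 + 1) - fst z = - sol 0 g (x0 + 1)"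
      using z by (simp add: N_def)
    ultimately have "y (x0 + 1) = fst z" by (simp add: algebra_simps)
    then have p: "y (x + 1) = y x" for x
      unfolding y_def by (intro per bgC) (use g(2) in \<open>auto simp: periodic1_def\<close>)
    have ny: "norm (y x) \<le> B * m" for x
    proof -
      obtain x' where x': "x0 \<le> x'" "x' \<le> x0 + 1" "y x = y x'"
        using p periodic1_reduce[of y x0 x] by (auto simp: periodic1_def)
      have "norm (g x + ?C) \<le> (1 + c) * m" for x
        using norm_triangle_ineq[of "g x" ?C] g(3)[of x] norm_snd_le_norm[of z] nz by (simp add: algebra_simps)
      then obtain y' where y': "y' x0 = fst z" "\<And>x. (y' has_vector_derivative comp_rhs q0 q1 q2 (\<lambda>x. g x + ?C) x (y' x)) (at x)"
        "\<And>x. norm (y' x) \<le> 2 * (norm (fst z) + ((1 + c) * m) / (2 * K)) * exp (2 * K * \<bar>x - x0\<bar>)"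
        using comp_ode_exists[OF q0(1) A(2) _ _ K_def, of "\<lambda>x. g x + ?C"] bgC unfolding bc_def by blast
      have "norm (y x') \<le> 2 * (norm (fst z) + ((1 + c) * m) / (2 * K)) * exp (2 * K * \<bar>x' - x0\<bar>)"
        using y'(3)[of x'] uniq[OF bgC y'(1,2)] by (simp add: y_def)
      also have "\<dots> \<le> 2 * (c * m + ((1 + c) * m) / (2 * K)) * E"
        using E[OF x'(1,2)] norm_fst_le_norm[of z] nz m c K by (intro mult_mono add_mono) auto
      also have "\<dots> = 2 * (c + (1 + c) / (2 * K)) * E * m" by (simp add: algebra_simps)
      also have "\<dots> \<le> B * m" using BB m by (intro mult_right_mono) auto
      finally show ?thesis using x' by simp
    qed
    have "norm ?C \<le> B * m"
      using norm_snd_le_norm[of z] nz mult_right_mono[OF BB(2) m] by linarith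
    moreover have "norm (fst (y x)) \<le> B * m" "norm (fst (snd (y x))) \<le> B * m" "norm (snd (snd (y x))) \<le> B * m" for x
      using ny[of x] norm_fst_le_norm[of "y x"] norm_snd_le_norm[of "y x"] norm_fst_le_norm[of "snd (y x)"] norm_snd_le_norm[of "snd (y x)"] by linarith+
    moreover have "fst (y x0) = 0" using z y0 by (simp add: N_def prod_eq_iff)
    ultimately show "\<exists>w w1 w2 C. (\<forall>x. (w has_vector_derivative w1 x) (at x)) \<and>
      (\<forall>x. (w1 has_vector_derivative w2 x) (at x)) \<and>
      (\<forall>x. (w2 has_vector_derivative q0 x * w x + q1 * w1 x + q2 * w2 x + g x + C) (at x)) \<and>
      periodic1 w \<and> w x0 = 0 \<and> (\<forall>x. norm (w x) \<le> B * m \<and> norm (w1 x) \<le> B * m \<and> norm (w2 x) \<le> B * m)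
      \<and> norm C \<le> B * m"
      using comp_ode_components[OF y] p
      by (intro exI[of _ "\<lambda>x. fst (y x)"] exI[of _ "\<lambda>x. fst (snd (y x))"] exI[of _ "\<lambda>x. snd (snd (y x))"] exI[of _ ?C])
        (auto simp: periodic1_def add.assoc)
  qed
qed

section \<open>Solvability of the linearized profile equation\<close>

lemma smooth1_cof: "smooth1 f \<Longrightarrow> smooth1 (\<lambda>x. complex_of_real (f x))"
  by (rule smooth1_of_real)

locale periodic_wave =
  fixes \<delta> k s :: real and V :: "real \<Rightarrow> real"
  assumes \<delta>: "\<delta> > 0" and k: "k > 0" and smoothV: "smooth1 V" and perV: "periodic1 V"
    and nonconst: "\<exists>x y. V x \<noteq> V y" and profile: "profile_eq \<delta> k V s"
    and spec: "spectral_assumption \<delta> k V s"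
begin

lemma kernel:
  assumes "smooth1 f" "periodic1 f" "\<And>x. lin_op \<delta> k V s f x = 0"
  obtains \<alpha> where "f = (\<lambda>x. \<alpha> * of_real (Dx V x))"
proof -
  have "f \<in> ker0 (lin_op \<delta> k V s)" using assms by (simp add: ker0_def per_smoothI fun_eq_iff)
  then have "f \<in> cfun.span {\<lambda>x. of_real (Dx V x)}" using spec by (simp add: spectral_assumption_def)
  then show thesis using that unfolding cfun.span_singleton by auto
qed

lemma Dx_V_nonzero: "\<exists>x. Dx V x \<noteq> 0"
proof (rule ccontr)
  assume "\<not> ?thesis"
  then have "(V has_vector_derivative 0) (at x within UNIV)" for x using smooth1_D[OF smoothV, of x] by simp
  then show False using has_vector_derivative_zero_constant[OF convex_UNIV, of V] nonconst by (metis UNIV_I)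
qed

text \<open>Evaluation at \<open>x0\<close> is non-zero on the kernel element V', so demanding w(x0)
  = 0 selects one solution from each coset of the kernel.\<close>

definition x0 where "x0 = (SOME x. Dx V x \<noteq> 0)"

lemma x0: "Dx V x0 \<noteq> 0" unfolding x0_def by (rule someI_ex[OF Dx_V_nonzero])

text \<open>The fourth derivative of w as dictated by L w = h.\<close>

definition fourth :: "(real \<Rightarrow> complex) \<Rightarrow> (real \<Rightarrow> complex) \<Rightarrow> real \<Rightarrow> complex" where
  "fourth h w x = (h x - of_real (k * (6 * V x - s)) * Dx w x - of_real (6 * k * Dx V x) * w x
      - of_real (k^3) * Dx (Dx (Dx w)) x - of_real (\<delta> * k^2) * Dx (Dx w) x) / of_real (\<delta> * k^4)"

text \<open>L w = h spelled out through derivatives up to order four, since for merely continuous h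
  a solution need not be smooth. The normalization at \<open>x0\<close> is built in to obtain
  uniqueness.\<close>

definition is_sol :: "(real \<Rightarrow> complex) \<Rightarrow> (real \<Rightarrow> complex) \<Rightarrow> bool" where
  "is_sol h w \<longleftrightarrow> periodic1 w \<and> w x0 = 0 \<and> (\<forall>x. (w has_vector_derivative Dx w x) (at x) \<and>
     (Dx w has_vector_derivative Dx (Dx w) x) (at x) \<and>
     (Dx (Dx w) has_vector_derivative Dx (Dx (Dx w)) x) (at x) \<and>
     (Dx (Dx (Dx w)) has_vector_derivative fourth h w x) (at x))"

lemma is_solI:
  assumes "\<And>x. (w has_vector_derivative w1 x) (at x)" "\<And>x. (w1 has_vector_derivative w2 x) (at x)"
    "\<And>x. (w2 has_vector_derivative w3 x) (at x)"
    "\<And>x. (w3 has_vector_derivative (h x - of_real (k * (6 * V x - s)) * w1 x - of_real (6 * k * Dx V x) * w x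
      - of_real (k^3) * w3 x - of_real (\<delta> * k^2) * w2 x) / of_real (\<delta> * k^4)) (at x)"
    "periodic1 w" "w x0 = 0"
  shows "is_sol h w" and "Dx w = w1" and "Dx (Dx w) = w2" and "Dx (Dx (Dx w)) = w3"
proof -
  show 1: "Dx w = w1" by (rule Dx_ext) (rule assms)
  have 2: "Dx w1 = w2" by (rule Dx_ext) (rule assms)
  have 3: "Dx w2 = w3" by (rule Dx_ext) (rule assms)
  show "Dx (Dx w) = w2" "Dx (Dx (Dx w)) = w3" by (simp_all only: 1 2 3)
  show "is_sol h w" unfolding is_sol_def fourth_def 1 2 3 using assms by blast
qed

lemma is_sol_diff:
  assumes "is_sol h w" "is_sol h' w'"
  shows "is_sol (\<lambda>x. h x - h' x) (\<lambda>x. w x - w' x)"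
    and "Dx (\<lambda>x. w x - w' x) = (\<lambda>x. Dx w x - Dx w' x)"
    and "Dx (Dx (\<lambda>x. w x - w' x)) = (\<lambda>x. Dx (Dx w) x - Dx (Dx w') x)"
    and "Dx (Dx (Dx (\<lambda>x. w x - w' x))) = (\<lambda>x. Dx (Dx (Dx w)) x - Dx (Dx (Dx w')) x)"
proof -
  have f: "fourth h w x - fourth h' w' x = ((h x - h' x) - of_real (k * (6 * V x - s)) * (Dx w x - Dx w' x) - of_real (6 * k * Dx V x) * (w x - w' x)
      - of_real (k^3) * (Dx (Dx (Dx w)) x - Dx (Dx (Dx w')) x) - of_real (\<delta> * k^2) * (Dx (Dx w) x - Dx (Dx w') x)) / of_real (\<delta> * k^4)" for x
    unfolding fourth_def diff_divide_distrib[symmetric] by (rule arg_cong2[of _ _ _ _ "(/)"]) (auto simp: algebra_simps)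
  have D: "((\<lambda>x. w x - w' x) has_vector_derivative Dx w x - Dx w' x) (at x)" 
    "((\<lambda>x. Dx w x - Dx w' x) has_vector_derivative Dx (Dx w) x - Dx (Dx w') x) (at x)"
    "((\<lambda>x. Dx (Dx w) x - Dx (Dx w') x) has_vector_derivative Dx (Dx (Dx w)) x - Dx (Dx (Dx w')) x) (at x)"
    "((\<lambda>x. Dx (Dx (Dx w)) x - Dx (Dx (Dx w')) x) has_vector_derivative fourth h w x - fourth h' w' x) (at x)" for x
    using assms unfolding is_sol_def by (auto intro!: has_vector_derivative_diff)
  note * = is_solI[OF D(1,2,3) D(4)[unfolded f]]
  have p: "periodic1 (\<lambda>x. w x - w' x)" "w x0 - w' x0 = 0" using assms unfolding is_sol_def periodic1_def by auto
  show "is_sol (\<lambda>x. h x - h' x) (\<lambda>x. w x - w' x)"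
    and "Dx (\<lambda>x. w x - w' x) = (\<lambda>x. Dx w x - Dx w' x)"
    and "Dx (Dx (\<lambda>x. w x - w' x)) = (\<lambda>x. Dx (Dx w) x - Dx (Dx w') x)"
    and "Dx (Dx (Dx (\<lambda>x. w x - w' x))) = (\<lambda>x. Dx (Dx (Dx w)) x - Dx (Dx (Dx w')) x)"
    by (rule * p)+
qed

text \<open>With zero forcing the equation bootstraps to a smooth kernel element, hence a multiple
  of V', and the value 0 at \<open>x0\<close> kills the multiple.\<close>

lemma is_sol_zero: assumes "is_sol (\<lambda>x. 0) w" shows "w = (\<lambda>x. 0)"
proof -
  have d4: "\<delta> * k^4 \<noteq> 0" using \<delta> k by simp
  have D: "(w has_vector_derivative Dx w x) (at x)" "(Dx w has_vector_derivative Dx (Dx w) x) (at x)"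
    "(Dx (Dx w) has_vector_derivative Dx (Dx (Dx w)) x) (at x)"
    "(Dx (Dx (Dx w)) has_vector_derivative fourth (\<lambda>x. 0) w x) (at x)" for x
    using assms by (auto simp: is_sol_def)
  have f: "fourth (\<lambda>x. 0) w x = complex_of_real ((- 6 * k / (\<delta> * k^4)) * Dx V x) * w x +
     complex_of_real ((- k / (\<delta> * k^4)) * (6 * V x - s)) * Dx w x + complex_of_real (- (\<delta> * k^2) / (\<delta> * k^4)) * Dx (Dx w) x +
     complex_of_real (- (k^3) / (\<delta> * k^4)) * Dx (Dx (Dx w)) x" for x
    unfolding fourth_def by (simp add: diff_divide_distrib)
  have sm: "smooth1 w"
    by (rule ode4_bootstrap[OF D(1-3) D(4)[unfolded f]])
      (intro smooth1_cof smooth1_intros smoothV)+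
  have "Dx (Dx (Dx (Dx w))) x = fourth (\<lambda>x. 0) w x" for x by (intro Dx_eqI D)
  then have "lin_op \<delta> k V s w x = 0" for x
    using d4 by (simp add: lin_op_expand[OF sm smoothV] fourth_def) (simp add: field_simps)
  with sm assms obtain \<alpha> where \<alpha>: "w = (\<lambda>x. \<alpha> * of_real (Dx V x))" 
    using kernel[of w] by (auto simp: is_sol_def)
  have "w x0 = 0" using assms by (simp add: is_sol_def)
  then show ?thesis using x0 by (simp add: \<alpha>)
qed

text \<open>L w is the derivative of k (6 V - s) w + k^3 w'' + \<delta> (k^2 w' + k^4 w'''). One
  integration gives a third-order equation forced by an antiderivative of h plus a free constant,
  and mean zero makes that antiderivative periodic. Injectivity of the third-order problem follows
  by differentiating back to \<open>is_sol\<close> with zero forcing.\<close>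

lemma solvable:
  obtains B where "B > 0" "\<And>h m. continuous_on UNIV h \<Longrightarrow> periodic1 h \<Longrightarrow> avg h = 0 \<Longrightarrow> (\<And>x. norm (h x) \<le> m) \<Longrightarrow>
    \<exists>w. is_sol h w \<and> (\<forall>x. norm (w x) \<le> B * m \<and> norm (Dx w x) \<le> B * m \<and>
       norm (Dx (Dx w) x) \<le> B * m \<and> norm (Dx (Dx (Dx w)) x) \<le> B * m)"
proof -
  define \<kappa> where "\<kappa> = 1 / (\<delta> * k^4)"
  have d4: "\<delta> * k^4 > 0" using \<delta> k by simp
  have \<kappa>: "\<kappa> > 0" using d4 by (simp add: \<kappa>_def)
  define q0 where "q0 x = complex_of_real (- \<kappa> * (k * (6 * V x - s)))" for x
  define q1 where "q1 = complex_of_real (- \<kappa> * (\<delta> * k^2))"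
  define q2 where "q2 = complex_of_real (- \<kappa> * k^3)"
  have q0c: "continuous_on UNIV q0" and q0p: "periodic1 q0"
    unfolding q0_def using perV by (auto intro!: continuous_intros smooth1_continuous[OF smoothV] simp: periodic1_def)
  have q0d: "(q0 has_vector_derivative complex_of_real (- \<kappa> * (6 * k * Dx V x))) (at x)" for x
    unfolding q0_def
    by (rule bounded_linear.has_vector_derivative[OF bounded_linear_of_real])
      (rule derivative_eq_intros smooth1_D[OF smoothV] refl | simp add: algebra_simps)+
  \<comment> \<open>Differentiating the integrated equation recovers the fourth-order one, and the
    constant C disappears.\<close>
  have d3: "((\<lambda>x. q0 x * w x + q1 * w1 x + q2 * w2 x + of_real \<kappa> * H x + C) has_vector_derivative
     (h x - of_real (k * (6 * V x - s)) * w1 x - of_real (6 * k * Dx V x) * w x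
      - of_real (k^3) * (q0 x * w x + q1 * w1 x + q2 * w2 x + of_real \<kappa> * H x + C) - of_real (\<delta> * k^2) * w2 x) / of_real (\<delta> * k^4)) (at x)"
    if "(w has_vector_derivative w1 x) (at x)" "(w1 has_vector_derivative w2 x) (at x)"
      "(w2 has_vector_derivative q0 x * w x + q1 * w1 x + q2 * w2 x + of_real \<kappa> * H x + C) (at x)"
      "(H has_vector_derivative h x) (at x)" for w w1 w2 H h C x
  proof -
    let ?w3 = "q0 x * w x + q1 * w1 x + q2 * w2 x + of_real \<kappa> * H x + C"
    have "((\<lambda>x. q0 x * w x + q1 * w1 x + q2 * w2 x + of_real \<kappa> * H x + C) has_vector_derivative
      (q0 x * w1 x + complex_of_real (- \<kappa> * (6 * k * Dx V x)) * w x) + q1 * w2 x + q2 * ?w3 + of_real \<kappa> * h x + 0) (at x)"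
      by (intro has_vector_derivative_add has_vector_derivative_mult has_vector_derivative_mult_right has_vector_derivative_const
          that q0d)
    moreover have "(q0 x * w1 x + complex_of_real (- \<kappa> * (6 * k * Dx V x)) * w x) + q1 * w2 x + q2 * ?w3 + of_real \<kappa> * h x + 0
      = of_real \<kappa> * (h x - of_real (k * (6 * V x - s)) * w1 x - of_real (6 * k * Dx V x) * w x
      - of_real (k^3) * ?w3 - of_real (\<delta> * k^2) * w2 x)"
      unfolding q0_def[of x] q1_def q2_def by (simp add: algebra_simps)
    ultimately show ?thesis by (simp add: \<kappa>_def divide_inverse mult.commute)
  qed
  obtain B where B: "B > 0" "\<And>g m. continuous_on UNIV g \<Longrightarrow> periodic1 g \<Longrightarrow> (\<And>x. norm (g x) \<le> m) \<Longrightarrow>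
    \<exists>w w1 w2 C. (\<forall>x. (w has_vector_derivative w1 x) (at x)) \<and>
      (\<forall>x. (w1 has_vector_derivative w2 x) (at x)) \<and>
      (\<forall>x. (w2 has_vector_derivative q0 x * w x + q1 * w1 x + q2 * w2 x + g x + C) (at x)) \<and>
      periodic1 w \<and> w x0 = 0 \<and> (\<forall>x. norm (w x) \<le> B * m \<and> norm (w1 x) \<le> B * m \<and> norm (w2 x) \<le> B * m)
      \<and> norm C \<le> B * m"
  proof (rule periodic_third_order_solvable[where ?x0.0 = x0 and ?q1.0 = q1 and ?q2.0 = q2, OF q0c q0p])
    fix w w1 w2 C
    assume D: "\<And>x. (w has_vector_derivative w1 x) (at x)" "\<And>x. (w1 has_vector_derivative w2 x) (at x)"
      "\<And>x. (w2 has_vector_derivative q0 x * w x + q1 * w1 x + q2 * w2 x + C) (at x)" and w: "periodic1 w" "w x0 = 0"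
    have "is_sol (\<lambda>x. 0) w"
      by (rule is_solI(1)[OF D])
        (use d3[of w w1 _ w2 "\<lambda>x. 0" C "\<lambda>x. 0"] D w in auto)
    then have 0: "w = (\<lambda>x. 0)" by (rule is_sol_zero)
    have "Dx w = w1" by (rule Dx_ext) (rule D)
    then have 1: "w1 = (\<lambda>x. 0)" unfolding 0 Dx_const by (rule sym)
    have "Dx w1 = w2" by (rule Dx_ext) (rule D)
    then have 2: "w2 = (\<lambda>x. 0)" unfolding 1 Dx_const by (rule sym)
    \<comment> \<open>Once w and its derivatives are known to vanish, the third-order equation
      itself reads 0 = C.\<close>
    have "Dx w2 = (\<lambda>x. q0 x * w x + q1 * w1 x + q2 * w2 x + C)" by (rule Dx_ext) (rule D)
    from fun_cong[OF this, of 0] show "C = 0 \<and> (\<forall>x. w x = 0)" unfolding 0 1 2 Dx_const by simp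
  qed (use that in blast)
  obtain A where A: "A > 0" "\<And>x. norm (q0 x) \<le> A" using periodic1_bounded[OF q0c q0p] by blast
  \<comment> \<open>The summand \<kappa> B bounds w, w', w''; the bracket bounds w''', which is read
    off from the integrated equation.\<close>
  define B' where "B' = \<kappa> * B + (A * (\<kappa> * B) + norm q1 * (\<kappa> * B) + norm q2 * (\<kappa> * B) + \<kappa> + \<kappa> * B)"
  have B': "\<kappa> * B \<le> B'" "B' > 0"
  proof -
    have "\<kappa> * B > 0" using \<kappa> B by simp
    have "A * (\<kappa> * B) + norm q1 * (\<kappa> * B) + norm q2 * (\<kappa> * B) + \<kappa> + \<kappa> * B \<ge> 0"
      using A \<kappa> B(1) by (intro add_nonneg_nonneg mult_nonneg_nonneg) auto
    then show "\<kappa> * B \<le> B'" "B' > 0" using \<open>\<kappa> * B > 0\<close> unfolding B'_def by linarith+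
  qed
  show thesis
  proof (rule that[of B'])
    fix h :: "real \<Rightarrow> complex" and m :: real
    assume h: "continuous_on UNIV h" "periodic1 h" "avg h = 0" "\<And>x. cmod (h x) \<le> m"
    have m: "m \<ge> 0" using h(4)[of 0] norm_ge_zero[of "h 0"] by linarith
    obtain H where H: "\<And>x. (H has_vector_derivative h x) (at x)" "periodic1 H" "\<And>x. norm (H x) \<le> m"
      using periodic_antiderivative[OF h] by blast
    have "continuous_on UNIV (\<lambda>x. of_real \<kappa> * H x)"
      using H(1) by (intro continuous_intros continuous_at_imp_continuous_on ballI has_vector_derivative_continuous)
    moreover have "periodic1 (\<lambda>x. of_real \<kappa> * H x)" using H by (simp add: periodic1_def)
    moreover have "norm (of_real \<kappa> * H x) \<le> \<kappa> * m" for x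
      using H(3)[of x] \<kappa> by (simp add: norm_mult)
    ultimately obtain w w1 w2 C where w: "\<And>x. (w has_vector_derivative w1 x) (at x)" "\<And>x. (w1 has_vector_derivative w2 x) (at x)"
      "\<And>x. (w2 has_vector_derivative q0 x * w x + q1 * w1 x + q2 * w2 x + of_real \<kappa> * H x + C) (at x)" "periodic1 w" "w x0 = 0"
      and b: "\<And>x. norm (w x) \<le> B * (\<kappa> * m)" "\<And>x. norm (w1 x) \<le> B * (\<kappa> * m)" "\<And>x. norm (w2 x) \<le> B * (\<kappa> * m)" "norm C \<le> B * (\<kappa> * m)"
      using B(2)[of "\<lambda>x. of_real \<kappa> * H x" "\<kappa> * m"] by blast
    note S = is_solI[where h = h, OF w(1-3) d3[where h = h and H = H, OF w(1-3) H(1)] w(4,5)]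
    have le: "B * (\<kappa> * m) \<le> B' * m" using mult_right_mono[OF B'(1) m] by (simp add: mult_ac)
    have "norm (q0 x * w x + q1 * w1 x + q2 * w2 x + of_real \<kappa> * H x + C) \<le> B' * m" for x
    proof -
      have "norm (q0 x * w x + q1 * w1 x + q2 * w2 x + of_real \<kappa> * H x + C) \<le>
        norm (q0 x) * norm (w x) + norm q1 * norm (w1 x) + norm q2 * norm (w2 x) + \<kappa> * norm (H x) + norm C"
        using \<kappa> by (intro order_trans[OF norm_triangle_ineq] add_mono order_refl) (simp_all add: norm_mult)
      also have "\<dots> \<le> A * (B * (\<kappa> * m)) + norm q1 * (B * (\<kappa> * m)) + norm q2 * (B * (\<kappa> * m)) + \<kappa> * m + B * (\<kappa> * m)"
        using A b H(3) \<kappa> by (intro add_mono mult_mono) (auto intro: less_imp_le)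
      also have "\<dots> = B' * m - \<kappa> * B * m" unfolding B'_def by (simp add: algebra_simps)
      also have "\<dots> \<le> B' * m" using \<kappa> B m by simp
      finally show ?thesis .
    qed
    then have "norm (Dx (Dx (Dx w)) x) \<le> B' * m" for x by (simp only: S(4))
    moreover have "norm (w x) \<le> B' * m" "norm (w1 x) \<le> B' * m" "norm (w2 x) \<le> B' * m" for x
      by (rule order_trans[OF _ le], rule b)+
    then have "norm (w x) \<le> B' * m" "norm (Dx w x) \<le> B' * m" "norm (Dx (Dx w) x) \<le> B' * m" for x
      by (simp_all only: S(3), simp_all only: S(2))
    ultimately show "\<exists>w. is_sol h w \<and> (\<forall>x. norm (w x) \<le> B' * m \<and> norm (Dx w x) \<le> B' * m \<and>
       norm (Dx (Dx w) x) \<le> B' * m \<and> norm (Dx (Dx (Dx w)) x) \<le> B' * m)"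
      using S(1) by blast
  qed (fact B')
qed

text \<open>Uniqueness identifies S h - S h' with the solution for h - h', so the linear bound
  becomes a Lipschitz estimate. It reaches the third derivative because the \<nu>-dependent part of
  the Bloch operator contains derivatives up to that order.\<close>

lemma solution_operator:
  obtains S B where "B > 0" "\<And>h. continuous_on UNIV h \<Longrightarrow> periodic1 h \<Longrightarrow> avg h = 0 \<Longrightarrow> is_sol h (S h)"
    "\<And>h h' m x. continuous_on UNIV h \<Longrightarrow> periodic1 h \<Longrightarrow> avg h = 0 \<Longrightarrow> continuous_on UNIV h' \<Longrightarrow> periodic1 h' \<Longrightarrow> avg h' = 0 \<Longrightarrow>
      (\<And>x. norm (h x - h' x) \<le> m) \<Longrightarrow> norm (S h x - S h' x) \<le> B * m \<and> norm (Dx (S h) x - Dx (S h') x) \<le> B * m \<and>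
       norm (Dx (Dx (S h)) x - Dx (Dx (S h')) x) \<le> B * m \<and> norm (Dx (Dx (Dx (S h))) x - Dx (Dx (Dx (S h'))) x) \<le> B * m"
    "S (\<lambda>x. 0) = (\<lambda>x. 0)"
proof -
  obtain B where B: "B > 0" "\<And>h m. continuous_on UNIV h \<Longrightarrow> periodic1 h \<Longrightarrow> avg h = 0 \<Longrightarrow> (\<And>x. norm (h x) \<le> m) \<Longrightarrow>
    \<exists>w. is_sol h w \<and> (\<forall>x. norm (w x) \<le> B * m \<and> norm (Dx w x) \<le> B * m \<and>
       norm (Dx (Dx w) x) \<le> B * m \<and> norm (Dx (Dx (Dx w)) x) \<le> B * m)"
    using solvable by blast
  define S where "S h = (SOME w. is_sol h w)" for h
  have S: "is_sol h (S h)" if h: "continuous_on UNIV h" "periodic1 h" "avg h = 0" for h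
  proof -
    obtain m where "\<And>x. norm (h x) \<le> m" using periodic1_bounded[OF h(1,2)] by blast
    then have "\<exists>w. is_sol h w" using B(2)[OF h] by blast
    then show ?thesis unfolding S_def by (rule someI_ex)
  qed
  have uniq: "w = w'" if "is_sol h w" "is_sol h w'" for h w w'
  proof -
    have "(\<lambda>x. w x - w' x) = (\<lambda>x. 0)" using is_sol_diff(1)[OF that] by (intro is_sol_zero) simp
    then show ?thesis by (auto simp: fun_eq_iff)
  qed
  show thesis
  proof (rule that[OF B(1) S])
    fix h h' :: "real \<Rightarrow> complex" and m x
    assume h: "continuous_on UNIV h" "periodic1 h" "avg h = 0" and h': "continuous_on UNIV h'" "periodic1 h'" "avg h' = 0"
      and m: "\<And>x. norm (h x - h' x) \<le> m"
    have "continuous_on UNIV (\<lambda>x. h x - h' x)" "periodic1 (\<lambda>x. h x - h' x)"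
      using h h' by (auto intro!: continuous_intros simp: periodic1_def)
    moreover have "avg (\<lambda>x. h x - h' x) = 0"
      using avg_diff[OF h(1) h'(1)] h(3) h'(3) by simp
    ultimately have "continuous_on UNIV (\<lambda>x. h x - h' x)" "periodic1 (\<lambda>x. h x - h' x)" "avg (\<lambda>x. h x - h' x) = 0"
      by auto
    from B(2)[OF this m] obtain w where w: "is_sol (\<lambda>x. h x - h' x) w" "\<forall>x. norm (w x) \<le> B * m \<and> norm (Dx w x) \<le> B * m \<and>
       norm (Dx (Dx w) x) \<le> B * m \<and> norm (Dx (Dx (Dx w)) x) \<le> B * m"
      by blast
    note D = is_sol_diff[OF S[OF h] S[OF h']]
    have *: "w = (\<lambda>x. S h x - S h' x)" by (rule uniq[OF w(1) D(1)])
    then show "norm (S h x - S h' x) \<le> B * m \<and> norm (Dx (S h) x - Dx (S h') x) \<le> B * m \<and>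
       norm (Dx (Dx (S h)) x - Dx (Dx (S h')) x) \<le> B * m \<and> norm (Dx (Dx (Dx (S h))) x - Dx (Dx (Dx (S h'))) x) \<le> B * m"
      using w(2)[rule_format, of x]
      unfolding * fun_cong[OF D(2), of x] fun_cong[OF D(3), of x] fun_cong[OF D(4), of x] by blast
  next
    show "S (\<lambda>x. 0) = (\<lambda>x. 0)"
      by (rule is_sol_zero, rule S) (auto simp: periodic1_def avg_const)
  qed
qed

end

section \<open>Mixed derivatives of jointly smooth functions\<close>

definition dirD :: "'a::real_normed_vector \<Rightarrow> ('a \<Rightarrow> 'b::real_normed_vector) \<Rightarrow> 'a \<Rightarrow> 'b" where
  "dirD v f p = frechet_derivative f (at p) v"

lemma smooth_on_dirD: "smooth_on S f \<Longrightarrow> smooth_on S (dirD v f)"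
  unfolding smooth_on_def dirD_def[abs_def] using Ck_on.simps(2) by blast

lemma smooth_on_continuous: "smooth_on S f \<Longrightarrow> continuous_on S f"
  unfolding smooth_on_def using Ck_on.simps(1) by blast

lemma smooth_on_has_derivative:
  "smooth_on S f \<Longrightarrow> p \<in> S \<Longrightarrow> (f has_derivative (\<lambda>v. dirD v f p)) (at p)"
  unfolding smooth_on_def dirD_def using Ck_on.simps(2)[of 0 S f] frechet_derivative_works by blast

lemma dirD_line:
  assumes f: "smooth_on S f" and p: "p + t *\<^sub>R v \<in> S"
  shows "((\<lambda>t. f (p + t *\<^sub>R v)) has_vector_derivative dirD v f (p + t *\<^sub>R v)) (at t)"
proof -
  have lin: "((\<lambda>t. p + t *\<^sub>R v) has_derivative (\<lambda>h. h *\<^sub>R v)) (at t)"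
    by (auto intro!: derivative_eq_intros)
  note d = smooth_on_has_derivative[OF f p]
  have "((\<lambda>t. f (p + t *\<^sub>R v)) has_derivative (\<lambda>h. dirD (h *\<^sub>R v) f (p + t *\<^sub>R v))) (at t)"
    by (rule has_derivative_compose[OF lin d])
  moreover have "dirD (h *\<^sub>R v) f q = h *\<^sub>R dirD v f q" if "q = p + t *\<^sub>R v" for h q
    using linear_scale[OF has_derivative_linear[OF d]] that by simp
  ultimately show ?thesis by (simp add: has_vector_derivative_def)
qed

lemma leibniz_interval:
  fixes f' :: "real \<Rightarrow> real \<Rightarrow> 'b::banach"
  assumes d: "\<And>t x. t \<in> ball t0 \<eta> \<Longrightarrow> ((\<lambda>t. f t x) has_vector_derivative f' t x) (at t)"
    and c: "\<And>t. t \<in> ball t0 \<eta> \<Longrightarrow> continuous_on UNIV (f t)"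
    and c': "continuous_on (ball t0 \<eta> \<times> UNIV) (\<lambda>(t, x). f' t x)" and \<eta>: "\<eta> > 0"
  shows "((\<lambda>t. integral {a..b} (f t)) has_vector_derivative integral {a..b} (f' t0)) (at t0)"
proof -
  have "((\<lambda>t. integral (cbox a b) (f t)) has_vector_derivative integral (cbox a b) (f' t0)) (at t0 within ball t0 \<eta>)"
  proof (rule leibniz_rule_vector_derivative)
    show "((\<lambda>t. f t x) has_vector_derivative f' t x) (at t within ball t0 \<eta>)" if "t \<in> ball t0 \<eta>" for t x
      using d[OF that] by (rule has_vector_derivative_at_within)
    show "f t integrable_on cbox a b" if "t \<in> ball t0 \<eta>" for t
      using c[OF that] by (intro integrable_continuous) (auto intro: continuous_on_subset)
    show "continuous_on (ball t0 \<eta> \<times> cbox a b) (\<lambda>(t, x). f' t x)"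
      using c' by (rule continuous_on_subset) auto
  qed (use \<eta> in auto)
  then show ?thesis using \<eta> by (simp add: at_within_open[of t0 "ball t0 \<eta>"])
qed

lemma line_in_open:
  fixes p e :: "'a::real_normed_vector"
  assumes "open P" "p \<in> P"
  obtains \<eta> where "\<eta> > 0" "\<And>t. t \<in> ball 0 \<eta> \<Longrightarrow> p + t *\<^sub>R e \<in> P"
proof -
  have "open ((\<lambda>t. p + t *\<^sub>R e) -` P)"
    by (intro open_vimage assms) (auto intro!: continuous_intros)
  moreover have "0 \<in> (\<lambda>t. p + t *\<^sub>R e) -` P" using assms by simp
  ultimately obtain \<eta> where "\<eta> > 0" "ball 0 \<eta> \<subseteq> (\<lambda>t. p + t *\<^sub>R e) -` P"
    unfolding open_contains_ball by blast
  then show thesis by (intro that[of \<eta>]) auto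
qed

text \<open>Equality of mixed derivatives, read off from \<open>F (q, x) = F (q, 0) + \<integral>\<^sub>0\<^sup>x \<partial>\<^sub>x F (q, s) ds\<close>
  by differentiating under the integral.\<close>

lemma mixed_derivative:
  fixes F :: "'a::real_normed_vector \<times> real \<Rightarrow> 'b::banach"
  assumes P: "open P" and F: "smooth_on (P \<times> UNIV) F" and p: "p \<in> P"
  shows "((\<lambda>x. dirD (e, 0) F (p, x)) has_vector_derivative dirD (e, 0) (dirD (0, 1) F) (p, x)) (at x)"
proof -
  obtain \<eta> where \<eta>: "\<eta> > 0" "\<And>t. t \<in> ball 0 \<eta> \<Longrightarrow> p + t *\<^sub>R e \<in> P"
    using line_in_open[OF P p] by blast
  have dx: "((\<lambda>x. G (q, x)) has_vector_derivative dirD (0, 1) G (q, x)) (at x)"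
    if "smooth_on (P \<times> UNIV) G" "q \<in> P" for G :: "'a \<times> real \<Rightarrow> 'b" and q x
    using dirD_line[OF that(1), of "(q, 0)" x "(0, 1)"] that(2) by simp
  have dt: "((\<lambda>t. G (p + t *\<^sub>R e, x)) has_vector_derivative dirD (e, 0) G (p + t *\<^sub>R e, x)) (at t)"
    if "smooth_on (P \<times> UNIV) G" "t \<in> ball 0 \<eta>" for G :: "'a \<times> real \<Rightarrow> 'b" and t x
    using dirD_line[OF that(1), of "(p, x)" t "(e, 0)"] \<eta>(2)[OF that(2)] by simp
  define a where "a = dirD (0, 1) F"
  have a: "smooth_on (P \<times> UNIV) a" unfolding a_def by (intro smooth_on_dirD F)
  have ca: "continuous_on UNIV (\<lambda>x. a (q, x))" if "q \<in> P" for q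
    using dx[OF a that] by (meson continuous_at_imp_continuous_on has_vector_derivative_continuous)
  define b where "b = dirD (e, 0) a"
  have b: "smooth_on (P \<times> UNIV) b" unfolding b_def by (intro smooth_on_dirD a)
  have cb: "continuous_on UNIV (\<lambda>x. b (p, x))"
    using dx[OF b p] by (meson continuous_at_imp_continuous_on has_vector_derivative_continuous)
  have cb': "continuous_on (ball 0 \<eta> \<times> UNIV) (\<lambda>(t, x). b (p + t *\<^sub>R e, x))"
    unfolding case_prod_beta
    by (rule continuous_on_compose2[OF smooth_on_continuous[OF b]]) (auto intro!: continuous_intros \<eta>(2))
  have vol: "F (q, x) = F (q, 0) + volt 0 (\<lambda>s. a (q, s)) x" if q: "q \<in> P" for q x
  proof -
    have "((\<lambda>x. F (q, x) - volt 0 (\<lambda>s. a (q, s)) x) has_vector_derivative a (q, x) - a (q, x)) (at x)" for x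
      unfolding a_def by (intro has_vector_derivative_diff dx F q volt_has_derivative ca[OF q, unfolded a_def])
    then have "((\<lambda>x. F (q, x) - volt 0 (\<lambda>s. a (q, s)) x) has_vector_derivative 0) (at x within UNIV)" for x
      by simp
    from has_vector_derivative_zero_constant[OF convex_UNIV this] obtain C where
      C: "F (q, x) - volt 0 (\<lambda>s. a (q, s)) x = C" for x by auto
    from C[of x] C[of 0] show ?thesis by (simp add: volt_same algebra_simps)
  qed
  have L: "((\<lambda>t. integral {u..v} (\<lambda>s. a (p + t *\<^sub>R e, s))) has_vector_derivative integral {u..v} (\<lambda>s. b (p, s))) (at 0)" for u v
    using leibniz_interval[of 0 \<eta> "\<lambda>t s. a (p + t *\<^sub>R e, s)" "\<lambda>t s. b (p + t *\<^sub>R e, s)" u v]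
      dt[OF a] ca[OF \<eta>(2)] cb' \<eta>(1) by (simp add: b_def)
  have eq: "dirD (e, 0) F (p, x) = dirD (e, 0) F (p, 0) + volt 0 (\<lambda>s. b (p, s)) x" for x
  proof -
    have d0: "((\<lambda>t. F (p + t *\<^sub>R e, x)) has_vector_derivative dirD (e, 0) F (p, x)) (at 0)" for x
      using dt[OF F, of 0 x] \<eta>(1) by simp
    have "((\<lambda>t. F (p + t *\<^sub>R e, 0) + volt 0 (\<lambda>s. a (p + t *\<^sub>R e, s)) x) has_vector_derivative
      dirD (e, 0) F (p, 0) + volt 0 (\<lambda>s. b (p, s)) x) (at 0)"
      unfolding volt_def by (rule has_vector_derivative_add[OF d0 has_vector_derivative_diff[OF L L]])
    then have "((\<lambda>t. F (p + t *\<^sub>R e, x)) has_vector_derivative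
      dirD (e, 0) F (p, 0) + volt 0 (\<lambda>s. b (p, s)) x) (at 0)"
    proof (rule has_vector_derivative_transform_within_open[where S = "ball 0 \<eta>"])
      show "F (p + t *\<^sub>R e, 0) + volt 0 (\<lambda>s. a (p + t *\<^sub>R e, s)) x = F (p + t *\<^sub>R e, x)" if "t \<in> ball 0 \<eta>" for t
        by (rule vol[OF \<eta>(2)[OF that], symmetric])
    qed (use \<eta>(1) in auto)
    from vector_derivative_unique_at[OF d0[of x] this] show ?thesis .
  qed
  have "((\<lambda>x. dirD (e, 0) F (p, 0) + volt 0 (\<lambda>s. b (p, s)) x) has_vector_derivative 0 + b (p, x)) (at x)"
    by (rule has_vector_derivative_add[OF has_vector_derivative_const volt_has_derivative[OF cb]])
  then show ?thesis unfolding eq[symmetric] unfolding b_def a_def by (simp only: add_0)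
qed

lemma smooth1_slice:
  fixes F :: "'a::real_normed_vector \<times> real \<Rightarrow> 'b::real_normed_vector"
  assumes F: "smooth_on (P \<times> UNIV) F" and p: "p \<in> P"
  shows "smooth1 (\<lambda>x. F (p, x))" "Dx (\<lambda>x. F (p, x)) = (\<lambda>x. dirD (0, 1) F (p, x))"
proof -
  have dx: "((\<lambda>x. G (p, x)) has_vector_derivative dirD (0, 1) G (p, x)) (at x)"
    if "smooth_on (P \<times> UNIV) G" for G :: "'a \<times> real \<Rightarrow> 'b" and x
    using dirD_line[OF that(1), of "(p, 0)" x "(0, 1)"] p by simp
  have "ndiff n (\<lambda>x. G (p, x))" if "smooth_on (P \<times> UNIV) G" for n and G :: "'a \<times> real \<Rightarrow> 'b"
    using that
  proof (induction n arbitrary: G)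
    case (Suc n)
    show ?case by (rule ndiff_Suc_I[OF dx[OF Suc.prems]]) (rule Suc.IH[OF smooth_on_dirD[OF Suc.prems]])
  qed simp
  then show "smooth1 (\<lambda>x. F (p, x))" using F by (simp add: smooth1_def)
  show "Dx (\<lambda>x. F (p, x)) = (\<lambda>x. dirD (0, 1) F (p, x))" by (rule Dx_ext) (rule dx[OF F])
qed

text \<open>Induction on the number of x-derivatives: \<open>mixed_derivative\<close> moves one of
  them onto F, leaving the claim for the x-derivative of F, which is again jointly smooth.\<close>

lemma parameter_derivative:
  fixes F :: "'a::real_normed_vector \<times> real \<Rightarrow> 'b::banach"
  assumes P: "open P" and F: "smooth_on (P \<times> UNIV) F" and p: "p \<in> P"
  shows "((\<lambda>t. (Dx ^^ j) (\<lambda>y. F (p + t *\<^sub>R e, y)) x) has_vector_derivative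
           (Dx ^^ j) (\<lambda>y. dirD (e, 0) F (p, y)) x) (at 0)"
  using F
proof (induction j arbitrary: F)
  case 0
  then show ?case using dirD_line[OF 0, of "(p, x)" 0 "(e, 0)"] p by simp
next
  case (Suc j)
  obtain \<eta> where \<eta>: "\<eta> > 0" "\<And>t. t \<in> ball 0 \<eta> \<Longrightarrow> p + t *\<^sub>R e \<in> P"
    using line_in_open[OF P p] by blast
  have "Dx (\<lambda>y. dirD (e, 0) F (p, y)) = (\<lambda>y. dirD (e, 0) (dirD (0, 1) F) (p, y))"
    by (rule Dx_ext) (rule mixed_derivative[OF P Suc.prems p])
  moreover have "((\<lambda>t. (Dx ^^ Suc j) (\<lambda>y. F (p + t *\<^sub>R e, y)) x) has_vector_derivative
     (Dx ^^ j) (\<lambda>y. dirD (e, 0) (dirD (0, 1) F) (p, y)) x) (at 0)"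
  proof (rule has_vector_derivative_transform_within_open[OF Suc.IH[OF smooth_on_dirD[OF Suc.prems]], where S = "ball 0 \<eta>"])
    show "(Dx ^^ j) (\<lambda>y. dirD (0, 1) F (p + t *\<^sub>R e, y)) x = (Dx ^^ Suc j) (\<lambda>y. F (p + t *\<^sub>R e, y)) x"
      if "t \<in> ball 0 \<eta>" for t
      using smooth1_slice(2)[OF Suc.prems \<eta>(2)[OF that]] by (simp add: funpow_Suc_right del: funpow.simps)
  qed (use \<eta> in auto)
  ultimately show ?case by (simp add: funpow_Suc_right del: funpow.simps)
qed

section \<open>Differentiating the wave family\<close>

locale wave_family =
  fixes \<delta> ks Ms :: real
    and \<Omega> :: "(real \<times> real) set"
    and U :: "real \<Rightarrow> real \<Rightarrow> real \<Rightarrow> real"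
    and c :: "real \<Rightarrow> real \<Rightarrow> real"
    and U0 :: "real \<Rightarrow> real \<Rightarrow> real"
    and c0 :: "real \<Rightarrow> real"
  assumes \<delta>: "\<delta> > 0"
    and op: "open \<Omega>"
    and kpos: "\<And>k M. (k, M) \<in> \<Omega> \<Longrightarrow> k > 0"
    and smU: "smooth_on (\<Omega> \<times> UNIV) (\<lambda>((k, M), x). U k M x)"
    and smc: "smooth_on \<Omega> (\<lambda>(k, M). c k M)"
    and perU: "\<And>k M. (k, M) \<in> \<Omega> \<Longrightarrow> periodic1 (U k M)"
    and ncU: "\<And>k M. (k, M) \<in> \<Omega> \<Longrightarrow> \<exists>x y. U k M x \<noteq> U k M y"
    and avgU: "\<And>k M. (k, M) \<in> \<Omega> \<Longrightarrow> avg (U k M) = M"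
    and prof: "\<And>k M. (k, M) \<in> \<Omega> \<Longrightarrow> profile_eq \<delta> k (U k M) (c k M)"
    and U0: "\<And>k M x. (k, M) \<in> \<Omega> \<Longrightarrow> U k M x = M + U0 k x"
    and c0: "\<And>k M. (k, M) \<in> \<Omega> \<Longrightarrow> c k M = 6 * M + c0 k"
    and spec: "\<And>k M. (k, M) \<in> \<Omega> \<Longrightarrow> spectral_assumption \<delta> k (U k M) (c k M)"
    and star: "(ks, Ms) \<in> \<Omega>"
begin

abbreviation "V \<equiv> U ks Ms"
abbreviation "s \<equiv> c ks Ms"
abbreviation "FU \<equiv> (\<lambda>((k, M), x). U k M x)"

lemma smooth1_U: "(k, M) \<in> \<Omega> \<Longrightarrow> smooth1 (U k M)"
  using smooth1_slice(1)[OF smU, of "(k, M)"] by simp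

lemma ks: "ks > 0" using kpos star by blast

sublocale periodic_wave \<delta> ks s V
  by unfold_locales
    (use \<delta> ks smooth1_U[OF star] perU[OF star] ncU[OF star] prof[OF star] spec[OF star] in auto)

text \<open>The k-derivative of the wave at fixed M; \<open>ks\<close> times it is the non-constant
  part of the first corrector, up to the kernel.\<close>

definition w :: "real \<Rightarrow> real" where "w x = dirD ((1, 0), 0) FU ((ks, Ms), x)"

lemma near: obtains \<eta> where "\<eta> > 0" "\<And>k. k \<in> ball ks \<eta> \<Longrightarrow> (k, Ms) \<in> \<Omega>"
proof -
  obtain \<eta> where \<eta>: "\<eta> > 0" "\<And>t. t \<in> ball 0 \<eta> \<Longrightarrow> (ks, Ms) + t *\<^sub>R (1, 0) \<in> \<Omega>"
    using line_in_open[OF op star, of "(1, 0)"] by blast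
  show thesis
  proof (rule that[of \<eta>])
    show "(k, Ms) \<in> \<Omega>" if "k \<in> ball ks \<eta>" for k
      using \<eta>(2)[of "k - ks"] that by (simp add: dist_real_def abs_minus_commute)
  qed (rule \<eta>)
qed

lemma has_real_derivative_near:
  assumes "(f has_real_derivative d) (at ks)" "\<And>k. (k, Ms) \<in> \<Omega> \<Longrightarrow> f k = g k"
  shows "(g has_real_derivative d) (at ks)"
proof -
  obtain \<eta> where \<eta>: "\<eta> > 0" "\<And>k. k \<in> ball ks \<eta> \<Longrightarrow> (k, Ms) \<in> \<Omega>" by (rule near) blast
  show ?thesis
    by (rule has_field_derivative_transform_within_open[OF assms(1), of "ball ks \<eta>"]) (use \<eta> assms(2) in auto)
qed

lemma deriv_shift_real:
  "((\<lambda>t. f (ks + t)) has_vector_derivative d) (at 0) \<longleftrightarrow> (f has_real_derivative d) (at ks)"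
  using DERIV_shift[of f d 0 ks] by (simp add: has_real_derivative_iff_has_vector_derivative add.commute)

lemma dk_U: "((\<lambda>k. (Dx ^^ j) (U k Ms) x) has_real_derivative (Dx ^^ j) w x) (at ks)"
  using parameter_derivative[OF op smU star, of j "(1, 0)" x]
  by (simp add: w_def[abs_def] flip: deriv_shift_real)

lemma smooth_w: "smooth1 w"
  unfolding w_def[abs_def] by (rule smooth1_slice(1)[OF smooth_on_dirD[OF smU] star])

lemma dk_U_at:
  assumes "(k, Ms) \<in> \<Omega>"
  shows "((\<lambda>k. U k Ms x) has_vector_derivative dirD ((1, 0), 0) FU ((k, Ms), x)) (at k)"
proof -
  have "((\<lambda>t. U (0 + t) Ms x) has_vector_derivative dirD ((1, 0), 0) FU ((0 + k, Ms), x)) (at k)"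
    using dirD_line[OF smU, of "((0, Ms), x)" k "((1, 0), 0)"] assms by simp
  then show ?thesis by simp
qed

lemma per_w: "periodic1 w"
  unfolding periodic1_def
proof
  fix x
  have "((\<lambda>k. U k Ms (x + 1)) has_real_derivative w x) (at ks)"
    by (rule has_real_derivative_near[OF dk_U[of 0 x, simplified]]) (use perU in \<open>auto simp: periodic1_def\<close>)
  then show "w (x + 1) = w x" using DERIV_unique[OF _ dk_U[of 0 "x + 1", simplified]] by simp
qed

text \<open>Used with G u = u, where the mean is prescribed and does not move with k, and with G u =
  3 u^2, the flux of the mass equation.\<close>

lemma avg_leibniz:
  fixes G :: "real \<Rightarrow> real" 
  assumes G: "\<And>u. (G has_real_derivative G' u) (at u)" and cG: "continuous_on UNIV G'"
  shows "((\<lambda>k. avg (\<lambda>x. G (U k Ms x))) has_real_derivative avg (\<lambda>x. G' (V x) * w x)) (at ks)"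
proof -
  obtain \<eta> where \<eta>: "\<eta> > 0" "\<And>k. k \<in> ball ks \<eta> \<Longrightarrow> (k, Ms) \<in> \<Omega>" by (rule near) blast
  have cG0: "continuous_on UNIV G" by (intro continuous_at_imp_continuous_on ballI DERIV_isCont[OF G])
  define D where "D = dirD ((1, 0), 0) FU"
  have "((\<lambda>k. integral {0..1} (\<lambda>x. G (U k Ms x))) has_vector_derivative
      integral {0..1} (\<lambda>x. G' (U ks Ms x) * D ((ks, Ms), x))) (at ks)"
  proof (rule leibniz_interval[of ks \<eta> "\<lambda>k x. G (U k Ms x)" "\<lambda>k x. G' (U k Ms x) * D ((k, Ms), x)"])
    fix k assume k: "k \<in> ball ks \<eta>"
    show "((\<lambda>k. G (U k Ms x)) has_vector_derivative G' (U k Ms x) * D ((k, Ms), x)) (at k)" for x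
      using DERIV_chain2[OF G dk_U_at[OF \<eta>(2)[OF k], unfolded has_real_derivative_iff_has_vector_derivative[symmetric]]]
      by (simp add: has_real_derivative_iff_has_vector_derivative D_def)
    show "continuous_on UNIV (\<lambda>x. G (U k Ms x))"
      by (rule continuous_on_compose2[OF cG0 smooth1_continuous[OF smooth1_U[OF \<eta>(2)[OF k]]]]) auto
  next
    have "continuous_on (ball ks \<eta> \<times> UNIV) (\<lambda>(k, x). FU ((k, Ms), x))"
      unfolding case_prod_beta[of "\<lambda>k x. FU ((k, Ms), x)"]
      by (rule continuous_on_compose2[OF smooth_on_continuous[OF smU]]) (auto intro!: continuous_intros \<eta>(2))
    then have 1: "continuous_on (ball ks \<eta> \<times> UNIV) (\<lambda>z. U (fst z) Ms (snd z))" by (simp add: case_prod_beta)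
    have "smooth_on (\<Omega> \<times> UNIV) D" unfolding D_def by (rule smooth_on_dirD[OF smU])
    then have 2: "continuous_on (ball ks \<eta> \<times> UNIV) (\<lambda>z. D ((fst z, Ms), snd z))"
      by (rule continuous_on_compose2[OF smooth_on_continuous]) (auto intro!: continuous_intros \<eta>(2))
    show "continuous_on (ball ks \<eta> \<times> UNIV) (\<lambda>(k, x). G' (U k Ms x) * D ((k, Ms), x))"
      unfolding case_prod_beta by (intro continuous_intros 2 continuous_on_compose2[OF cG 1]) auto
  qed (rule \<eta>)
  then show ?thesis by (simp add: avg_def w_def D_def has_real_derivative_iff_has_vector_derivative)
qed

lemma avg_w: "avg w = 0"
proof -
  have "((\<lambda>k. avg (\<lambda>x. U k Ms x)) has_real_derivative avg (\<lambda>x. 1 * w x)) (at ks)"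
    by (rule avg_leibniz[of "\<lambda>u. u" "\<lambda>u. 1"]) auto
  then have "((\<lambda>k. Ms) has_real_derivative avg (\<lambda>x. 1 * w x)) (at ks)"
    by (rule has_real_derivative_near) (use avgU in auto)
  from DERIV_unique[OF this DERIV_const] show ?thesis by simp
qed

text \<open>U0 has mean zero, so the cross term 6 M U0 drops out and the dependence on M becomes
  explicit.\<close>

lemma avg_3U2: assumes "(k, M) \<in> \<Omega>" shows "avg (\<lambda>x. 3 * (U k M x)^2) = 3 * M^2 + qbar0 U0 k"
proof -
  have c: "continuous_on UNIV (U k M)" by (rule smooth1_continuous[OF smooth1_U[OF assms]])
  have e: "U0 k = (\<lambda>x. U k M x - M)" using U0[OF assms] by auto
  have c': "continuous_on UNIV (U0 k)" unfolding e by (intro continuous_intros c)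
  have a: "avg (U0 k) = 0" using avg_diff[OF c continuous_on_const[of UNIV M]] avgU[OF assms] by (simp add: e avg_const)
  have "(\<lambda>x. 3 * (U k M x)^2) = (\<lambda>x. 3 * M^2 + (6 * M * U0 k x + 3 * (U0 k x)^2))"
    unfolding e by (simp add: fun_eq_iff power2_eq_square algebra_simps)
  then have "avg (\<lambda>x. 3 * (U k M x)^2) = avg (\<lambda>x. 3 * M^2) + (avg (\<lambda>x. 6 * M * U0 k x) + avg (\<lambda>x. 3 * (U0 k x)^2))"
    by (simp only:) (subst avg_add, (intro continuous_intros c')+, subst avg_add, (intro continuous_intros c')+, rule refl)
  then show ?thesis by (simp only: avg_cmult_real avg_const a qbar0_def)
qed

definition ck where "ck = deriv c0 ks"
definition qk where "qk = deriv (qbar0 U0) ks"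

text \<open>Existence comes from the smoothness of c in the direction (1, 0); since c and c0 differ
  by 6 M, their k-derivatives coincide.\<close>

lemma dk_c: "((\<lambda>k. c k Ms) has_real_derivative ck) (at ks)" and dc0: "(c0 has_real_derivative ck) (at ks)"
proof -
  obtain d where d: "((\<lambda>k. c k Ms) has_real_derivative d) (at ks)"
    using dirD_line[OF smc, of "(ks, Ms)" 0 "(1, 0)"] star deriv_shift_real[of "\<lambda>k. c k Ms"] by auto
  then have "((\<lambda>k. c k Ms - 6 * Ms) has_real_derivative d) (at ks)"
    by (auto intro!: derivative_eq_intros)
  then have d': "(c0 has_real_derivative d) (at ks)"
    by (rule has_real_derivative_near) (use c0 in auto)
  then have "ck = d" by (simp add: ck_def DERIV_imp_deriv)
  then show "((\<lambda>k. c k Ms) has_real_derivative ck) (at ks)" "(c0 has_real_derivative ck) (at ks)" using d d' by auto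
qed

lemma dk_q: "((\<lambda>k. avg (\<lambda>x. 3 * (U k Ms x)^2)) has_real_derivative qk) (at ks)"
  and dq0: "(qbar0 U0 has_real_derivative qk) (at ks)"
  and qk: "qk = avg (\<lambda>x. 6 * V x * w x)"
proof -
  have d: "((\<lambda>k. avg (\<lambda>x. 3 * (U k Ms x)^2)) has_real_derivative avg (\<lambda>x. 6 * V x * w x)) (at ks)"
    by (rule avg_leibniz[of "\<lambda>u. 3 * u^2" "\<lambda>u. 6 * u"]) (auto intro!: derivative_eq_intros continuous_intros)
  then have "((\<lambda>k. avg (\<lambda>x. 3 * (U k Ms x)^2) - 3 * Ms^2) has_real_derivative avg (\<lambda>x. 6 * V x * w x)) (at ks)"
    by (auto intro!: derivative_eq_intros)
  then have d': "(qbar0 U0 has_real_derivative avg (\<lambda>x. 6 * V x * w x)) (at ks)"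
    by (rule has_real_derivative_near) (use avg_3U2 in auto)
  then show "qk = avg (\<lambda>x. 6 * V x * w x)" by (simp add: qk_def DERIV_imp_deriv)
  with d d' show "((\<lambda>k. avg (\<lambda>x. 3 * (U k Ms x)^2)) has_real_derivative qk) (at ks)"
    "(qbar0 U0 has_real_derivative qk) (at ks)" by auto
qed

lemma dM: "((\<lambda>M. c ks M) has_real_derivative 6) (at Ms)"
  "((\<lambda>M. avg (\<lambda>x. 3 * (U ks M x)^2)) has_real_derivative 6 * Ms) (at Ms)"
proof -
  obtain \<eta> where \<eta>: "\<eta> > 0" "\<And>t. t \<in> ball 0 \<eta> \<Longrightarrow> (ks, Ms) + t *\<^sub>R (0, 1) \<in> \<Omega>"
    using line_in_open[OF op star, of "(0, 1)"] by blast
  have n: "(ks, M) \<in> \<Omega>" if "M \<in> ball Ms \<eta>" for M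
    using \<eta>(2)[of "M - Ms"] that by (simp add: dist_real_def abs_minus_commute)
  have "((\<lambda>M. 6 * M + c0 ks) has_real_derivative 6) (at Ms)" by (auto intro!: derivative_eq_intros)
  then show "((\<lambda>M. c ks M) has_real_derivative 6) (at Ms)"
    by (rule has_field_derivative_transform_within_open[of _ _ _ "ball Ms \<eta>"]) (use \<eta> n c0 in auto)
  have "((\<lambda>M. 3 * M^2 + qbar0 U0 ks) has_real_derivative 6 * Ms) (at Ms)" by (auto intro!: derivative_eq_intros)
  then show "((\<lambda>M. avg (\<lambda>x. 3 * (U ks M x)^2)) has_real_derivative 6 * Ms) (at Ms)"
    by (rule has_field_derivative_transform_within_open[of _ _ _ "ball Ms \<eta>"]) (use \<eta> n avg_3U2 in auto)
qed

lemma s_eq: "s = 6 * Ms + c0 ks" using c0[OF star] .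

text \<open>The M-derivatives are 6 and 6 Ms, and s = 6 Ms + c0 ks, so the coefficient l - s + 6 Ms
  collapses to l - c0 ks.\<close>

lemma modulation_iff:
  "modulation_eqs U c ks Ms l \<kappa> \<mu> \<longleftrightarrow>
     l * \<kappa> + of_real ks * (of_real ck * \<kappa> + 6 * \<mu>) = 0 \<and>
     of_real qk * \<kappa> + (l - of_real (c0 ks)) * \<mu> = 0"
  unfolding modulation_eqs_def DERIV_imp_deriv[OF dk_c] DERIV_imp_deriv[OF dk_q] DERIV_imp_deriv[OF dM(1)] DERIV_imp_deriv[OF dM(2)]
  by (simp add: s_eq)

text \<open>On \<Omega> the flux is (k (6 M + c0 k), 3 M^2 + qbar0 k), so total differentiability
  reduces to that of c0 and qbar0 in one variable.\<close>

lemma flux_derivative: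
  "(whitham_flux U c has_derivative (\<lambda>h. ((s + ks * ck) * fst h + 6 * ks * snd h, qk * fst h + 6 * Ms * snd h))) (at (ks, Ms))"
proof -
  have 1: "((\<lambda>z. c0 (fst z)) has_derivative (\<lambda>h. ck * fst h)) (at (ks, Ms))"
    using has_derivative_compose[OF has_derivative_fst[OF has_derivative_ident], of c0 "(*) ck" "(ks, Ms)" UNIV] dc0
    by (simp add: has_field_derivative_def)
  have 2: "((\<lambda>z. qbar0 U0 (fst z)) has_derivative (\<lambda>h. qk * fst h)) (at (ks, Ms))"
    using has_derivative_compose[OF has_derivative_fst[OF has_derivative_ident], of "qbar0 U0" "(*) qk" "(ks, Ms)" UNIV] dq0
    by (simp add: has_field_derivative_def)
  have "((\<lambda>z. (fst z * (6 * snd z + c0 (fst z)), 3 * (snd z)^2 + qbar0 U0 (fst z))) has_derivative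
     (\<lambda>h. ((s + ks * ck) * fst h + 6 * ks * snd h, qk * fst h + 6 * Ms * snd h))) (at (ks, Ms))"
    by (auto intro!: derivative_eq_intros 1 2 simp: fun_eq_iff s_eq algebra_simps)
  then show ?thesis
    by (rule has_derivative_transform_within_open[OF _ op star])
      (auto simp: whitham_flux_def c0 avg_3U2)
qed

lemma cderiv_flux:
  "cderiv (whitham_flux U c) (ks, Ms) v =
    (of_real (s + ks * ck) * fst v + of_real (6 * ks) * snd v, of_real qk * fst v + of_real (6 * Ms) * snd v)"
  unfolding cderiv_def frechet_derivative_at[OF flux_derivative, symmetric]
  by (simp add: Let_def complex_eq_iff)

lemma Dx_pow: "(Dx ^^ 2) f = Dx (Dx f)" "(Dx ^^ 3) f = Dx (Dx (Dx f))" "(Dx ^^ 4) f = Dx (Dx (Dx (Dx f)))"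
  by (simp_all add: eval_nat_numeral)

text \<open>The terms in w form the linearization applied to w; those in V come from differentiating
  the explicit powers of k and the speed.\<close>

lemma profile_dk:
  "- (s + ks * ck) * Dx V x + 6 * V x * Dx V x - ks * s * Dx w x + 6 * ks * (w x * Dx V x + V x * Dx w x)
   + 3 * ks^2 * Dx (Dx (Dx V)) x + ks^3 * Dx (Dx (Dx w)) x
   + \<delta> * (2 * ks * Dx (Dx V) x + ks^2 * Dx (Dx w) x + 4 * ks^3 * Dx (Dx (Dx (Dx V))) x + ks^4 * Dx (Dx (Dx (Dx w))) x) = 0"
  (is "?lhs = 0")
proof -
  note d = dk_U[of 0 x, simplified] dk_U[of 1 x, simplified] dk_U[of 2 x, unfolded Dx_pow] dk_U[of 3 x, unfolded Dx_pow] dk_U[of 4 x, unfolded Dx_pow]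
  have "((\<lambda>k. - k * c k Ms * Dx (U k Ms) x + 6 * k * U k Ms x * Dx (U k Ms) x + k^3 * Dx (Dx (Dx (U k Ms))) x
     + \<delta> * (k^2 * Dx (Dx (U k Ms)) x + k^4 * Dx (Dx (Dx (Dx (U k Ms)))) x)) has_real_derivative ?lhs) (at ks)"
    by (rule derivative_eq_intros d dk_c refl)+ (simp add: algebra_simps)
  then have "((\<lambda>k. 0) has_real_derivative ?lhs) (at ks)"
    by (rule has_real_derivative_near) (use prof in \<open>auto simp: profile_eq_def Dx_pow\<close>)
  from DERIV_unique[OF this DERIV_const] show ?thesis .
qed

end

section \<open>Averages, modulation equations and plane waves\<close>

lemma lin_op_lincomb:
  assumes "smooth1 f" "smooth1 g" "smooth1 V"
  shows "lin_op \<delta> k V s (\<lambda>x. f x + a * g x) x = lin_op \<delta> k V s f x + a * lin_op \<delta> k V s g x"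
proof -
  have D: "Dx (\<lambda>x. p x + a * q x) = (\<lambda>x. Dx p x + a * Dx q x)" if "smooth1 p" "smooth1 q" for p q
    by (rule Dx_ext) (intro has_vector_derivative_add has_vector_derivative_mult_right smooth1_D that)
  have "smooth1 (\<lambda>x. f x + a * g x)" by (intro smooth1_intros assms)
  then show ?thesis
    by (simp add: lin_op_expand assms D smooth1_Dx) (simp add: algebra_simps)
qed

text \<open>Everything without an undifferentiated factor \<nu> f or a higher power of \<nu> times f
  is the exact derivative of a periodic function and averages to 0. What survives carries at least
  one factor \<nu>.\<close>

lemma avg_bloch_op:
  assumes f: "smooth1 f" "periodic1 f" and V: "smooth1 V" "periodic1 V"
  shows "avg (bloch_op \<delta> k V s \<nu> f) =
    of_real k * \<nu> * avg (\<lambda>x. of_real (6 * V x - s) * f x)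
    + (of_real (k^3) * \<nu>^3 + of_real \<delta> * (of_real (k^2) * \<nu>^2 + of_real (k^4) * \<nu>^4)) * avg f"
proof -
  let ?\<Phi> = "\<lambda>x. of_real k * (of_real (6 * V x - s) * f x)
    + of_real (k^3) * (Dx (Dx f) x + 3 * \<nu> * Dx f x + 3 * \<nu>^2 * f x)
    + of_real \<delta> * (of_real (k^2) * (Dx f x + 2 * \<nu> * f x)
      + of_real (k^4) * (Dx (Dx (Dx f)) x + 4 * \<nu> * Dx (Dx f) x + 6 * \<nu>^2 * Dx f x + 4 * \<nu>^3 * f x))"
  \<comment> \<open>The zero in \<open>Dx V x - 0\<close> is the derivative of the constant s, in
    the form given by the difference rule.\<close>
  let ?\<phi> = "\<lambda>x. of_real k * (of_real (6 * V x - s) * Dx f x + of_real (6 * Dx V x - 0) * f x)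
    + of_real (k^3) * (Dx (Dx (Dx f)) x + 3 * \<nu> * Dx (Dx f) x + 3 * \<nu>^2 * Dx f x)
    + of_real \<delta> * (of_real (k^2) * (Dx (Dx f) x + 2 * \<nu> * Dx f x)
      + of_real (k^4) * (Dx (Dx (Dx (Dx f))) x + 4 * \<nu> * Dx (Dx (Dx f)) x + 6 * \<nu>^2 * Dx (Dx f) x + 4 * \<nu>^3 * Dx f x))"
  have 1: "(?\<Phi> has_vector_derivative ?\<phi> x) (at x)" for x
    by (intro has_vector_derivative_add has_vector_derivative_mult_right has_vector_derivative_mult has_vector_derivative_diff
        has_vector_derivative_const bounded_linear.has_vector_derivative[OF bounded_linear_of_real] smooth1_D smooth1_Dx f V)
  have p: "periodic1 (Dx f)" "periodic1 (Dx (Dx f))" "periodic1 (Dx (Dx (Dx f)))"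
    by (intro periodic1_Dx smooth1_Dx f)+
  have "periodic1 ?\<Phi>" using p f V by (simp add: periodic1_def)
  from avg_integral_Dx[OF 1 this] have 0: "avg ?\<phi> = 0" .
  have c: "continuous_on UNIV f" "continuous_on UNIV (Dx f)" "continuous_on UNIV (Dx (Dx f))" "continuous_on UNIV (Dx (Dx (Dx f)))"
    "continuous_on UNIV (Dx (Dx (Dx (Dx f))))" "continuous_on UNIV V" "continuous_on UNIV (Dx V)"
    by (intro smooth1_continuous smooth1_Dx f V)+
  define \<phi> where "\<phi> = ?\<phi>"
  define R where "R = of_real (k^3) * \<nu>^3 + of_real \<delta> * (of_real (k^2) * \<nu>^2 + of_real (k^4) * \<nu>^4)"
  define p where "p x = of_real k * \<nu> * (of_real (6 * V x - s) * f x)" for x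
  have cont: "continuous_on UNIV \<phi>" "continuous_on UNIV p" "continuous_on UNIV (\<lambda>x. R * f x)"
    "continuous_on UNIV (\<lambda>x. p x + R * f x)"
    unfolding \<phi>_def p_def by (intro continuous_intros c)+
  have eq: "bloch_op \<delta> k V s \<nu> f x = \<phi> x + (p x + R * f x)" for x
    unfolding bloch_op_expand[OF f(1) V(1)] \<phi>_def p_def R_def of_real_diff of_real_0 by algebra
  have "avg (bloch_op \<delta> k V s \<nu> f) = avg (\<lambda>x. \<phi> x + (p x + R * f x))"
    by (rule arg_cong[of _ _ avg]) (rule ext, rule eq)
  also have "\<dots> = avg \<phi> + (avg p + avg (\<lambda>x. R * f x))"
    unfolding avg_add[OF cont(1,4)] avg_add[OF cont(2,3)] ..
  also have "\<dots> = avg p + R * avg f" using 0 by (simp only: \<phi>_def avg_cmult add_0)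
  also have "avg p = of_real k * \<nu> * avg (\<lambda>x. of_real (6 * V x - s) * f x)" unfolding p_def by (rule avg_cmult)
  finally show ?thesis unfolding R_def .
qed

text \<open>The neighbourhood filter includes the point 0 itself, so the remainder bound there
  already gives the value; dividing it by |\<xi>| gives the derivative.\<close>

lemma quadratic_remainder_derivative:
  fixes f :: "real \<Rightarrow> complex"
  assumes "\<forall>\<^sub>F \<xi> in nhds 0. norm (f \<xi> - (a + of_real \<xi> * b)) \<le> C * \<bar>\<xi>\<bar>^2"
  shows "f 0 = a" "(f has_vector_derivative b) (at 0)"
proof -
  have "norm (f 0 - a) \<le> 0" using eventually_nhds_x_imp_x[OF assms] by simp
  then show 0: "f 0 = a" by simp
  have "((\<lambda>\<xi>. C * \<bar>\<xi>\<bar>) \<longlongrightarrow> C * \<bar>0\<bar>) (at 0)" by (intro tendsto_intros)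
  then have lim: "((\<lambda>\<xi>. C * \<bar>\<xi>\<bar>) \<longlongrightarrow> 0) (at 0)" by simp
  have "((\<lambda>\<xi>. norm (f (0 + \<xi>) - f 0 - \<xi> *\<^sub>R b) / norm \<xi>) \<longlongrightarrow> 0) (at 0)"
  proof (rule tendsto_sandwich[OF _ _ tendsto_const lim])
    have "\<forall>\<^sub>F \<xi> in at 0. norm (f \<xi> - (a + of_real \<xi> * b)) \<le> C * \<bar>\<xi>\<bar>^2 \<and> \<xi> \<noteq> 0"
      using assms by (auto simp: eventually_at_filter elim: eventually_mono)
    then show "\<forall>\<^sub>F \<xi> in at 0. norm (f (0 + \<xi>) - f 0 - \<xi> *\<^sub>R b) / norm \<xi> \<le> C * \<bar>\<xi>\<bar>"
    proof eventually_elim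
      case (elim \<xi>)
      then show ?case by (simp add: 0 divide_le_eq power2_eq_square scaleR_conv_of_real algebra_simps)
    qed
  qed auto
  then show "(f has_vector_derivative b) (at 0)"
    by (simp add: has_vector_derivative_def has_derivative_at bounded_linear_scaleR_left)
qed

lemma vector_derivative_quotient:
  fixes f :: "real \<Rightarrow> complex"
  assumes "(f has_vector_derivative b) (at 0)" "f 0 = 0"
  shows "((\<lambda>\<xi>. f \<xi> / of_real \<xi>) \<longlongrightarrow> b) (at 0)"
proof -
  have "((\<lambda>\<xi>. norm (f (0 + \<xi>) - f 0 - \<xi> *\<^sub>R b) / norm \<xi>) \<longlongrightarrow> 0) (at 0)"
    using assms by (simp add: has_vector_derivative_def has_derivative_at)
  then have "((\<lambda>\<xi>. norm (f \<xi> / of_real \<xi> - b)) \<longlongrightarrow> 0) (at 0)"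
  proof (rule Lim_transform_eventually)
    show "\<forall>\<^sub>F \<xi> in at 0. norm (f (0 + \<xi>) - f 0 - \<xi> *\<^sub>R b) / norm \<xi> = norm (f \<xi> / of_real \<xi> - b)"
      unfolding eventually_at_filter
    proof (intro always_eventually allI impI)
      fix \<xi> :: real assume "\<xi> \<noteq> 0"
      then have "f \<xi> / of_real \<xi> - b = (f \<xi> - of_real \<xi> * b) / of_real \<xi>" by (simp add: field_simps)
      then show "norm (f (0 + \<xi>) - f 0 - \<xi> *\<^sub>R b) / norm \<xi> = norm (f \<xi> / of_real \<xi> - b)"
        by (simp only: norm_divide) (simp add: assms scaleR_conv_of_real)
    qed
  qed
  then have "((\<lambda>\<xi>. f \<xi> / of_real \<xi> - b) \<longlongrightarrow> 0) (at 0)" by (simp add: tendsto_norm_zero_iff)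
  then show ?thesis by (simp add: LIM_zero_iff)
qed

section \<open>Linearization, averages and modulation equations at the wave\<close>

context wave_family
begin

abbreviation "cV x \<equiv> complex_of_real (V x)"
abbreviation "cV' x \<equiv> complex_of_real (Dx V x)"
abbreviation "cw x \<equiv> complex_of_real (w x)"

lemma smooth_cV': "smooth1 cV'" and smooth_cw: "smooth1 cw"
  by (intro smooth1_cof smooth1_Dx smoothV smooth_w)+

lemma Dx_cV': "Dx cV' = (\<lambda>x. of_real (Dx (Dx V) x))" "Dx (\<lambda>x. complex_of_real (Dx (Dx V) x)) = (\<lambda>x. of_real (Dx (Dx (Dx V)) x))"
    "Dx (\<lambda>x. complex_of_real (Dx (Dx (Dx V)) x)) = (\<lambda>x. of_real (Dx (Dx (Dx (Dx V))) x))"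
  by (simp_all add: Dx_of_real smoothV smooth1_Dx)

lemma Dx_cw: "Dx cw = (\<lambda>x. of_real (Dx w x))" "Dx (\<lambda>x. complex_of_real (Dx w x)) = (\<lambda>x. of_real (Dx (Dx w) x))"
    "Dx (\<lambda>x. complex_of_real (Dx (Dx w) x)) = (\<lambda>x. of_real (Dx (Dx (Dx w)) x))" "Dx (\<lambda>x. complex_of_real (Dx (Dx (Dx w)) x)) = (\<lambda>x. of_real (Dx (Dx (Dx (Dx w))) x))"
  by (simp_all add: Dx_of_real smooth_w smooth1_Dx)

text \<open>The \<nu>-derivative at \<nu> = 0 of the Bloch operator.\<close>

definition L1 :: "(real \<Rightarrow> complex) \<Rightarrow> real \<Rightarrow> complex" where
  "L1 f x = of_real (ks * (6 * V x - s)) * f x + of_real (3 * ks^3) * Dx (Dx f) x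
     + of_real \<delta> * (of_real (2 * ks^2) * Dx f x + of_real (4 * ks^4) * Dx (Dx (Dx f)) x)"

text \<open>Read off from the spectral assumption, in which V' spans the kernel.\<close>

lemma lin_op_cV': "lin_op \<delta> ks V s cV' x = 0"
proof -
  have "cV' \<in> ker0 (lin_op \<delta> ks V s)"
    using spec[OF star] cfun.span_base[of cV' "{cV'}"] by (simp add: spectral_assumption_def)
  then show ?thesis by (simp add: ker0_def fun_eq_iff)
qed

lemma lin_op_const: "lin_op \<delta> ks V s (\<lambda>x. a) x = a * of_real (6 * ks * Dx V x)"
  by (simp add: lin_op_expand[OF smooth1_const smoothV] Dx_const)

text \<open>This is \<open>profile_dk\<close> multiplied by \<open>ks\<close>. Adding ks w to an
  expansion thus removes L1 V' at order \<nu> and leaves a multiple of V', which a constant can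
  absorb because L[1] = 6 ks V'.\<close>

lemma lin_op_cw: "of_real ks * lin_op \<delta> ks V s cw x = - L1 cV' x + of_real (ks^2 * ck * Dx V x)"
proof -
  have "ks * (ks * ((6 * V x - s) * Dx w x + 6 * Dx V x * w x) + ks^3 * Dx (Dx (Dx w)) x
      + \<delta> * (ks^2 * Dx (Dx w) x + ks^4 * Dx (Dx (Dx (Dx w))) x)) =
    - (ks * (6 * V x - s) * Dx V x + 3 * ks^3 * Dx (Dx (Dx V)) x
     + \<delta> * (2 * ks^2 * Dx (Dx V) x + 4 * ks^4 * Dx (Dx (Dx (Dx V))) x)) + ks^2 * ck * Dx V x"
    (is "?a = ?b")
    using profile_dk[of x] by algebra
  then have "complex_of_real ?a = complex_of_real ?b" by (rule arg_cong)
  then show ?thesis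
    by (simp add: lin_op_expand[OF smooth_cw smoothV] L1_def Dx_cV' Dx_cw)
qed

lemma avg_cw: "avg cw = 0" 
  by (simp add: avg_of_real smooth1_continuous smooth_w avg_w)

lemma avg_weight_cw: "avg (\<lambda>x. of_real (6 * V x - s) * cw x) = of_real qk"
proof -
  have c: "continuous_on UNIV V" "continuous_on UNIV w" by (intro smooth1_continuous smoothV smooth_w)+
  have "avg (\<lambda>x. of_real (6 * V x - s) * cw x) = avg (\<lambda>x. complex_of_real (6 * V x * w x - s * w x))"
    by (simp add: algebra_simps)
  also have "\<dots> = of_real (avg (\<lambda>x. 6 * V x * w x - s * w x))"
    by (rule avg_of_real) (intro continuous_intros c)
  also have "avg (\<lambda>x. 6 * V x * w x - s * w x) = qk"
    by (subst avg_diff) (auto intro!: continuous_intros c simp: avg_cmult_real avg_w qk)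
  finally show ?thesis .
qed

lemma avg_cV': "avg cV' = 0"
  using avg_integral_Dx[of V "Dx V"] smooth1_D[OF smoothV] perV
  by (simp add: avg_of_real smooth1_continuous smooth1_Dx smoothV)

lemma avg_weight_cV': "avg (\<lambda>x. of_real (6 * V x - s) * cV' x) = 0"
proof (rule avg_integral_Dx)
  show "((\<lambda>x. complex_of_real (3 * (V x * V x) - s * V x)) has_vector_derivative of_real (6 * V x - s) * cV' x) (at x)" for x
  proof -
    have "((\<lambda>x. complex_of_real (3 * (V x * V x) - s * V x)) has_vector_derivative
       complex_of_real (3 * (V x * Dx V x + Dx V x * V x) - s * Dx V x)) (at x)"
      by (intro bounded_linear.has_vector_derivative[OF bounded_linear_of_real] has_vector_derivative_diff
          has_vector_derivative_mult_right has_vector_derivative_mult smooth1_D smoothV)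
    then show ?thesis by (simp add: algebra_simps)
  qed
  show "periodic1 (\<lambda>x. complex_of_real (3 * (V x * V x) - s * V x))" using perV by (simp add: periodic1_def)
qed

lemma avg_weight_const: fixes a :: complex shows "avg (\<lambda>x. of_real (6 * V x - s) * a) = - of_real (c0 ks) * a"
proof -
  have c: "continuous_on UNIV V" by (intro smooth1_continuous smoothV)
  have "avg (\<lambda>x. of_real (6 * V x - s) * a) = a * avg (\<lambda>x. complex_of_real (6 * V x - s))"
    by (subst avg_cmult[symmetric]) (simp add: mult.commute)
  also have "avg (\<lambda>x. complex_of_real (6 * V x - s)) = of_real (avg (\<lambda>x. 6 * V x - s))"
    by (rule avg_of_real) (intro continuous_intros c)
  also have "avg (\<lambda>x. 6 * V x - s) = 6 * avg (\<lambda>x. V x) - s"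
    by (subst avg_diff) (auto intro!: continuous_intros c simp: avg_cmult_real avg_const)
  also have "\<dots> = - c0 ks" using avgU[OF star] s_eq by simp
  finally show ?thesis by simp
qed

text \<open>Elimination of \<mu>: (l - c0 ks) times the first equation minus 6 ks times the second
  is \<kappa> times the dispersion polynomial.\<close>

lemma dispersion_iff:
  assumes "\<kappa> \<noteq> 0" "modulation_eqs U c ks Ms l \<kappa> \<mu>"
  shows "dispersion_poly c0 U0 ks l = 0"
proof -
  from assms(2) have 1: "l * \<kappa> + of_real ks * (of_real ck * \<kappa> + 6 * \<mu>) = 0"
    and 2: "of_real qk * \<kappa> + (l - of_real (c0 ks)) * \<mu> = 0" by (simp_all add: modulation_iff)
  have "\<kappa> * dispersion_poly c0 U0 ks l = 0"
    using 1 2 unfolding dispersion_poly_def ck_def[symmetric] qk_def[symmetric] of_real_add of_real_mult of_real_diff of_real_numeral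
    by algebra
  then show ?thesis using assms(1) by simp
qed

text \<open>On an exponential, which never vanishes, the linearized system is \<nu> times that
  exponential times the two left-hand sides of the modulation equations. Returning to the fixed
  frame turns l into l - s: the s cancels in the first row of the flux derivative and combines with
  6 Ms to - c0 ks in the second.\<close>

lemma plane_wave_iff:
  "solves_linearization_comoving (whitham_flux U c) (ks, Ms) s (plane_wave \<nu> l \<kappa> \<mu>) \<longleftrightarrow>
    \<nu> = 0 \<or> modulation_eqs U c ks Ms l \<kappa> \<mu>"
proof -
  let ?E = "\<lambda>X T. exp (\<nu> * (of_real (X - s * T) + l * of_real T))"
  let ?w = "\<lambda>X T. plane_wave \<nu> l \<kappa> \<mu> (X - s * T) T"
  have E: "?E X T \<noteq> 0" for X T by simp
  have exp_line: "((\<lambda>t. exp (p + of_real t * q) * a) has_vector_derivative q * exp (p + of_real t0 * q) * a) (at t0)"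
    for p q a :: complex and t0
  proof -
    have "((\<lambda>t. p + of_real t * q) has_vector_derivative 0 + of_real 1 * q) (at t0)"
      by (intro has_vector_derivative_mult_left has_vector_derivative_add has_vector_derivative_const
          has_vector_derivative_id bounded_linear.has_vector_derivative[OF bounded_linear_of_real])
    from has_vector_derivative_mult_left[OF field_vector_diff_chain_at[OF this DERIV_exp], of a]
    show ?thesis by (simp add: o_def)
  qed
  have dT: "((\<lambda>t. ?w X t) has_vector_derivative (\<nu> * (l - of_real s) * ?E X T * \<kappa>, \<nu> * (l - of_real s) * ?E X T * \<mu>)) (at T)" for X T
  proof -
    have "\<nu> * (of_real (X - s * t) + l * of_real t) = \<nu> * of_real X + of_real t * (\<nu> * (l - of_real s))" for t
      by (simp add: algebra_simps)
    then show ?thesis unfolding plane_wave_def by (simp only:) (intro has_vector_derivative_Pair exp_line)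
  qed
  have dX: "((\<lambda>y. ?w y T) has_vector_derivative (\<nu> * ?E X T * \<kappa>, \<nu> * ?E X T * \<mu>)) (at X)" for X T
  proof -
    have "\<nu> * (of_real (y - s * T) + l * of_real T) = \<nu> * (l - of_real s) * of_real T + of_real y * \<nu>" for y
      by (simp add: algebra_simps)
    then show ?thesis unfolding plane_wave_def by (simp only:) (intro has_vector_derivative_Pair exp_line)
  qed
  let ?m1 = "l * \<kappa> + of_real ks * (of_real ck * \<kappa> + 6 * \<mu>)"
  let ?m2 = "of_real qk * \<kappa> + (l - of_real (c0 ks)) * \<mu>"
  have red: "(\<nu> * (l - of_real s) * ?E X T * \<kappa>, \<nu> * (l - of_real s) * ?E X T * \<mu>) +
      cderiv (whitham_flux U c) (ks, Ms) (\<nu> * ?E X T * \<kappa>, \<nu> * ?E X T * \<mu>) = (\<nu> * ?E X T * ?m1, \<nu> * ?E X T * ?m2)" for X T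
    unfolding cderiv_flux by (simp add: s_eq algebra_simps)
  have ex: "(\<exists>wT wX. ((\<lambda>t. ?w X t) has_vector_derivative wT) (at T) \<and> ((\<lambda>y. ?w y T) has_vector_derivative wX) (at X) \<and>
     wT + cderiv (whitham_flux U c) (ks, Ms) wX = 0) \<longleftrightarrow> (\<nu> * ?E X T * ?m1, \<nu> * ?E X T * ?m2) = 0" for X T
    unfolding red[symmetric]
    using dT[of X T] dX[of T X] vector_derivative_unique_at[OF _ dT[of X T]] vector_derivative_unique_at[OF _ dX[of T X]] by blast
  have "solves_linearization_comoving (whitham_flux U c) (ks, Ms) s (plane_wave \<nu> l \<kappa> \<mu>) \<longleftrightarrow>
    (\<forall>X T. (\<nu> * ?E X T * ?m1, \<nu> * ?E X T * ?m2) = 0)"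
    unfolding solves_linearization_comoving_def solves_linearization_def
    by (simp only: ex)
  also have "\<dots> \<longleftrightarrow> \<nu> = 0 \<or> (?m1 = 0 \<and> ?m2 = 0)" using E by (auto simp: zero_prod_def)
  finally show ?thesis by (simp add: modulation_iff)
qed

text \<open>The assumed quantity is the discriminant: writing c0 for c0 ks, (ks ck - c0)^2 + 4 (ks
  c0 ck + 6 ks qk) = (c0 + ks ck)^2 + 24 ks qk.\<close>

lemma real_roots:
  assumes "(c0 ks + ks * ck)^2 + 24 * ks * qk > 0"
  shows "\<exists>r1 r2 :: real. r1 \<noteq> r2 \<and>
     (\<forall>z. dispersion_poly c0 U0 ks z = 0 \<longleftrightarrow> z = of_real r1 \<or> z = of_real r2)"
proof -
  define D where "D = (c0 ks + ks * ck)^2 + 24 * ks * qk"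
  define b where "b = ks * ck - c0 ks"
  define r1 where "r1 = (- b + sqrt D) / 2"
  define r2 where "r2 = (- b - sqrt D) / 2"
  have D: "D > 0" "sqrt D ^ 2 = D" using assms by (auto simp: D_def)
  have sum: "r1 + r2 = - b" by (simp add: r1_def r2_def field_simps)
  have "4 * (r1 * r2) = b^2 - sqrt D ^ 2" by (simp add: r1_def r2_def field_simps power2_eq_square)
  then have prod: "r1 * r2 = - (ks * c0 ks * ck + 6 * ks * qk)"
    unfolding D(2) unfolding D_def b_def by (simp add: power2_eq_square algebra_simps)
  have "dispersion_poly c0 U0 ks z = (z - of_real r1) * (z - of_real r2)" for z
  proof -
    have "(z - of_real r1) * (z - of_real r2) = z^2 - of_real (r1 + r2) * z + of_real (r1 * r2)"
      by (simp add: power2_eq_square algebra_simps)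
    then show ?thesis unfolding sum prod by (simp add: dispersion_poly_def b_def ck_def qk_def left_diff_distrib)
  qed
  moreover have "r1 \<noteq> r2" using D by (simp add: r1_def r2_def)
  ultimately show ?thesis by (intro exI[of _ r1] exI[of _ r2]) auto
qed

end

section \<open>Expansion of a Bloch curve\<close>

context wave_family
begin

text \<open>All data are carried over to the real parameter \<xi> with \<nu> = \<i> \<xi>, where the
  curve is jointly smooth; each coefficient of \<nu> then appears with a factor \<i>. The constant
  k0 is \<alpha> ks when u0 = \<alpha> V'.\<close>

lemma bloch_curve_modulation:
  assumes bc: "bloch_curve \<delta> ks V s \<epsilon> lam uhat" and ce: "curve_expansions ks lam uhat l0 u0 u1" and ne: "u0 y0 \<noteq> 0"
  shows "\<exists>k0. k0 \<noteq> 0 \<and> (\<forall>x. u0 x = k0 / of_real ks * cV' x) \<and> modulation_eqs U c ks Ms l0 k0 (avg u1)"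
proof -
  define G where "G = (\<lambda>(\<xi>::real, x). uhat (\<i> * of_real \<xi>) x)"
  define P where "P = {-\<epsilon><..<\<epsilon>}"
  define \<Lambda> where "\<Lambda> \<xi> = lam (\<i> * of_real \<xi>)" for \<xi> :: real
  have P: "open P" "0 \<in> P" and smG: "smooth_on (P \<times> UNIV) G"
    and perG: "\<And>\<xi>. \<xi> \<in> P \<Longrightarrow> periodic1 (\<lambda>x. G (\<xi>, x))"
    and eqG: "\<And>\<xi>. \<xi> \<in> P \<Longrightarrow> bloch_eq \<delta> ks V s (\<i> * of_real \<xi>) (\<Lambda> \<xi>) (\<lambda>x. G (\<xi>, x))"
    using bc by (auto simp: bloch_curve_def P_def G_def \<Lambda>_def)
  obtain C\<^sub>1 where "\<forall>\<^sub>F \<xi> in nhds 0. cmod (\<Lambda> \<xi> - \<i> * of_real \<xi> * of_real ks * l0) \<le> C\<^sub>1 * \<bar>\<xi>\<bar>^2"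
    using ce by (auto simp: curve_expansions_def \<Lambda>_def)
  then have "\<forall>\<^sub>F \<xi> in nhds 0. cmod (\<Lambda> \<xi> - (0 + of_real \<xi> * (\<i> * of_real ks * l0))) \<le> C\<^sub>1 * \<bar>\<xi>\<bar>^2"
    by (simp add: algebra_simps)
  note \<Lambda> = quadratic_remainder_derivative[OF this]
  obtain C where C: "\<forall>\<^sub>F \<xi> in nhds 0. \<forall>x. cmod (G (\<xi>, x) - (u0 x + of_real \<xi> * (\<i> * u1 x))) \<le> C * \<bar>\<xi>\<bar>^2"
    using ce by (auto simp: curve_expansions_def G_def mult.left_commute mult.assoc)
  then have "\<forall>\<^sub>F \<xi> in nhds 0. cmod (G (\<xi>, x) - (u0 x + of_real \<xi> * (\<i> * u1 x))) \<le> C * \<bar>\<xi>\<bar>^2" for x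
    by (auto elim: eventually_mono)
  note G0 = quadratic_remainder_derivative[OF this]
  have G0': "(\<lambda>x. G (0, x)) = u0" using G0(1) by auto
  \<comment> \<open>The coefficient u1 is given only through the expansion; recognizing it as a
    \<xi>-derivative of the family yields its smoothness, and below its periodicity.\<close>
  have dG: "dirD (1, 0) G (0, x) = \<i> * u1 x" for x
    using vector_derivative_unique_at[OF _ G0(2)[of x]] dirD_line[OF smG, of "(0, x)" 0 "(1, 0)"] P(2) by simp
  have su0: "smooth1 u0" using smooth1_slice(1)[OF smG P(2)] by (simp add: G0')
  have "smooth1 (\<lambda>x. dirD (1, 0) G (0, x))" by (rule smooth1_slice(1)[OF smooth_on_dirD[OF smG] P(2)])
  then have "smooth1 (\<lambda>x. (- \<i>) * (\<i> * u1 x))" unfolding dG by (rule smooth1_mult[OF smooth1_const])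
  moreover have "(- \<i>) * (\<i> * u1 x) = u1 x" for x by (simp flip: mult.assoc)
  ultimately have su1: "smooth1 u1" by (simp only:)
  have pu0: "periodic1 u0" using perG[OF P(2)] by (simp add: G0')
  have pu1: "periodic1 u1"
    unfolding periodic1_def
  proof
    fix x
    have "((\<lambda>\<xi>. G (\<xi>, x + 1)) has_vector_derivative \<i> * u1 x) (at 0)"
      by (rule has_vector_derivative_transform_within_open[OF G0(2)[of x] P]) (use perG in \<open>simp add: periodic1_def\<close>)
    from vector_derivative_unique_at[OF this G0(2)] show "u1 (x + 1) = u1 x" by simp
  qed
  have "lin_op \<delta> ks V s u0 x = 0" for x
    using eqG[OF P(2)] \<Lambda>(1) by (simp add: bloch_eq_def G0' lin_op_bloch_op)
  then obtain \<alpha> where \<alpha>: "u0 = (\<lambda>x. \<alpha> * cV' x)" using kernel[OF su0 pu0] by blast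
  have \<alpha>0: "\<alpha> \<noteq> 0" using ne by (auto simp: \<alpha>)
  have d: "((\<lambda>\<xi>. (Dx ^^ j) (\<lambda>y. G (\<xi>, y)) x) has_vector_derivative \<i> * (Dx ^^ j) u1 x) (at 0)" for j x
  proof -
    have *: "(Dx ^^ j) (\<lambda>y. \<i> * f y) = (\<lambda>y. \<i> * (Dx ^^ j) f y)" if "smooth1 f" for f :: "real \<Rightarrow> complex"
      using that by (induction j arbitrary: f) (simp_all add: funpow_Suc_right Dx_cmult smooth1_Dx del: funpow.simps(2))
    show ?thesis
      using parameter_derivative[OF P(1) smG P(2), of j 1 x] by (simp add: dG * su1)
  qed
  \<comment> \<open>The coefficient of \<nu> in the Bloch equation, obtained by differentiating at
    \<xi> = 0.\<close>
  have lin1: "lin_op \<delta> ks V s u1 x + L1 u0 x + of_real ks * l0 * u0 x = 0" (is "?T = 0") for x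
  proof -
    define D0 where "D0 \<xi> = G (\<xi>, x)" for \<xi>
    define D1 where "D1 \<xi> = Dx (\<lambda>y. G (\<xi>, y)) x" for \<xi>
    define D2 where "D2 \<xi> = Dx (Dx (\<lambda>y. G (\<xi>, y))) x" for \<xi>
    define D3 where "D3 \<xi> = Dx (Dx (Dx (\<lambda>y. G (\<xi>, y)))) x" for \<xi>
    define D4 where "D4 \<xi> = Dx (Dx (Dx (Dx (\<lambda>y. G (\<xi>, y))))) x" for \<xi>
    note D_defs = D0_def D1_def D2_def D3_def D4_def
    have dD: "(D0 has_vector_derivative \<i> * u1 x) (at 0)" "(D1 has_vector_derivative \<i> * Dx u1 x) (at 0)"
      "(D2 has_vector_derivative \<i> * Dx (Dx u1) x) (at 0)" "(D3 has_vector_derivative \<i> * Dx (Dx (Dx u1)) x) (at 0)"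
      "(D4 has_vector_derivative \<i> * Dx (Dx (Dx (Dx u1))) x) (at 0)"
      using d[of 0 x] d[of 1 x] d[of 2 x, unfolded Dx_pow] d[of 3 x, unfolded Dx_pow] d[of 4 x, unfolded Dx_pow]
      unfolding D_defs[abs_def] by simp_all
    define W where "W = complex_of_real (6 * V x - s)"
    \<comment> \<open>The Bloch operator is sorted as A + \<nu> B + \<nu>^2 R, where R still depends
      on \<nu>. As R is differentiable, the last term has derivative 0 at \<xi> = 0.\<close>
    define A where "A \<xi> = of_real ks * (W * D1 \<xi> + of_real (6 * Dx V x) * D0 \<xi>) + of_real (ks^3) * D3 \<xi>
      + of_real \<delta> * (of_real (ks^2) * D2 \<xi> + of_real (ks^4) * D4 \<xi>)" for \<xi>
    define B where "B \<xi> = of_real ks * W * D0 \<xi> + of_real (3 * ks^3) * D2 \<xi>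
      + of_real \<delta> * (of_real (2 * ks^2) * D1 \<xi> + of_real (4 * ks^4) * D3 \<xi>)" for \<xi>
    define R where "R \<xi> = of_real (3 * ks^3) * D1 \<xi> + of_real \<delta> * (of_real (ks^2) * D0 \<xi> + of_real (6 * ks^4) * D2 \<xi>)
      + \<i> * of_real \<xi> * (of_real (ks^3) * D0 \<xi> + of_real \<delta> * (of_real (4 * ks^4) * D1 \<xi>) + \<i> * of_real \<xi> * (of_real \<delta> * (of_real (ks^4) * D0 \<xi>)))" for \<xi>
    have \<nu>B: "((\<lambda>\<xi>. \<i> * of_real \<xi> * F \<xi>) has_vector_derivative \<i> * F 0) (at 0)" if "(F has_vector_derivative f) (at 0)" for F f
    proof -
      have "((\<lambda>\<xi>. \<i> * of_real \<xi>) has_vector_derivative \<i> * of_real 1) (at 0)"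
        by (intro has_vector_derivative_mult_right bounded_linear.has_vector_derivative[OF bounded_linear_of_real] has_vector_derivative_id)
      from has_vector_derivative_mult[OF this that] show ?thesis by simp
    qed
    note intros = has_vector_derivative_add has_vector_derivative_mult_right
    have dA: "(A has_vector_derivative \<i> * lin_op \<delta> ks V s u1 x) (at 0)"
    proof -
      have "(A has_vector_derivative of_real ks * (W * (\<i> * Dx u1 x) + of_real (6 * Dx V x) * (\<i> * u1 x)) + of_real (ks^3) * (\<i> * Dx (Dx (Dx u1)) x)
        + of_real \<delta> * (of_real (ks^2) * (\<i> * Dx (Dx u1) x) + of_real (ks^4) * (\<i> * Dx (Dx (Dx (Dx u1))) x))) (at 0)"
        unfolding A_def[abs_def] by (intro intros dD)
      then show ?thesis by (simp add: lin_op_expand[OF su1 smoothV] W_def algebra_simps)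
    qed
    have "\<exists>d. (B has_vector_derivative d) (at 0)" unfolding B_def[abs_def] by (rule exI, (rule intros dD)+)
    then have dB: "((\<lambda>\<xi>. \<i> * of_real \<xi> * B \<xi>) has_vector_derivative \<i> * B 0) (at 0)" using \<nu>B by blast
    have "\<exists>d. (R has_vector_derivative d) (at 0)" unfolding R_def[abs_def] by (rule exI, (rule has_vector_derivative_add \<nu>B has_vector_derivative_mult_right dD)+)
    then have dR: "((\<lambda>\<xi>. \<i> * of_real \<xi> * (\<i> * of_real \<xi> * R \<xi>)) has_vector_derivative \<i> * (\<i> * of_real 0 * R 0)) (at 0)" using \<nu>B by blast
    have d\<Lambda>: "((\<lambda>\<xi>. \<Lambda> \<xi> * D0 \<xi>) has_vector_derivative \<Lambda> 0 * (\<i> * u1 x) + \<i> * of_real ks * l0 * D0 0) (at 0)"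
      by (rule has_vector_derivative_mult[OF \<Lambda>(2) dD(1)])
    have zero: "A \<xi> + \<i> * of_real \<xi> * B \<xi> + \<i> * of_real \<xi> * (\<i> * of_real \<xi> * R \<xi>) + \<Lambda> \<xi> * D0 \<xi> = 0" if "\<xi> \<in> P" for \<xi>
    proof -
      have "A \<xi> + \<i> * of_real \<xi> * B \<xi> + \<i> * of_real \<xi> * (\<i> * of_real \<xi> * R \<xi>) = bloch_op \<delta> ks V s (\<i> * of_real \<xi>) (\<lambda>x. G (\<xi>, x)) x"
        unfolding bloch_op_expand[OF smooth1_slice(1)[OF smG that] smoothV] D_defs[symmetric] W_def[symmetric]
        unfolding A_def B_def R_def of_real_mult of_real_numeral by algebra
      then show ?thesis using eqG[OF that] by (simp add: bloch_eq_def D0_def)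
    qed
    have "((\<lambda>\<xi>. A \<xi> + \<i> * of_real \<xi> * B \<xi> + \<i> * of_real \<xi> * (\<i> * of_real \<xi> * R \<xi>) + \<Lambda> \<xi> * D0 \<xi>) has_vector_derivative
      \<i> * lin_op \<delta> ks V s u1 x + \<i> * B 0 + \<i> * (\<i> * of_real 0 * R 0) + (\<Lambda> 0 * (\<i> * u1 x) + \<i> * of_real ks * l0 * D0 0)) (at 0)"
      by (intro has_vector_derivative_add dA dB dR d\<Lambda>)
    from has_vector_derivative_transform_within_open[OF this P zero]
    have "((\<lambda>\<xi>. 0) has_vector_derivative
      \<i> * lin_op \<delta> ks V s u1 x + \<i> * B 0 + \<i> * (\<i> * of_real 0 * R 0) + (\<Lambda> 0 * (\<i> * u1 x) + \<i> * of_real ks * l0 * D0 0)) (at 0)" .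
    from vector_derivative_unique_at[OF this has_vector_derivative_const]
    have "\<i> * (lin_op \<delta> ks V s u1 x + B 0 + of_real ks * l0 * D0 0) = 0" by (simp add: \<Lambda>(1) algebra_simps)
    moreover have "B 0 = L1 u0 x" unfolding B_def L1_def D_defs G0' W_def by (simp add: G0(1))
    ultimately show ?thesis by (simp add: D0_def G0(1))
  qed
  \<comment> \<open>Chosen so that L[b] = 6 ks b V' matches the multiples of V' with coefficients ks
    ck and l0 left over after subtracting \<alpha> ks w from u1; hence r lies in the kernel.\<close>
  define b where "b = - \<alpha> * (of_real (ks * ck) + l0) / 6"
  define r where "r x = u1 x + (- (\<alpha> * of_real ks)) * cw x + (- b)" for x
  have sr: "smooth1 r" unfolding r_def[abs_def] by (intro smooth1_intros su1 smooth_cw)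
  have pr: "periodic1 r" using pu1 per_w by (simp add: r_def periodic1_def)
  have L1u0: "L1 u0 x = \<alpha> * L1 cV' x" for x
    unfolding \<alpha> L1_def by (simp add: Dx_cmult smooth_cV' smooth1_Dx algebra_simps)
  have "lin_op \<delta> ks V s r x = 0" for x
  proof -
    have "lin_op \<delta> ks V s r x = lin_op \<delta> ks V s u1 x - \<alpha> * of_real ks * lin_op \<delta> ks V s cw x - b * of_real (6 * ks * Dx V x)"
      using lin_op_lincomb[OF smooth1_add[OF su1 smooth1_mult[OF smooth1_const[of "- (\<alpha> * of_real ks)"] smooth_cw]] smooth1_const[of "- b"] smoothV, of \<delta> ks s 1 x]
        lin_op_lincomb[OF su1 smooth_cw smoothV, of \<delta> ks s "- (\<alpha> * of_real ks)" x] 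
      by (simp add: r_def[abs_def] lin_op_const)
    also have "\<dots> = lin_op \<delta> ks V s u1 x - \<alpha> * (of_real ks * lin_op \<delta> ks V s cw x) - b * of_real (6 * ks * Dx V x)"
      by simp
    also have "lin_op \<delta> ks V s u1 x = - \<alpha> * L1 cV' x - of_real ks * l0 * \<alpha> * cV' x"
      using lin1[of x] unfolding L1u0 by (simp add: \<alpha> algebra_simps eq_neg_iff_add_eq_0)
    finally show ?thesis unfolding lin_op_cw b_def by (simp add: field_simps power2_eq_square)
  qed
  then obtain \<beta> where \<beta>: "r = (\<lambda>x. \<beta> * cV' x)" using kernel[OF sr pr] by blast
  \<comment> \<open>Both w and V' have mean zero, so the mean of u1 will be b; the undetermined
    kernel component \<beta> drops out of the averages below.\<close>
  have u1: "u1 = (\<lambda>x. \<alpha> * of_real ks * cw x + (b + \<beta> * cV' x))"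
    using fun_cong[OF \<beta>] by (simp add: r_def fun_eq_iff algebra_simps)
  have cont: "continuous_on UNIV cw" "continuous_on UNIV cV'" "continuous_on UNIV (\<lambda>x. complex_of_real (6 * V x - s))"
    "continuous_on UNIV u0" "continuous_on UNIV u1"
    by (intro smooth1_continuous smooth_cw smooth_cV' su0 su1 smoothV continuous_intros)+
  have a0: "avg u0 = 0" unfolding \<alpha> by (simp add: avg_cmult avg_cV')
  have m0: "avg (\<lambda>x. of_real (6 * V x - s) * u0 x) = 0"
  proof -
    have "(\<lambda>x. complex_of_real (6 * V x - s) * u0 x) = (\<lambda>x. \<alpha> * (of_real (6 * V x - s) * cV' x))" by (auto simp: \<alpha>)
    then show ?thesis by (simp only: avg_cmult avg_weight_cV' mult_zero_right)
  qed
  have a1: "avg u1 = b"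
  proof -
    have "avg u1 = \<alpha> * of_real ks * avg cw + (b + \<beta> * avg cV')"
      unfolding u1 by (subst avg_add, (intro continuous_intros cont)+, subst avg_add, (intro continuous_intros cont)+, simp only: avg_cmult avg_const)
    then show ?thesis by (simp add: avg_cw avg_cV')
  qed
  have m1: "avg (\<lambda>x. of_real (6 * V x - s) * u1 x) = \<alpha> * of_real ks * of_real qk - of_real (c0 ks) * b"
  proof -
    have "(\<lambda>x. of_real (6 * V x - s) * u1 x) = (\<lambda>x. \<alpha> * of_real ks * (of_real (6 * V x - s) * cw x) +
      (of_real (6 * V x - s) * b + \<beta> * (of_real (6 * V x - s) * cV' x)))"
      unfolding u1 by (simp add: fun_eq_iff algebra_simps)
    then have "avg (\<lambda>x. of_real (6 * V x - s) * u1 x) = \<alpha> * of_real ks * avg (\<lambda>x. of_real (6 * V x - s) * cw x) +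
       (avg (\<lambda>x. of_real (6 * V x - s) * b) + \<beta> * avg (\<lambda>x. of_real (6 * V x - s) * cV' x))"
      by (simp only:) (subst avg_add, (intro continuous_intros cont)+, subst avg_add, (intro continuous_intros cont)+, simp only: avg_cmult)
    then show ?thesis by (simp only: avg_weight_cw avg_weight_const avg_weight_cV') simp
  qed
  define m where "m \<xi> = avg (\<lambda>x. of_real (6 * V x - s) * G (\<xi>, x))" for \<xi>
  define a where "a \<xi> = avg (\<lambda>x. G (\<xi>, x))" for \<xi>
  \<comment> \<open>The remainder of the expansion is uniform in x, so averaging against a bounded
    weight keeps the quadratic bound. The weight 6 V - s yields the linearized flux and the weight 1
    the mass.\<close>
  have q: "((\<lambda>\<xi>. avg (\<lambda>x. W x * G (\<xi>, x)) / of_real \<xi>) \<longlongrightarrow> \<i> * avg (\<lambda>x. W x * u1 x)) (at 0)"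
    if W: "continuous_on UNIV W" "periodic1 W" and W0: "avg (\<lambda>x. W x * u0 x) = 0" for W :: "real \<Rightarrow> complex"
  proof -
    obtain A where A: "A > 0" "\<And>x. norm (W x) \<le> A" using periodic1_bounded[OF W] by blast
    have "\<forall>\<^sub>F \<xi> in nhds 0. \<xi> \<in> P" using P by (simp add: eventually_nhds_in_open)
    then have "\<forall>\<^sub>F \<xi> in nhds 0. norm (avg (\<lambda>x. W x * G (\<xi>, x)) - (0 + of_real \<xi> * (\<i> * avg (\<lambda>x. W x * u1 x)))) \<le> (A * C) * \<bar>\<xi>\<bar>^2"
      using C
    proof eventually_elim
      case (elim \<xi>)
      have c: "continuous_on UNIV (\<lambda>x. G (\<xi>, x))" by (rule smooth1_continuous[OF smooth1_slice(1)[OF smG elim(1)]])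
      have "(\<lambda>x. W x * (G (\<xi>, x) - (u0 x + of_real \<xi> * (\<i> * u1 x)))) =
        (\<lambda>x. W x * G (\<xi>, x) - (W x * u0 x + (of_real \<xi> * \<i>) * (W x * u1 x)))" by (simp add: fun_eq_iff algebra_simps)
      then have "avg (\<lambda>x. W x * (G (\<xi>, x) - (u0 x + of_real \<xi> * (\<i> * u1 x)))) =
        avg (\<lambda>x. W x * G (\<xi>, x)) - (avg (\<lambda>x. W x * u0 x) + (of_real \<xi> * \<i>) * avg (\<lambda>x. W x * u1 x))"
        by (simp only:) (subst avg_diff, (intro continuous_intros cont c W)+, subst avg_add, (intro continuous_intros cont c W)+, simp only: avg_cmult)
      moreover have "norm (avg (\<lambda>x. W x * (G (\<xi>, x) - (u0 x + of_real \<xi> * (\<i> * u1 x))))) \<le> A * (C * \<bar>\<xi>\<bar>^2)"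
        by (rule avg_bound) (use A elim(2) in \<open>auto intro!: continuous_intros cont c W mult_mono simp: norm_mult less_imp_le\<close>)
      ultimately show ?case using W0 by (simp add: mult.assoc)
    qed
    note * = quadratic_remainder_derivative[OF this]
    show ?thesis by (rule vector_derivative_quotient[OF *(2,1)])
  qed
  have qm: "((\<lambda>\<xi>. m \<xi> / of_real \<xi>) \<longlongrightarrow> \<i> * avg (\<lambda>x. of_real (6 * V x - s) * u1 x)) (at 0)"
    unfolding m_def by (rule q[OF cont(3) _ m0]) (use perV in \<open>simp add: periodic1_def\<close>)
  have qa: "((\<lambda>\<xi>. a \<xi> / of_real \<xi>) \<longlongrightarrow> \<i> * b) (at 0)"
    using q[of "\<lambda>x. 1"] a0 a1 by (simp add: a_def periodic1_def)
  have q\<Lambda>: "((\<lambda>\<xi>. \<Lambda> \<xi> / of_real \<xi>) \<longlongrightarrow> \<i> * of_real ks * l0) (at 0)"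
    by (rule vector_derivative_quotient[OF \<Lambda>(2,1)])
  \<comment> \<open>The averaged Bloch equation divided by \<xi>^2. Both averages are of order
    \<xi>, because u0 = \<alpha> V' contributes nothing to them, and \<Lambda> is of order \<xi> as
    well; so second order is the first order with content.\<close>
  define H where "H \<xi> = of_real ks * \<i> * (m \<xi> / of_real \<xi>) + (of_real (ks^3) * \<i>^3 * of_real (\<xi>^2)
     + of_real \<delta> * (of_real (ks^2) * \<i>^2 * of_real \<xi> + of_real (ks^4) * \<i>^4 * of_real (\<xi>^3))) * (a \<xi> / of_real \<xi>) +
     (\<Lambda> \<xi> / of_real \<xi>) * (a \<xi> / of_real \<xi>)" for \<xi>
  have H0: "H \<xi> = 0" if "\<xi> \<in> P" "\<xi> \<noteq> 0" for \<xi>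
  proof -
    have "bloch_op \<delta> ks V s (\<i> * of_real \<xi>) (\<lambda>x. G (\<xi>, x)) = (\<lambda>x. (- \<Lambda> \<xi>) * G (\<xi>, x))"
      using eqG[OF that(1)] by (auto simp: bloch_eq_def)
    from arg_cong[OF this, of avg]
    have "of_real ks * (\<i> * of_real \<xi>) * m \<xi> + (of_real (ks^3) * (\<i> * of_real \<xi>)^3
      + of_real \<delta> * (of_real (ks^2) * (\<i> * of_real \<xi>)^2 + of_real (ks^4) * (\<i> * of_real \<xi>)^4)) * a \<xi> = - \<Lambda> \<xi> * a \<xi>"
      unfolding avg_bloch_op[OF smooth1_slice(1)[OF smG that(1)] perG[OF that(1)] smoothV perV] avg_cmult
      by (simp add: m_def a_def)
    then have "of_real ks * (\<i> * of_real \<xi>) * m \<xi> + (of_real (ks^3) * (\<i> * of_real \<xi>)^3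
      + of_real \<delta> * (of_real (ks^2) * (\<i> * of_real \<xi>)^2 + of_real (ks^4) * (\<i> * of_real \<xi>)^4)) * a \<xi> + \<Lambda> \<xi> * a \<xi> = 0" by simp
    moreover have "of_real \<xi> * of_real \<xi> * H \<xi> = of_real ks * (\<i> * of_real \<xi>) * m \<xi> + (of_real (ks^3) * (\<i> * of_real \<xi>)^3
      + of_real \<delta> * (of_real (ks^2) * (\<i> * of_real \<xi>)^2 + of_real (ks^4) * (\<i> * of_real \<xi>)^4)) * a \<xi> + \<Lambda> \<xi> * a \<xi>"
    proof -
      have x: "complex_of_real \<xi> \<noteq> 0" using that by simp
      define M A L where "M = m \<xi> / of_real \<xi>" and "A = a \<xi> / of_real \<xi>" and "L = \<Lambda> \<xi> / of_real \<xi>"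
      have e: "m \<xi> = of_real \<xi> * M" "a \<xi> = of_real \<xi> * A" "\<Lambda> \<xi> = of_real \<xi> * L" using x by (auto simp: M_def A_def L_def)
      show ?thesis unfolding H_def M_def[symmetric] A_def[symmetric] L_def[symmetric] unfolding e of_real_power by algebra
    qed
    ultimately show ?thesis using that by simp
  qed
  have "(H \<longlongrightarrow> of_real ks * \<i> * (\<i> * avg (\<lambda>x. of_real (6 * V x - s) * u1 x)) + (of_real (ks^3) * \<i>^3 * of_real (0^2)
     + of_real \<delta> * (of_real (ks^2) * \<i>^2 * of_real 0 + of_real (ks^4) * \<i>^4 * of_real (0^3))) * (\<i> * b) +
     (\<i> * of_real ks * l0) * (\<i> * b)) (at 0)"
    unfolding H_def by (intro tendsto_intros qm qa q\<Lambda>)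
  moreover have "(H \<longlongrightarrow> 0) (at 0)"
  proof (rule Lim_transform_eventually[OF tendsto_const])
    have "\<forall>\<^sub>F \<xi> in at 0. \<xi> \<in> P" using P by (simp add: eventually_at_in_open')
    then show "\<forall>\<^sub>F \<xi> in at 0. 0 = H \<xi>" using H0 by (auto simp: eventually_at_filter elim: eventually_mono)
  qed
  ultimately have "of_real ks * \<i> * (\<i> * avg (\<lambda>x. of_real (6 * V x - s) * u1 x)) + (of_real (ks^3) * \<i>^3 * of_real (0^2)
     + of_real \<delta> * (of_real (ks^2) * \<i>^2 * of_real 0 + of_real (ks^4) * \<i>^4 * of_real (0^3))) * (\<i> * b) +
     (\<i> * of_real ks * l0) * (\<i> * b) = 0"
    using tendsto_unique[OF trivial_limit_at] by blast
  then have "of_real ks * (avg (\<lambda>x. of_real (6 * V x - s) * u1 x) + l0 * b) = 0"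
    unfolding m1 by (simp add: algebra_simps)
  then have 2: "of_real qk * (\<alpha> * of_real ks) + (l0 - of_real (c0 ks)) * b = 0"
  proof -
    assume "of_real ks * (avg (\<lambda>x. of_real (6 * V x - s) * u1 x) + l0 * b) = 0"
    then have "\<alpha> * of_real ks * of_real qk - of_real (c0 ks) * b + l0 * b = 0"
      using ks unfolding m1 mult_eq_0_iff by simp
    then show ?thesis by algebra
  qed
  \<comment> \<open>The first modulation equation is the definition of b rearranged: solvability at
    order \<nu> went into finding b.\<close>
  have 1: "l0 * (\<alpha> * of_real ks) + of_real ks * (of_real ck * (\<alpha> * of_real ks) + 6 * b) = 0"
  proof -
    have "6 * b = - \<alpha> * (of_real ks * of_real ck + l0)" by (simp add: b_def)
    then show ?thesis by algebra
  qed
  show ?thesis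
  proof (intro exI[of _ "\<alpha> * of_real ks"] conjI)
    show "\<alpha> * of_real ks \<noteq> 0" using \<alpha>0 ks by simp
    show "\<forall>x. u0 x = \<alpha> * of_real ks / of_real ks * cV' x" using ks by (simp add: \<alpha>)
    show "modulation_eqs U c ks Ms l0 (\<alpha> * of_real ks) (avg u1)" unfolding modulation_iff a1 using 1 2 by simp
  qed
qed

end

section \<open>A parametrized Newton iteration\<close>

text \<open>Newton's iteration for \<open>z\<close>, coupled to \<open>y\<close> only through terms of size \<open>\<tau>\<close>.\<close>

lemma newton_contraction:
  fixes \<Phi> :: "real \<Rightarrow> complex \<Rightarrow> 'e::{real_normed_vector, complete_space} \<Rightarrow> 'e" and r :: "real \<Rightarrow> complex \<Rightarrow> 'e \<Rightarrow> complex"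
  assumes S: "closed S" "0 \<in> S" and z: "z0 \<noteq> z1" and \<rho>: "\<rho> > 0" "\<rho> \<le> 1" and C: "C \<ge> 0"
    and mem: "\<And>\<tau> z y. 0 < \<tau> \<Longrightarrow> \<tau> \<le> 1 \<Longrightarrow> z \<in> cball z0 1 \<Longrightarrow> y \<in> S \<inter> cball 0 1 \<Longrightarrow> \<tau> *\<^sub>R \<Phi> \<tau> z y \<in> S"
    and bound: "\<And>\<tau> z y. 0 < \<tau> \<Longrightarrow> \<tau> \<le> 1 \<Longrightarrow> z \<in> cball z0 1 \<Longrightarrow> y \<in> S \<inter> cball 0 1 \<Longrightarrow>
       norm (\<Phi> \<tau> z y) \<le> C \<and> norm (r \<tau> z y) \<le> C"
    and lip: "\<And>\<tau> z y z' y'. 0 < \<tau> \<Longrightarrow> \<tau> \<le> 1 \<Longrightarrow> z \<in> cball z0 1 \<Longrightarrow> y \<in> S \<inter> cball 0 1 \<Longrightarrow>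
       z' \<in> cball z0 1 \<Longrightarrow> y' \<in> S \<inter> cball 0 1 \<Longrightarrow>
       dist (\<Phi> \<tau> z y) (\<Phi> \<tau> z' y') \<le> C * (dist z z' + dist y y') \<and>
       dist (r \<tau> z y) (r \<tau> z' y') \<le> C * (dist z z' + dist y y')"
  obtains \<tau>0 where "\<tau>0 > 0" "\<And>\<tau>. 0 < \<tau> \<Longrightarrow> \<tau> \<le> \<tau>0 \<Longrightarrow> \<tau> \<le> 1 \<and>
     (\<exists>z\<in>cball z0 \<rho>. \<exists>y\<in>S \<inter> cball 0 1. y = \<tau> *\<^sub>R \<Phi> \<tau> z y \<and> (z - z0) * (z - z1) + of_real \<tau> * r \<tau> z y = 0)"
proof -
  \<comment> \<open>The derivative of (z - z0) (z - z1) at the simple root z0; it stays frozen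
    during the iteration.\<close>
  define D where "D = z0 - z1"
  have D: "norm D > 0" "D \<noteq> 0" using z by (auto simp: D_def)
  \<comment> \<open>Within radius norm D / 8 the quadratic part (z - z0)^2 / D has Lipschitz
    constant at most 1/4.\<close>
  define \<rho>' where "\<rho>' = min \<rho> (norm D / 8)"
  have \<rho>': "\<rho>' > 0" "\<rho>' \<le> \<rho>" "\<rho>' \<le> 1" "\<rho>' \<le> norm D / 8" using \<rho> D by (auto simp: \<rho>'_def)
  define \<kappa> where "\<kappa> = C + C / norm D + 1"
  have \<kappa>: "\<kappa> \<ge> 1" "C \<le> \<kappa>" "C / norm D \<le> \<kappa>" "C + C / norm D \<le> \<kappa>" using C D by (auto simp: \<kappa>_def)
  \<comment> \<open>The bound 1/8 on \<tau> \<kappa> lets the coupled terms add at most another 1/4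
    to the contraction factor; the bound \<rho>' / 2 keeps the z-component in its ball.\<close>
  define \<tau>0 where "\<tau>0 = min (1/8) (\<rho>' / 2) / \<kappa>"
  show thesis
  proof (rule that[of \<tau>0])
    show "\<tau>0 > 0" using \<rho>' \<kappa> by (simp add: \<tau>0_def)
    fix \<tau> assume \<tau>: "0 < \<tau>" "\<tau> \<le> \<tau>0"
    have "\<tau> * \<kappa> \<le> \<tau>0 * \<kappa>" using \<tau> \<kappa> by (intro mult_right_mono) auto
    also have "\<tau>0 * \<kappa> = min (1/8) (\<rho>' / 2)" using \<kappa> by (simp add: \<tau>0_def)
    finally have \<tau>\<kappa>: "\<tau> * \<kappa> \<le> 1/8" "\<tau> * \<kappa> \<le> \<rho>' / 2" by auto
    have t1: "\<tau> \<le> 1" using mult_left_mono[OF \<kappa>(1), of \<tau>] \<tau> \<tau>\<kappa> by linarith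
    have tC: "\<tau> * C \<le> \<tau> * \<kappa>" "\<tau> * (C / norm D) \<le> \<tau> * \<kappa>" "\<tau> * (C + C / norm D) \<le> \<tau> * \<kappa>"
      by (intro mult_left_mono \<kappa>; use \<tau> in simp)+
    let ?Y = "cball z0 \<rho>' \<times> (S \<inter> cball 0 1)"
    define T where "T p = (fst p - ((fst p - z0) * (fst p - z1) + of_real \<tau> * r \<tau> (fst p) (snd p)) / D, \<tau> *\<^sub>R \<Phi> \<tau> (fst p) (snd p))" for p
    have sub: "cball z0 \<rho>' \<subseteq> cball z0 1" using \<rho>' by (intro subset_cball) auto
    have "\<exists>!p. p \<in> ?Y \<and> T p = p"
    proof (rule Banach_fix[of ?Y "1/2" T])
      show "complete ?Y"
        by (intro complete_eq_closed[THEN iffD2] closed_Times closed_Int S closed_cball)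
      show "?Y \<noteq> {}" using \<rho>' S(2) by auto
      show "T ` ?Y \<subseteq> ?Y"
      proof
        fix q assume "q \<in> T ` ?Y"
        then obtain p where p: "p \<in> ?Y" "q = T p" by blast
        then have m: "fst p \<in> cball z0 1" "snd p \<in> S \<inter> cball 0 1" "norm (fst p - z0) \<le> \<rho>'"
          using sub by (auto simp: dist_norm norm_minus_commute)
        note b = bound[OF \<tau>(1) t1 m(1,2)]
        have "fst (T p) - z0 = - ((fst p - z0) * (fst p - z0) / D) - of_real \<tau> * r \<tau> (fst p) (snd p) / D"
          using D(2) unfolding T_def fst_conv by (simp add: field_simps) (simp add: D_def algebra_simps)
        then have "norm (fst (T p) - z0) \<le> norm ((fst p - z0) * (fst p - z0) / D) + norm (of_real \<tau> * r \<tau> (fst p) (snd p) / D)"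
          using norm_triangle_ineq4[of "- ((fst p - z0) * (fst p - z0) / D)" "of_real \<tau> * r \<tau> (fst p) (snd p) / D"] by simp
        also have "\<dots> = norm (fst p - z0) * norm (fst p - z0) / norm D + \<tau> * (norm (r \<tau> (fst p) (snd p)) / norm D)"
          using \<tau> by (simp add: norm_mult norm_divide)
        also have "\<dots> \<le> \<rho>' * (norm D / 8) / norm D + \<tau> * (C / norm D)"
          using m(3) \<rho>' b \<tau> D by (intro add_mono divide_right_mono mult_mono mult_left_mono) auto
        also have "\<rho>' * (norm D / 8) / norm D = \<rho>' / 8" using D by simp
        also have "\<rho>' / 8 + \<tau> * (C / norm D) \<le> \<rho>' / 8 + \<rho>' / 2" using tC(2) \<tau>\<kappa>(2) by linarith
        also have "\<dots> \<le> \<rho>'" using \<rho>' by simp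
        finally have 1: "fst (T p) \<in> cball z0 \<rho>'" by (simp add: dist_norm norm_minus_commute)
        have "norm (snd (T p)) \<le> \<tau> * C" using b \<tau> by (simp add: T_def)
        then have "snd (T p) \<in> S \<inter> cball 0 1" using mem[OF \<tau>(1) t1 m(1,2)] tC \<tau>\<kappa> by (simp add: T_def)
        with 1 show "q \<in> ?Y" using p by (simp add: mem_Times_iff)
      qed
      show "dist (T p) (T q) \<le> 1 / 2 * dist p q" if p: "p \<in> ?Y" and q: "q \<in> ?Y" for p q
      proof -
        have mp: "fst p \<in> cball z0 1" "snd p \<in> S \<inter> cball 0 1" "norm (fst p - z0) \<le> \<rho>'"
          and mq: "fst q \<in> cball z0 1" "snd q \<in> S \<inter> cball 0 1" "norm (fst q - z0) \<le> \<rho>'"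
          using p q sub by (auto simp: dist_norm norm_minus_commute)
        let ?d = "dist p q"
        have dd: "dist (fst p) (fst q) \<le> ?d" "dist (snd p) (snd q) \<le> ?d" by (rule dist_fst_le dist_snd_le)+
        have l: "dist (\<Phi> \<tau> (fst p) (snd p)) (\<Phi> \<tau> (fst q) (snd q)) \<le> C * (2 * ?d)"
          "dist (r \<tau> (fst p) (snd p)) (r \<tau> (fst q) (snd q)) \<le> C * (2 * ?d)"
          using lip[OF \<tau>(1) t1 mp(1,2) mq(1,2)] mult_left_mono[of "dist (fst p) (fst q) + dist (snd p) (snd q)" "2 * ?d" C] dd C by auto
        let ?a = "(fst p - fst q) * ((z0 - fst p) + (z0 - fst q)) / D"
        let ?b = "of_real \<tau> * (r \<tau> (fst p) (snd p) - r \<tau> (fst q) (snd q)) / D"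
        have "fst (T p) - fst (T q) = ?a - ?b"
          using D(2) unfolding T_def fst_conv by (simp add: field_simps) (simp add: D_def algebra_simps)
        then have "dist (fst (T p)) (fst (T q)) \<le> norm ?a + norm ?b"
          using norm_triangle_ineq4[of ?a ?b] by (simp only: dist_norm)
        also have "norm ?a \<le> ?d * (norm D / 4) / norm D"
        proof -
          have "norm ((z0 - fst p) + (z0 - fst q)) \<le> norm D / 4"
            using norm_triangle_ineq[of "z0 - fst p" "z0 - fst q"] mp(3) mq(3) \<rho>'(4) by (simp add: norm_minus_commute)
          then show ?thesis unfolding norm_divide norm_mult
            using dd(1) by (intro divide_right_mono mult_mono) (auto simp: dist_norm)
        qed
        also have "norm ?b \<le> \<tau> * (C * (2 * ?d)) / norm D"
          unfolding norm_divide norm_mult using l(2) \<tau> by (intro divide_right_mono mult_mono) (auto simp: dist_norm)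
        finally have 1: "dist (fst (T p)) (fst (T q)) \<le> ?d / 4 + \<tau> * (C / norm D) * (2 * ?d)"
          using D by simp
        have "dist (snd (T p)) (snd (T q)) = \<tau> * dist (\<Phi> \<tau> (fst p) (snd p)) (\<Phi> \<tau> (fst q) (snd q))"
          using \<tau> by (simp add: T_def dist_norm flip: scaleR_diff_right)
        also have "\<dots> \<le> \<tau> * (C * (2 * ?d))" using l(1) \<tau> by (intro mult_left_mono) auto
        finally have 2: "dist (snd (T p)) (snd (T q)) \<le> \<tau> * C * (2 * ?d)" by simp
        have "dist (T p) (T q) \<le> dist (fst (T p)) (fst (T q)) + dist (snd (T p)) (snd (T q))"
          using sqrt_sum_squares_le_sum_abs[of "dist (fst (T p)) (fst (T q))" "dist (snd (T p)) (snd (T q))"]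
          by (simp add: dist_prod_def)
        also have "\<dots> \<le> ?d / 4 + \<tau> * (C + C / norm D) * (2 * ?d)" using 1 2 by (simp add: algebra_simps)
        also have "\<dots> \<le> ?d / 4 + 1/8 * (2 * ?d)"
          by (intro add_left_mono mult_right_mono order_trans[OF tC(3) \<tau>\<kappa>(1)]) auto
        finally show "dist (T p) (T q) \<le> 1 / 2 * ?d" by simp
      qed
    qed auto
    then obtain p where p: "p \<in> ?Y" "T p = p" by blast
    have "fst (T p) = fst p" "snd (T p) = snd p" using p by auto
    then have "(fst p - z0) * (fst p - z1) + of_real \<tau> * r \<tau> (fst p) (snd p) = 0" "\<tau> *\<^sub>R \<Phi> \<tau> (fst p) (snd p) = snd p"
      using D(2) by (auto simp: T_def)
    then show "\<tau> \<le> 1 \<and>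
     (\<exists>z\<in>cball z0 \<rho>. \<exists>y\<in>S \<inter> cball 0 1. y = \<tau> *\<^sub>R \<Phi> \<tau> z y \<and> (z - z0) * (z - z1) + of_real \<tau> * r \<tau> z y = 0)"
      using t1 p(1) \<rho>'(2) by (intro conjI bexI[of _ "fst p"] bexI[of _ "snd p"]) auto
  qed
qed

section \<open>Families bounded and Lipschitz uniformly in the small parameter\<close>

definition ulip_with :: "real \<Rightarrow> complex \<Rightarrow> 'e::metric_space set \<Rightarrow> (real \<Rightarrow> complex \<Rightarrow> 'e \<Rightarrow> real \<Rightarrow> complex) \<Rightarrow> bool" where
  "ulip_with C z0 Y F \<longleftrightarrow> C \<ge> 0 \<and> (\<forall>\<tau>\<in>{0<..1}. \<forall>z\<in>cball z0 1. \<forall>y\<in>Y. \<forall>x. norm (F \<tau> z y x) \<le> C \<and>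
     (\<forall>z'\<in>cball z0 1. \<forall>y'\<in>Y. norm (F \<tau> z y x - F \<tau> z' y' x) \<le> C * (dist z z' + dist y y')))"

text \<open>Hiding the constant gives a calculus closed under sums, products and averages, so that
  the estimates required by the Newton iteration follow from the shape of the residual. Boundedness
  accompanies the Lipschitz condition because products use both.\<close>

definition ulip :: "complex \<Rightarrow> 'e::metric_space set \<Rightarrow> (real \<Rightarrow> complex \<Rightarrow> 'e \<Rightarrow> real \<Rightarrow> complex) \<Rightarrow> bool" where
  "ulip z0 Y F \<longleftrightarrow> (\<exists>C. ulip_with C z0 Y F)"

lemma ulip_withD:
  assumes "ulip_with C z0 Y F"
  shows "C \<ge> 0" "\<And>\<tau> z y x. 0 < \<tau> \<Longrightarrow> \<tau> \<le> 1 \<Longrightarrow> z \<in> cball z0 1 \<Longrightarrow> y \<in> Y \<Longrightarrow> norm (F \<tau> z y x) \<le> C"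
    "\<And>\<tau> z y z' y' x. 0 < \<tau> \<Longrightarrow> \<tau> \<le> 1 \<Longrightarrow> z \<in> cball z0 1 \<Longrightarrow> y \<in> Y \<Longrightarrow> z' \<in> cball z0 1 \<Longrightarrow> y' \<in> Y \<Longrightarrow>
      norm (F \<tau> z y x - F \<tau> z' y' x) \<le> C * (dist z z' + dist y y')"
  using assms unfolding ulip_with_def by auto

lemma ulipI:
  assumes "C1 \<ge> 0" "C2 \<ge> 0" "\<And>\<tau> z y x. 0 < \<tau> \<Longrightarrow> \<tau> \<le> 1 \<Longrightarrow> z \<in> cball z0 1 \<Longrightarrow> y \<in> Y \<Longrightarrow> norm (F \<tau> z y x) \<le> C1"
    "\<And>\<tau> z y z' y' x. 0 < \<tau> \<Longrightarrow> \<tau> \<le> 1 \<Longrightarrow> z \<in> cball z0 1 \<Longrightarrow> y \<in> Y \<Longrightarrow> z' \<in> cball z0 1 \<Longrightarrow> y' \<in> Y \<Longrightarrow>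
      norm (F \<tau> z y x - F \<tau> z' y' x) \<le> C2 * (dist z z' + dist y y')"
  shows "ulip z0 Y F"
proof -
  have "C2 * (dist z z' + dist y y') \<le> (C1 + C2) * (dist z z' + dist y y')" for z z' :: complex and y y' :: 'a
    using assms(1) by (intro mult_right_mono) auto
  note le = order_trans[OF assms(4) this]
  have "norm (F \<tau> z y x) \<le> C1 + C2" if "0 < \<tau>" "\<tau> \<le> 1" "z \<in> cball z0 1" "y \<in> Y" for \<tau> z y x
    using assms(3)[OF that, of x] assms(2) by simp
  then have "ulip_with (C1 + C2) z0 Y F" unfolding ulip_with_def
    by (intro conjI ballI allI) (use assms(1,2) le in auto)
  then show ?thesis unfolding ulip_def by blast
qed

lemma ulip_base:
  assumes "\<And>\<tau> x. 0 < \<tau> \<Longrightarrow> \<tau> \<le> 1 \<Longrightarrow> norm (g \<tau> x) \<le> C"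
  shows "ulip z0 Y (\<lambda>\<tau> z y x. g \<tau> x)"
proof -
  have "C \<ge> 0" using assms[of 1 0] norm_ge_zero[of "g 1 0"] by linarith
  then show ?thesis using assms by (intro ulipI[of C 0]) auto
qed

lemma ulip_const: "ulip z0 Y (\<lambda>\<tau> z y x. a)"
  by (rule ulip_base[of "\<lambda>\<tau> x. a" "norm a"]) simp

lemma ulip_tau: "ulip z0 Y (\<lambda>\<tau> z y x. of_real \<tau>)"
  by (rule ulip_base[of "\<lambda>\<tau> x. of_real \<tau>" 1]) simp

lemma ulip_z: "ulip z0 Y (\<lambda>\<tau> z y x. z)"
proof (rule ulipI[of "norm z0 + 1" 1])
  show "norm z \<le> norm z0 + 1" if "z \<in> cball z0 1" for z
    using norm_triangle_sub[of z z0] that by (simp add: dist_norm norm_minus_commute)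
qed (auto simp: dist_norm)

lemma ulip_add:
  assumes "ulip z0 Y F" "ulip z0 Y G" shows "ulip z0 Y (\<lambda>\<tau> z y x. F \<tau> z y x + G \<tau> z y x)"
proof -
  obtain C where "ulip_with C z0 Y F" using assms(1) unfolding ulip_def by blast
  note C = ulip_withD[OF this]
  obtain D where "ulip_with D z0 Y G" using assms(2) unfolding ulip_def by blast
  note D = ulip_withD[OF this]
  show ?thesis
  proof (rule ulipI[of "C + D" "C + D"])
    fix \<tau> :: real and z y z' y' and x :: real assume *: "0 < \<tau>" "\<tau> \<le> 1" "z \<in> cball z0 1" "y \<in> Y" "z' \<in> cball z0 1" "y' \<in> Y"
    have e: "F \<tau> z y x + G \<tau> z y x - (F \<tau> z' y' x + G \<tau> z' y' x) = (F \<tau> z y x - F \<tau> z' y' x) + (G \<tau> z y x - G \<tau> z' y' x)" by simp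
    show "norm (F \<tau> z y x + G \<tau> z y x - (F \<tau> z' y' x + G \<tau> z' y' x)) \<le> (C + D) * (dist z z' + dist y y')"
      unfolding e distrib_right by (rule norm_triangle_mono[OF C(3)[OF *, of x] D(3)[OF *, of x]])
  next
    fix \<tau> :: real and z y and x :: real assume *: "0 < \<tau>" "\<tau> \<le> 1" "z \<in> cball z0 1" "y \<in> Y"
    show "norm (F \<tau> z y x + G \<tau> z y x) \<le> C + D" by (rule norm_triangle_mono[OF C(2)[OF *] D(2)[OF *]])
  qed (use C(1) D(1) in auto)
qed

lemma ulip_mult:
  assumes "ulip z0 Y F" "ulip z0 Y G" shows "ulip z0 Y (\<lambda>\<tau> z y x. F \<tau> z y x * G \<tau> z y x)"
proof -
  obtain C where "ulip_with C z0 Y F" using assms(1) unfolding ulip_def by blast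
  note C = ulip_withD[OF this]
  obtain D where "ulip_with D z0 Y G" using assms(2) unfolding ulip_def by blast
  note D = ulip_withD[OF this]
  show ?thesis
  proof (rule ulipI[of "C * D" "2 * (C * D)"])
    fix \<tau> :: real and z y z' y' and x :: real assume *: "0 < \<tau>" "\<tau> \<le> 1" "z \<in> cball z0 1" "y \<in> Y" "z' \<in> cball z0 1" "y' \<in> Y"
    let ?d = "dist z z' + dist y y'"
    have "F \<tau> z y x * G \<tau> z y x - F \<tau> z' y' x * G \<tau> z' y' x =
      (F \<tau> z y x - F \<tau> z' y' x) * G \<tau> z y x + F \<tau> z' y' x * (G \<tau> z y x - G \<tau> z' y' x)" by (simp add: algebra_simps)
    also have "norm \<dots> \<le> (C * ?d) * D + C * (D * ?d)"
      using C(1) by (intro norm_triangle_mono) (auto simp: norm_mult intro!: mult_mono C D * )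
    finally show "norm (F \<tau> z y x * G \<tau> z y x - F \<tau> z' y' x * G \<tau> z' y' x) \<le> 2 * (C * D) * ?d" by (simp add: mult_ac)
  next
    fix \<tau> :: real and z y and x :: real assume *: "0 < \<tau>" "\<tau> \<le> 1" "z \<in> cball z0 1" "y \<in> Y"
    show "norm (F \<tau> z y x * G \<tau> z y x) \<le> C * D" unfolding norm_mult by (intro mult_mono C(2) D(2) * C(1)) auto
  qed (use C(1) D(1) in auto)
qed

lemma ulip_minus: "ulip z0 Y F \<Longrightarrow> ulip z0 Y (\<lambda>\<tau> z y x. - F \<tau> z y x)"
  using ulip_mult[OF ulip_const[of z0 Y "-1"], of F] by simp

lemma ulip_diff: "ulip z0 Y F \<Longrightarrow> ulip z0 Y G \<Longrightarrow> ulip z0 Y (\<lambda>\<tau> z y x. F \<tau> z y x - G \<tau> z y x)"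
  using ulip_add[OF _ ulip_minus, of z0 Y F G] by simp

lemma ulip_power: "ulip z0 Y F \<Longrightarrow> ulip z0 Y (\<lambda>\<tau> z y x. F \<tau> z y x ^ n)"
  by (induction n) (auto intro: ulip_const ulip_mult)

section \<open>Bloch eigenfunctions near the origin\<close>

text \<open>The eigenvalue equation at a point x with the function values replaced by independent
  letters: W = 6 V - s, p for V', a for w, v for the corrector, n = \<nu>, t = \<tau>. The
  hypotheses are L V' = 0, the equation for ks w, L v = h, the choice of the constant b and the
  equation fixing h; the conclusion is a linear combination of them.\<close>

lemma ansatz_identity:
  fixes k d W p p1 p2 p3 p4 a a1 a2 a3 a4 v v1 v2 v3 v4 h ck z n t b :: complex
  assumes "k * (W * p1 + 6 * p * p) + k^3 * p3 + d * (k^2 * p2 + k^4 * p4) = 0" (is "?A = 0")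
    and "k * (k * (W * a1 + 6 * p * a) + k^3 * a3 + d * (k^2 * a2 + k^4 * a4)) =
      - (k * W * p + 3 * k^3 * p2 + d * (2 * k^2 * p1 + 4 * k^4 * p3)) + k^2 * ck * p" (is "?B = ?B'")
    and "k * (W * v1 + 6 * p * v) + k^3 * v3 + d * (k^2 * v2 + k^4 * v4) = h" (is "?C = h")
    and "6 * b = - (k * ck + z)"
    and "t * h = - n * (k * W * (b + k * a + t * v)
      + k^3 * (3 * (k * a2 + t * v2) + 3 * n * (k * a1 + t * v1) + n^2 * (b + k * a + t * v))
      + d * (k^2 * (2 * (k * a1 + t * v1) + n * (b + k * a + t * v))
        + k^4 * (4 * (k * a3 + t * v3) + 6 * n * (k * a2 + t * v2)
          + 4 * n^2 * (k * a1 + t * v1) + n^3 * (b + k * a + t * v)))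
      + k * z * (b + k * a + t * v)
      + (3 * k^3 * p1 + d * (k^2 * p + 6 * k^4 * p2)
        + n * (k^3 * p + 4 * d * k^4 * p1) + n^2 * (d * k^4) * p))" (is "_ = ?D")
  shows "k * (W * (p1 + n * (0 + k * a1 + t * v1)) + 6 * p * (p + n * (b + k * a + t * v)) + n * W * (p + n * (b + k * a + t * v)))
    + k^3 * ((p3 + n * (0 + k * a3 + t * v3)) + 3 * n * (p2 + n * (0 + k * a2 + t * v2)) + 3 * n^2 * (p1 + n * (0 + k * a1 + t * v1)) + n^3 * (p + n * (b + k * a + t * v)))
    + d * (k^2 * ((p2 + n * (0 + k * a2 + t * v2)) + 2 * n * (p1 + n * (0 + k * a1 + t * v1)) + n^2 * (p + n * (b + k * a + t * v)))
      + k^4 * ((p4 + n * (0 + k * a4 + t * v4)) + 4 * n * (p3 + n * (0 + k * a3 + t * v3)) + 6 * n^2 * (p2 + n * (0 + k * a2 + t * v2))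
        + 4 * n^3 * (p1 + n * (0 + k * a1 + t * v1)) + n^4 * (p + n * (b + k * a + t * v))))
    = - (n * k * z) * (p + n * (b + k * a + t * v))" (is "?L = ?R")
proof -
  have "?L - ?R = ?A + n * (?B - ?B') + n * t * (?C - h) + n * (t * h - ?D) + n * k * p * (6 * b - - (k * ck + z))"
    by algebra
  moreover have "?A = 0" by (rule assms)
  moreover have "?B - ?B' = 0" by (simp only: assms(2) diff_self)
  moreover have "?C - h = 0" by (simp only: assms(3) diff_self)
  moreover have "t * h - ?D = 0" by (simp only: assms(5) diff_self)
  moreover have "6 * b - - (k * ck + z) = 0" by (simp only: assms(4) diff_self)
  ultimately have "?L - ?R = 0" by (simp only: mult_zero_right add_0_left)
  then show ?thesis by (simp only: right_minus_eq)
qed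

lemma ulip_avg:
  assumes F: "ulip z0 Y F"
    and c: "\<And>\<tau> z y. 0 < \<tau> \<Longrightarrow> \<tau> \<le> 1 \<Longrightarrow> z \<in> cball z0 1 \<Longrightarrow> y \<in> Y \<Longrightarrow> continuous_on UNIV (F \<tau> z y)"
  shows "ulip z0 Y (\<lambda>\<tau> z y x. avg (F \<tau> z y))"
proof -
  obtain C where "ulip_with C z0 Y F" using F unfolding ulip_def by blast
  note C = ulip_withD[OF this]
  show ?thesis
  proof (rule ulipI[OF C(1) C(1)])
    fix \<tau> :: real and z y assume *: "0 < \<tau>" "\<tau> \<le> 1" "z \<in> cball z0 1" "y \<in> Y"
    show "norm (avg (F \<tau> z y)) \<le> C" by (rule avg_bound[OF c[OF *] C(2)[OF *]])
    fix z' y' assume **: "z' \<in> cball z0 1" "y' \<in> Y"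
    have "avg (F \<tau> z y) - avg (F \<tau> z' y') = avg (\<lambda>x. F \<tau> z y x - F \<tau> z' y' x)"
      by (rule avg_diff[symmetric]) (intro c * **)+
    also have "norm \<dots> \<le> C * (dist z z' + dist y y')"
      by (rule avg_bound) (intro continuous_intros c C(3) * **)+
    finally show "norm (avg (F \<tau> z y) - avg (F \<tau> z' y')) \<le> C * (dist z z' + dist y y')" .
  qed
qed

section \<open>The residual of the ansatz at order \<nu>^2\<close>

context wave_family
begin

text \<open>The constant component forced at order \<nu>, where 6 ks b0 = - ks (ks ck + z): the mean
  of the first corrector of a curve with u0 = V' and l0 = z.\<close>

abbreviation "b0 z \<equiv> - (of_real (ks * ck) + z) / 6"

text \<open>The Bloch operator minus L, divided by \<nu>, acting on g. The derivatives of g are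
  passed as separate values, each of which is estimated on its own; only three of them
  occur.\<close>

definition bloch_increment :: "complex \<Rightarrow> real \<Rightarrow> complex \<Rightarrow> complex \<Rightarrow> complex \<Rightarrow> complex \<Rightarrow> complex" where
  "bloch_increment \<nu> x g g1 g2 g3 = of_real (ks * (6 * V x - s)) * g + of_real (ks^3) * (3 * g2 + 3 * \<nu> * g1 + \<nu>^2 * g)
     + of_real \<delta> * (of_real (ks^2) * (2 * g1 + \<nu> * g) + of_real (ks^4) * (4 * g3 + 6 * \<nu> * g2 + 4 * \<nu>^2 * g1 + \<nu>^3 * g))"

text \<open>The terms of order at least two in \<nu> of the Bloch operator applied to V', divided by
  \<nu>^2.\<close>

definition kernel_correction :: "complex \<Rightarrow> real \<Rightarrow> complex" where
  "kernel_correction \<nu> x = of_real (3 * ks^3) * of_real (Dx (Dx V) x) + of_real \<delta> * (of_real (ks^2) * cV' x + of_real (6 * ks^4) * of_real (Dx (Dx (Dx V)) x))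
     + \<nu> * (of_real (ks^3) * cV' x + of_real (4 * \<delta> * ks^4) * of_real (Dx (Dx V) x)) + \<nu>^2 * of_real (\<delta> * ks^4) * cV' x"

text \<open>The factor by which \<open>bloch_increment\<close>, apart from its term with 6 V - s,
  multiplies constants.\<close>

definition mean_symbol :: "complex \<Rightarrow> complex" where
  "mean_symbol \<nu> = of_real (ks^3) * \<nu>^2 + of_real \<delta> * (of_real (ks^2) * \<nu> + of_real (ks^4) * \<nu>^3)"

text \<open>Insert V' + \<nu> g with g = b0 z + ks w + \<tau> v and \<lambda> = \<nu> ks z into the
  Bloch equation: order 0 cancels, order \<nu> reduces to \<tau> L v, and the remaining factor of
  \<nu>^2 is this residual.\<close>

definition bloch_residual :: "complex \<Rightarrow> complex \<Rightarrow> real \<Rightarrow> (real \<Rightarrow> complex) \<Rightarrow> real \<Rightarrow> complex" where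
  "bloch_residual \<nu> z \<tau> v x = bloch_increment \<nu> x (b0 z + of_real ks * cw x + of_real \<tau> * v x) (of_real (ks * Dx w x) + of_real \<tau> * Dx v x)
       (of_real (ks * Dx (Dx w) x) + of_real \<tau> * Dx (Dx v) x) (of_real (ks * Dx (Dx (Dx w)) x) + of_real \<tau> * Dx (Dx (Dx v)) x)
     + of_real ks * z * (b0 z + of_real ks * cw x + of_real \<tau> * v x) + kernel_correction \<nu> x"

text \<open>The left-hand side is, up to the factor ks, the mean of the residual at leading order;
  here the dispersion polynomial reappears as the solvability condition for the corrector.\<close>

lemma dispersion_b0:
  "of_real ks * of_real qk + (z - of_real (c0 ks)) * b0 z = - dispersion_poly c0 U0 ks z / 6"
  unfolding dispersion_poly_def ck_def[symmetric] qk_def[symmetric]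
  by (simp add: field_simps power2_eq_square)

lemma wave_continuous:
  "continuous_on UNIV V" "continuous_on UNIV (Dx V)" "continuous_on UNIV (Dx (Dx V))" "continuous_on UNIV (Dx (Dx (Dx V)))"
  "continuous_on UNIV w" "continuous_on UNIV (Dx w)" "continuous_on UNIV (Dx (Dx w))" "continuous_on UNIV (Dx (Dx (Dx w)))"
  by (intro smooth1_continuous smooth1_Dx smoothV smooth_w)+

lemma sol_continuous:
  assumes "is_sol h v"
  shows "continuous_on UNIV v" "continuous_on UNIV (Dx v)" "continuous_on UNIV (Dx (Dx v))" "continuous_on UNIV (Dx (Dx (Dx v)))"
  using assms unfolding is_sol_def
  by (auto intro!: continuous_at_imp_continuous_on has_vector_derivative_continuous)

lemma sol_periodic:
  assumes "is_sol h v"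
  shows "periodic1 v" "periodic1 (Dx v)" "periodic1 (Dx (Dx v))" "periodic1 (Dx (Dx (Dx v)))"
proof -
  show 0: "periodic1 v" using assms by (simp add: is_sol_def)
  show 1: "periodic1 (Dx v)" by (rule periodic1_derivative[OF _ 0]) (use assms in \<open>auto simp: is_sol_def\<close>)
  show 2: "periodic1 (Dx (Dx v))" by (rule periodic1_derivative[OF _ 1]) (use assms in \<open>auto simp: is_sol_def\<close>)
  show "periodic1 (Dx (Dx (Dx v)))" by (rule periodic1_derivative[OF _ 2]) (use assms in \<open>auto simp: is_sol_def\<close>)
qed

lemma bloch_residual_continuous: assumes "is_sol h v" shows "continuous_on UNIV (bloch_residual \<nu> z \<tau> v)"
  unfolding bloch_residual_def[abs_def] bloch_increment_def kernel_correction_def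
  by (intro continuous_intros sol_continuous[OF assms] wave_continuous)

lemma bloch_residual_periodic: assumes "is_sol h v" shows "periodic1 (bloch_residual \<nu> z \<tau> v)"
proof -
  have "periodic1 (Dx V)" "periodic1 (Dx (Dx V))" "periodic1 (Dx (Dx (Dx V)))" "periodic1 (Dx w)" "periodic1 (Dx (Dx w))" "periodic1 (Dx (Dx (Dx w)))"
    by (intro periodic1_Dx smooth1_Dx smoothV smooth_w perV per_w)+
  then show ?thesis using sol_periodic[OF assms] perV per_w
    by (simp add: periodic1_def bloch_residual_def bloch_increment_def kernel_correction_def)
qed

text \<open>Exact derivatives, w and V' all have mean zero, so up to a constant factor the mean is
  the dispersion polynomial plus terms carrying \<tau> or \<open>mean_symbol \<nu>\<close>.\<close>

lemma avg_bloch_residual: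
  assumes sol: "is_sol h v"
  shows "avg (bloch_residual \<nu> z \<tau> v) = of_real ks * (- dispersion_poly c0 U0 ks z / 6)
     + of_real \<tau> * (of_real ks * avg (\<lambda>x. of_real (6 * V x - s) * v x) + (of_real ks * z + mean_symbol \<nu>) * avg v) + mean_symbol \<nu> * b0 z"
proof -
  note cv = sol_continuous[OF sol] note pv = sol_periodic[OF sol]
  have d: "(v has_vector_derivative Dx v x) (at x)" "(Dx v has_vector_derivative Dx (Dx v) x) (at x)"
    "(Dx (Dx v) has_vector_derivative Dx (Dx (Dx v)) x) (at x)" for x using sol by (auto simp: is_sol_def)
  have z: "avg (Dx v) = 0" "avg (Dx (Dx v)) = 0" "avg (Dx (Dx (Dx v))) = 0"
    using avg_integral_Dx[OF d(1) pv(1)] avg_integral_Dx[OF d(2) pv(2)] avg_integral_Dx[OF d(3) pv(3)] by auto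
  have zr: "avg (\<lambda>x. complex_of_real (Dx f x)) = 0" if "smooth1 f" "periodic1 f" for f
    using avg_integral_Dx[of f "Dx f"] smooth1_D[OF that(1)] that(2)
    by (simp add: avg_of_real smooth1_continuous smooth1_Dx that)
  have pw: "periodic1 (Dx V)" "periodic1 (Dx (Dx V))" "periodic1 (Dx w)" "periodic1 (Dx (Dx w))"
    by (intro periodic1_Dx smooth1_Dx smoothV smooth_w perV per_w)+
  note zz = zr[OF smooth_w per_w] zr[OF smooth1_Dx[OF smooth_w] pw(3)] zr[OF smooth1_Dx[OF smooth1_Dx[OF smooth_w]] pw(4)]
    zr[OF smoothV perV] zr[OF smooth1_Dx[OF smoothV] pw(1)] zr[OF smooth1_Dx[OF smooth1_Dx[OF smoothV]] pw(2)]
  define W where "W x = complex_of_real (6 * V x - s)" for x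
  define A where "A f \<longleftrightarrow> continuous_on UNIV f" for f :: "real \<Rightarrow> complex"
  have add: "avg (\<lambda>x. f x + g x) = avg f + avg g" "A (\<lambda>x. f x + g x)" if "A f" "A g" for f g
    using that by (auto simp: A_def avg_add intro: continuous_intros)
  have mul: "avg (\<lambda>x. a * f x) = a * avg f" "A (\<lambda>x. a * f x)" if "A f" for a f
    using that by (auto simp: A_def avg_cmult intro: continuous_intros)
  have AV: "A v" "A (Dx v)" "A (Dx (Dx v))" "A (Dx (Dx (Dx v)))" using cv by (auto simp: A_def)
  have AW: "A (\<lambda>x. W x * v x)" "A (\<lambda>x. W x * b0 z)" "A (\<lambda>x. W x * cw x)"
    unfolding A_def W_def by (intro continuous_intros cv wave_continuous)+
  have Aw: "A cw" "A (\<lambda>x. of_real (Dx w x))" "A (\<lambda>x. of_real (Dx (Dx w) x))" "A (\<lambda>x. of_real (Dx (Dx (Dx w)) x))"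
    "A cV'" "A (\<lambda>x. of_real (Dx (Dx V) x))" "A (\<lambda>x. of_real (Dx (Dx (Dx V)) x))" "A (\<lambda>x. a)" for a
    unfolding A_def by (intro continuous_intros wave_continuous)+
  let ?k = "complex_of_real ks" let ?\<delta> = "complex_of_real \<delta>" let ?t = "complex_of_real \<tau>"
  \<comment> \<open>Sorted by the function being averaged; only the terms with the weight W, the
    constant term and the term in v itself can contribute.\<close>
  have "bloch_residual \<nu> z \<tau> v = (\<lambda>x. ?k * (W x * b0 z) + (?k * ?k * (W x * cw x) + (?k * ?t * (W x * v x) +
     ((?k * z + mean_symbol \<nu>) * b0 z + ((?k * z + mean_symbol \<nu>) * ?k * cw x + ((?k * z + mean_symbol \<nu>) * ?t * v x +
     ((3 * ?k^3 * \<nu> + ?\<delta> * (2 * ?k^2 + 4 * ?k^4 * \<nu>^2)) * ?k * of_real (Dx w x) +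
     ((3 * ?k^3 * \<nu> + ?\<delta> * (2 * ?k^2 + 4 * ?k^4 * \<nu>^2)) * ?t * Dx v x +
     ((3 * ?k^3 + ?\<delta> * 6 * ?k^4 * \<nu>) * ?k * of_real (Dx (Dx w) x) +
     ((3 * ?k^3 + ?\<delta> * 6 * ?k^4 * \<nu>) * ?t * Dx (Dx v) x +
     (?\<delta> * 4 * ?k^4 * ?k * of_real (Dx (Dx (Dx w)) x) +
     (?\<delta> * 4 * ?k^4 * ?t * Dx (Dx (Dx v)) x +
     ((3 * ?k^3 + \<nu> * 4 * ?\<delta> * ?k^4) * of_real (Dx (Dx V) x) +
     ((?\<delta> * ?k^2 + \<nu> * ?k^3 + \<nu>^2 * ?\<delta> * ?k^4) * cV' x +
       ?\<delta> * 6 * ?k^4 * of_real (Dx (Dx (Dx V)) x)))))))))))))))"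
    unfolding bloch_residual_def[abs_def] bloch_increment_def kernel_correction_def mean_symbol_def W_def
    by (rule ext) (simp only: of_real_mult of_real_numeral of_real_power, algebra)
  then have "avg (bloch_residual \<nu> z \<tau> v) = ?k * avg (\<lambda>x. W x * b0 z) + (?k * ?k * avg (\<lambda>x. W x * cw x) + (?k * ?t * avg (\<lambda>x. W x * v x) +
     ((?k * z + mean_symbol \<nu>) * b0 z + (?k * z + mean_symbol \<nu>) * ?t * avg v)))"
    by (simp only: add mul AV AW Aw z zz avg_cw avg_const mult_zero_right add_0_left add_0_right)
  also have "avg (\<lambda>x. W x * b0 z) = - of_real (c0 ks) * b0 z" unfolding W_def by (rule avg_weight_const)
  also have "avg (\<lambda>x. W x * cw x) = of_real qk" unfolding W_def by (rule avg_weight_cw)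
  also have "?k * (- of_real (c0 ks) * b0 z) + (?k * ?k * of_real qk + (?k * ?t * avg (\<lambda>x. W x * v x) +
     ((?k * z + mean_symbol \<nu>) * b0 z + (?k * z + mean_symbol \<nu>) * ?t * avg v))) =
     ?k * (?k * of_real qk + (z - of_real (c0 ks)) * b0 z) + ?t * (?k * avg (\<lambda>x. W x * v x) + (?k * z + mean_symbol \<nu>) * avg v) + mean_symbol \<nu> * b0 z"
    by algebra
  finally show ?thesis unfolding dispersion_b0 W_def .
qed

text \<open>With \<open>v\<close> solving \<open>L v = h\<close> and \<open>\<tau> h = - \<nu> bloch_residual\<close>, the ansatz
  \<open>V' + \<nu> (b0 z + ks w + \<tau> v)\<close> is an exact Bloch eigenfunction for \<open>\<lambda> = \<nu> ks z\<close>.\<close>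

lemma bloch_ansatz:
  fixes \<nu> z :: complex and \<tau> :: real
  assumes sol: "is_sol h v" and h: "\<And>x. of_real \<tau> * h x = - \<nu> * bloch_residual \<nu> z \<tau> v x"
  defines "f \<equiv> \<lambda>x. cV' x + \<nu> * (b0 z + of_real ks * cw x + of_real \<tau> * v x)"
  shows "per_smooth f" "bloch_eq \<delta> ks V s \<nu> (\<nu> * of_real ks * z) f"
proof -
  let ?k = "complex_of_real ks" let ?\<delta> = "complex_of_real \<delta>" let ?t = "complex_of_real \<tau>"
  define f1 where "f1 x = of_real (Dx (Dx V) x) + \<nu> * (0 + ?k * of_real (Dx w x) + ?t * Dx v x)" for x
  define f2 where "f2 x = of_real (Dx (Dx (Dx V)) x) + \<nu> * (0 + ?k * of_real (Dx (Dx w) x) + ?t * Dx (Dx v) x)" for x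
  define f3 where "f3 x = of_real (Dx (Dx (Dx (Dx V))) x) + \<nu> * (0 + ?k * of_real (Dx (Dx (Dx w)) x) + ?t * Dx (Dx (Dx v)) x)" for x
  \<comment> \<open>The top derivative uses \<open>fourth h v\<close>: of the corrector four
    derivatives are available, not smoothness.\<close>
  define f4 where "f4 x = of_real (Dx (Dx (Dx (Dx (Dx V)))) x) + \<nu> * (0 + ?k * of_real (Dx (Dx (Dx (Dx w))) x) + ?t * fourth h v x)" for x
  have dv: "(v has_vector_derivative Dx v x) (at x)" "(Dx v has_vector_derivative Dx (Dx v) x) (at x)"
    "(Dx (Dx v) has_vector_derivative Dx (Dx (Dx v)) x) (at x)" "(Dx (Dx (Dx v)) has_vector_derivative fourth h v x) (at x)" for x
    using sol by (auto simp: is_sol_def)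
  have dr: "((\<lambda>x. complex_of_real (g x)) has_vector_derivative of_real (Dx g x)) (at x)" if "smooth1 g" for g x
    by (rule bounded_linear.has_vector_derivative[OF bounded_linear_of_real smooth1_D[OF that]])
  note I = has_vector_derivative_add has_vector_derivative_mult_right has_vector_derivative_const dr dv smoothV smooth_w smooth1_Dx
  have D: "(f has_vector_derivative f1 x) (at x)" "(f1 has_vector_derivative f2 x) (at x)"
    "(f2 has_vector_derivative f3 x) (at x)" "(f3 has_vector_derivative f4 x) (at x)" for x
    unfolding f_def f1_def[abs_def] f2_def[abs_def] f3_def[abs_def] f4_def by (intro I)+
  have d4: "?\<delta> * ?k^4 \<noteq> 0" using \<delta> ks by simp
  have BL: "?k * (of_real (6 * V x - s) * f1 x + of_real (6 * Dx V x) * f x + \<nu> * of_real (6 * V x - s) * f x)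
    + ?k^3 * (f3 x + 3 * \<nu> * f2 x + 3 * \<nu>^2 * f1 x + \<nu>^3 * f x)
    + ?\<delta> * (?k^2 * (f2 x + 2 * \<nu> * f1 x + \<nu>^2 * f x)
      + ?k^4 * (f4 x + 4 * \<nu> * f3 x + 6 * \<nu>^2 * f2 x + 4 * \<nu>^3 * f1 x + \<nu>^4 * f x)) = - (\<nu> * ?k * z) * f x" for x
  proof -
    define W where "W = complex_of_real (6 * V x - s)"
    have lV: "?k * (W * of_real (Dx (Dx V) x) + of_real (6 * Dx V x) * cV' x) + ?k^3 * of_real (Dx (Dx (Dx (Dx V))) x)
      + ?\<delta> * (?k^2 * of_real (Dx (Dx (Dx V)) x) + ?k^4 * of_real (Dx (Dx (Dx (Dx (Dx V)))) x)) = 0"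
      using lin_op_cV'[of x] unfolding lin_op_expand[OF smooth_cV' smoothV] W_def
      by (simp add: Dx_of_real smoothV smooth1_Dx)
    have lw: "?k * (?k * (W * of_real (Dx w x) + of_real (6 * Dx V x) * cw x) + ?k^3 * of_real (Dx (Dx (Dx w)) x)
      + ?\<delta> * (?k^2 * of_real (Dx (Dx w) x) + ?k^4 * of_real (Dx (Dx (Dx (Dx w))) x)))
      = - (?k * W * cV' x + 3 * ?k^3 * of_real (Dx (Dx (Dx V)) x)
        + ?\<delta> * (2 * ?k^2 * of_real (Dx (Dx V) x) + 4 * ?k^4 * of_real (Dx (Dx (Dx (Dx V))) x))) + ?k^2 * of_real ck * cV' x"
      using lin_op_cw[of x] unfolding lin_op_expand[OF smooth_cw smoothV] W_def L1_def Dx_cV' Dx_cw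
      by (simp add: algebra_simps)
    have lv: "?k * (W * Dx v x + of_real (6 * Dx V x) * v x) + ?k^3 * Dx (Dx (Dx v)) x
      + ?\<delta> * (?k^2 * Dx (Dx v) x + ?k^4 * fourth h v x) = h x"
      using d4 unfolding fourth_def W_def by (simp add: field_simps)
    define bz where "bz = b0 z"
    have b: "6 * bz = - (?k * of_real ck + z)" unfolding bz_def by simp
    have hx: "?t * h x = - \<nu> * (?k * W * (bz + ?k * cw x + ?t * v x)
      + ?k^3 * (3 * (?k * of_real (Dx (Dx w) x) + ?t * Dx (Dx v) x) + 3 * \<nu> * (?k * of_real (Dx w x) + ?t * Dx v x) + \<nu>^2 * (bz + ?k * cw x + ?t * v x))
      + ?\<delta> * (?k^2 * (2 * (?k * of_real (Dx w x) + ?t * Dx v x) + \<nu> * (bz + ?k * cw x + ?t * v x))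
        + ?k^4 * (4 * (?k * of_real (Dx (Dx (Dx w)) x) + ?t * Dx (Dx (Dx v)) x) + 6 * \<nu> * (?k * of_real (Dx (Dx w) x) + ?t * Dx (Dx v) x)
          + 4 * \<nu>^2 * (?k * of_real (Dx w x) + ?t * Dx v x) + \<nu>^3 * (bz + ?k * cw x + ?t * v x)))
      + ?k * z * (bz + ?k * cw x + ?t * v x)
      + (3 * ?k^3 * of_real (Dx (Dx V) x) + ?\<delta> * (?k^2 * cV' x + 6 * ?k^4 * of_real (Dx (Dx (Dx V)) x))
        + \<nu> * (?k^3 * cV' x + 4 * ?\<delta> * ?k^4 * of_real (Dx (Dx V) x)) + \<nu>^2 * (?\<delta> * ?k^4) * cV' x))"
      using h[of x] unfolding bloch_residual_def bloch_increment_def kernel_correction_def W_def bz_def by simp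
    show ?thesis
      unfolding f_def f1_def f2_def f3_def f4_def unfolding W_def[symmetric] bz_def[symmetric]
      unfolding of_real_mult of_real_numeral
      by (rule ansatz_identity[OF lV[unfolded of_real_mult of_real_numeral] lw[unfolded of_real_mult of_real_numeral]
          lv[unfolded of_real_mult of_real_numeral] b hx])
  qed
  \<comment> \<open>Solved for the fourth derivative, the pointwise eigenvalue equation has smooth
    coefficients and no forcing left, so the eigenfunction bootstraps to smoothness although the
    corrector was only known to have four derivatives.\<close>
  have f4: "f4 x = - (of_real (6 * ks * Dx V x) + \<nu> * of_real (ks * (6 * V x - s)) + ?k^3 * \<nu>^3 + ?\<delta> * (?k^2 * \<nu>^2 + ?k^4 * \<nu>^4) + \<nu> * ?k * z) / (?\<delta> * ?k^4) * f x
     + - (of_real (ks * (6 * V x - s)) + 3 * ?k^3 * \<nu>^2 + ?\<delta> * (2 * ?k^2 * \<nu> + 4 * ?k^4 * \<nu>^3)) / (?\<delta> * ?k^4) * f1 x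
     + - (3 * ?k^3 * \<nu> + ?\<delta> * (?k^2 + 6 * ?k^4 * \<nu>^2)) / (?\<delta> * ?k^4) * f2 x
     + - (?k^3 + 4 * ?\<delta> * ?k^4 * \<nu>) / (?\<delta> * ?k^4) * f3 x" (is "_ = ?a / _ * _ + ?b / _ * _ + ?c / _ * _ + ?d / _ * _") for x
  proof -
    have "?\<delta> * ?k^4 * f4 x = ?a * f x + ?b * f1 x + ?c * f2 x + ?d * f3 x"
      using BL[of x] unfolding of_real_mult of_real_numeral by algebra
    then have "f4 x = (?a * f x + ?b * f1 x + ?c * f2 x + ?d * f3 x) / (?\<delta> * ?k^4)" using d4 by (simp add: eq_divide_eq mult.commute)
    then show ?thesis by (simp add: add_divide_distrib)
  qed
  have sm: "smooth1 f"
    by (rule ode4_bootstrap[OF D(1-3) D(4)[unfolded f4]])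
      (unfold divide_inverse, (intro smooth1_intros smooth1_cof smoothV)+)
  have "periodic1 f" using sol_periodic(1)[OF sol] per_w periodic1_Dx[OF perV smoothV] by (simp add: f_def periodic1_def)
  then show "per_smooth f" using sm by (simp add: per_smoothI)
  have "Dx f = f1" by (rule Dx_ext) (rule D)
  moreover have "Dx f1 = f2" by (rule Dx_ext) (rule D)
  moreover have "Dx f2 = f3" by (rule Dx_ext) (rule D)
  moreover have "Dx f3 = f4" by (rule Dx_ext) (rule D)
  ultimately show "bloch_eq \<delta> ks V s \<nu> (\<nu> * of_real ks * z) f"
    unfolding bloch_eq_def bloch_op_expand[OF sm smoothV] using BL by simp
qed

end

section \<open>Instability from non-real characteristics\<close>

lemma continuous_on_eval_bcontfun: "continuous_on A (\<lambda>y :: real \<Rightarrow>\<^sub>C complex. apply_bcontfun y x)"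
proof (rule continuous_onI)
  fix y :: "real \<Rightarrow>\<^sub>C complex" and e :: real assume "e > 0"
  then show "\<exists>d>0. \<forall>y'\<in>A. dist y' y < d \<longrightarrow> dist (apply_bcontfun y' x) (apply_bcontfun y x) \<le> e"
    by (intro exI[of _ e]) (auto intro: order_trans[OF dist_bounded])
qed

text \<open>An intersection of conditions on point evaluations, each continuous in the sup norm. The
  Newton iteration needs closedness for a complete domain.\<close>

lemma closed_periodic_bcontfun: "closed {y :: real \<Rightarrow>\<^sub>C complex. periodic1 (apply_bcontfun y)}"
proof -
  have "{y :: real \<Rightarrow>\<^sub>C complex. periodic1 (apply_bcontfun y)} = (\<Inter>x. {y. apply_bcontfun y (x + 1) = apply_bcontfun y x})"
    by (auto simp: periodic1_def)
  then show ?thesis by (simp add: closed_INT closed_Collect_eq continuous_on_eval_bcontfun)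
qed

lemma ulip_periodic:
  assumes "continuous_on UNIV f" "periodic1 f" shows "ulip z0 Y (\<lambda>\<tau> z y x. complex_of_real (f x))"
proof -
  obtain C where "\<And>x. norm (f x) \<le> C" using periodic1_bounded[OF assms] by blast
  then show ?thesis by (intro ulip_base[of "\<lambda>\<tau> x. complex_of_real (f x)" C]) simp
qed

context wave_family
begin

text \<open>The coefficients are real, so the conjugate of a non-real root is a second, different
  root.\<close>

lemma dispersion_factor:
  assumes "dispersion_poly c0 U0 ks z0 = 0" "Im z0 \<noteq> 0"
  shows "dispersion_poly c0 U0 ks z = (z - z0) * (z - cnj z0)"
proof -
  define p q where "p = ks * ck - c0 ks" and "q = ks * c0 ks * ck + 6 * ks * qk"
  have d: "dispersion_poly c0 U0 ks z = z^2 + of_real p * z - of_real q" for z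
    by (simp add: dispersion_poly_def p_def q_def ck_def qk_def)
  have 1: "z0^2 + of_real p * z0 - of_real q = 0" using assms(1) by (simp add: d)
  have "cnj (z0^2 + of_real p * z0 - of_real q) = 0" unfolding 1 by simp
  then have 2: "(cnj z0)^2 + of_real p * cnj z0 - of_real q = 0" by simp
  have "z0 - cnj z0 \<noteq> 0" using assms(2) by (simp add: complex_eq_iff)
  moreover have "(z0 - cnj z0) * (z0 + cnj z0 + of_real p) = 0" using 1 2 by algebra
  ultimately have 3: "z0 + cnj z0 + of_real p = 0" by simp
  show ?thesis unfolding d using 1 3 by algebra
qed

text \<open>The iteration runs over the forcing y = L v of the corrector instead of v, so its domain
  consists of bounded continuous functions. The equation is y = - (\<nu> / \<tau>) times the
  residual minus its mean, and the vanishing of that mean is the equation for z.\<close>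

lemma unstable:
  assumes root: "dispersion_poly c0 U0 ks z0 = 0" and im: "Im z0 \<noteq> 0"
  shows "\<not> spectrally_stable \<delta> ks V s"
proof -
  obtain S B where B: "B > 0" and S: "\<And>h. continuous_on UNIV h \<Longrightarrow> periodic1 h \<Longrightarrow> avg h = 0 \<Longrightarrow> is_sol h (S h)"
    and Sd: "\<And>h h' m x. continuous_on UNIV h \<Longrightarrow> periodic1 h \<Longrightarrow> avg h = 0 \<Longrightarrow> continuous_on UNIV h' \<Longrightarrow> periodic1 h' \<Longrightarrow> avg h' = 0 \<Longrightarrow>
      (\<And>x. norm (h x - h' x) \<le> m) \<Longrightarrow> norm (S h x - S h' x) \<le> B * m \<and> norm (Dx (S h) x - Dx (S h') x) \<le> B * m \<and>
       norm (Dx (Dx (S h)) x - Dx (Dx (S h')) x) \<le> B * m \<and> norm (Dx (Dx (Dx (S h))) x - Dx (Dx (Dx (S h'))) x) \<le> B * m"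
    and S0: "S (\<lambda>x. 0) = (\<lambda>x. 0)"
    by (rule solution_operator) blast
  define X where "X = {y :: real \<Rightarrow>\<^sub>C complex. periodic1 (apply_bcontfun y)}"
  define Y where "Y = X \<inter> cball 0 1"
  \<comment> \<open>The solution operator acts on mean-zero forcings, so y is projected; at the
    fixed point y turns out to have mean 0 and the projection becomes the identity.\<close>
  define pr where "pr y x = apply_bcontfun y x - avg (apply_bcontfun y)" for y :: "real \<Rightarrow>\<^sub>C complex" and x
  define corrector where "corrector y = S (pr y)" for y
  have cy: "continuous_on UNIV (apply_bcontfun y)" for y :: "real \<Rightarrow>\<^sub>C complex" by simp
  have pr: "continuous_on UNIV (pr y)" "periodic1 (pr y)" "avg (pr y) = 0" if "y \<in> X" for y
    unfolding pr_def using that avg_diff[OF cy continuous_on_const, of y "avg (apply_bcontfun y)"]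
    by (auto intro!: continuous_intros simp: X_def periodic1_def avg_const)
  have sol: "is_sol (pr y) (corrector y)" if "y \<in> X" for y unfolding corrector_def by (intro S pr that)
  have prd: "norm (pr y x - pr y' x) \<le> 2 * dist y y'" for y y' x
  proof -
    have "norm (apply_bcontfun y x - apply_bcontfun y' x) \<le> dist y y'" for x
      using dist_bounded[of y x y'] by (simp add: dist_norm)
    moreover from this have "norm (avg (\<lambda>x. apply_bcontfun y x - apply_bcontfun y' x)) \<le> dist y y'"
      by (intro avg_bound continuous_intros cy)
    moreover have "pr y x - pr y' x = (apply_bcontfun y x - apply_bcontfun y' x) - avg (\<lambda>x. apply_bcontfun y x - apply_bcontfun y' x)"
      by (simp add: pr_def avg_diff[OF cy cy])
    ultimately show ?thesis by (smt (verit) norm_triangle_ineq4)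
  qed
  have vd: "norm (corrector y x - corrector y' x) \<le> B * (2 * dist y y') \<and> norm (Dx (corrector y) x - Dx (corrector y') x) \<le> B * (2 * dist y y') \<and>
       norm (Dx (Dx (corrector y)) x - Dx (Dx (corrector y')) x) \<le> B * (2 * dist y y') \<and>
       norm (Dx (Dx (Dx (corrector y))) x - Dx (Dx (Dx (corrector y'))) x) \<le> B * (2 * dist y y')" if "y \<in> X" "y' \<in> X" for y y' x
    unfolding corrector_def by (intro Sd pr that prd)
  have X0: "0 \<in> X" by (simp add: X_def periodic1_def)
  have pr0: "pr 0 = (\<lambda>x. 0)" by (simp add: pr_def[abs_def] avg_const)
  have corrector0: "corrector 0 = (\<lambda>x. 0)" unfolding corrector_def pr0 by (rule S0)
  have vb: "norm (corrector y x) \<le> 2 * B \<and> norm (Dx (corrector y) x) \<le> 2 * B \<and>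
       norm (Dx (Dx (corrector y)) x) \<le> 2 * B \<and> norm (Dx (Dx (Dx (corrector y))) x) \<le> 2 * B" if "y \<in> Y" for y x
  proof -
    have "y \<in> X" "dist y 0 \<le> 1" using that by (auto simp: Y_def)
    moreover have "B * (2 * dist y 0) \<le> 2 * B" using B \<open>dist y 0 \<le> 1\<close> by simp
    ultimately show ?thesis using vd[OF \<open>y \<in> X\<close> X0, of x] unfolding corrector0 Dx_const by (auto intro: order_trans)
  qed
  have uv: "ulip z0 Y (\<lambda>\<tau> z y x. corrector y x)" "ulip z0 Y (\<lambda>\<tau> z y x. Dx (corrector y) x)"
    "ulip z0 Y (\<lambda>\<tau> z y x. Dx (Dx (corrector y)) x)" "ulip z0 Y (\<lambda>\<tau> z y x. Dx (Dx (Dx (corrector y))) x)"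
  proof -
    have le: "B * (2 * dist y y') \<le> 2 * B * (dist z z' + dist y y')" for y y' :: "real \<Rightarrow>\<^sub>C complex" and z z' :: complex
      using B by (simp add: algebra_simps)
    have sub: "y \<in> X" if "y \<in> Y" for y using that by (simp add: Y_def)
    show "ulip z0 Y (\<lambda>\<tau> z y x. corrector y x)" "ulip z0 Y (\<lambda>\<tau> z y x. Dx (corrector y) x)"
      "ulip z0 Y (\<lambda>\<tau> z y x. Dx (Dx (corrector y)) x)" "ulip z0 Y (\<lambda>\<tau> z y x. Dx (Dx (Dx (corrector y))) x)"
      by (rule ulipI[of "2 * B" "2 * B"]; use B vb vd[OF sub sub] le in \<open>blast intro: order_trans less_imp_le mult_pos_pos zero_less_numeral\<close>)+
  qed
  \<comment> \<open>For \<nu> = \<i> \<sigma> \<tau>^2 one has Re (\<nu> ks z) = - \<sigma> \<tau>^2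
    ks Im z, so the sign is taken opposite to that of Im z0.\<close>
  define \<sigma> where "\<sigma> = - sgn (Im z0)"
  have \<sigma>: "\<bar>\<sigma>\<bar> = 1" "\<sigma> * Im z0 < 0" using im by (auto simp: \<sigma>_def sgn_if)
  \<comment> \<open>The square makes \<nu> / \<tau> = \<i> \<sigma> \<tau>, so the forcing of the
    corrector is of order \<tau>; the factor - \<i> \<sigma> left after removing \<tau> goes into
    \<phi>.\<close>
  define \<nu> where "\<nu> \<tau> = \<i> * of_real (\<sigma> * \<tau>^2)" for \<tau> :: real
  have u\<nu>: "ulip z0 Y (\<lambda>\<tau> z y x. \<nu> \<tau>)"
  proof (rule ulip_base[of "\<lambda>\<tau> x. \<nu> \<tau>" 1])
    show "norm (\<nu> \<tau>) \<le> 1" if "0 < \<tau>" "\<tau> \<le> 1" for \<tau>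
      using that \<sigma>(1) by (simp add: \<nu>_def norm_mult norm_power abs_mult power_le_one)
  qed
  have pV: "periodic1 (Dx V)" "periodic1 (Dx (Dx V))" "periodic1 (Dx (Dx (Dx V)))" "periodic1 (Dx w)" "periodic1 (Dx (Dx w))" "periodic1 (Dx (Dx (Dx w)))"
    by (intro periodic1_Dx smooth1_Dx smoothV smooth_w perV per_w)+
  have uW: "ulip z0 Y (\<lambda>\<tau> z y x. complex_of_real (6 * V x - s))"
    by (rule ulip_periodic) (use perV wave_continuous(1) in \<open>auto simp: periodic1_def intro!: continuous_intros\<close>)
  note uw = ulip_periodic[OF wave_continuous(2) pV(1)] ulip_periodic[OF wave_continuous(3) pV(2)] ulip_periodic[OF wave_continuous(4) pV(3)]
    ulip_periodic[OF wave_continuous(5) per_w] ulip_periodic[OF wave_continuous(6) pV(4)] ulip_periodic[OF wave_continuous(7) pV(5)]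
    ulip_periodic[OF wave_continuous(8) pV(6)]
  note ui = ulip_add ulip_mult ulip_minus ulip_power ulip_tau ulip_z ulip_const uv uW uw u\<nu>
  have ub: "ulip z0 Y (\<lambda>\<tau> z y x. b0 z)" unfolding divide_inverse by (intro ui)
  note ub = ub[unfolded of_real_mult]
  define R where "R \<tau> z y = bloch_residual (\<nu> \<tau>) z \<tau> (corrector y)" for \<tau> z y
  have uR: "ulip z0 Y R"
    unfolding R_def[abs_def] bloch_residual_def bloch_increment_def kernel_correction_def of_real_mult by (intro ui ub)
  have Rc: "continuous_on UNIV (R \<tau> z y)" and Rp: "periodic1 (R \<tau> z y)" if "y \<in> X" for \<tau> z y
    unfolding R_def by (rule bloch_residual_continuous[OF sol[OF that]], rule bloch_residual_periodic[OF sol[OF that]])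
  have uaR: "ulip z0 Y (\<lambda>\<tau> z y x. avg (R \<tau> z y))"
    by (rule ulip_avg[OF uR]) (use Rc in \<open>auto simp: Y_def\<close>)
  define \<phi> where "\<phi> \<tau> z y x = - (\<i> * of_real \<sigma>) * (R \<tau> z y x - avg (R \<tau> z y))" for \<tau> z y x
  have u\<phi>: "ulip z0 Y \<phi>" unfolding \<phi>_def[abs_def] by (intro ui ulip_diff uR uaR)
  define \<Phi> where "\<Phi> \<tau> z y = Bcontfun (\<phi> \<tau> z y)" for \<tau> z y
  have c\<phi>: "continuous_on UNIV (\<phi> \<tau> z y)" and p\<phi>: "periodic1 (\<phi> \<tau> z y)" if "y \<in> X" for \<tau> z y
    using Rc[OF that] Rp[OF that] by (auto simp: \<phi>_def[abs_def] periodic1_def intro!: continuous_intros)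
  have \<Phi>: "apply_bcontfun (\<Phi> \<tau> z y) = \<phi> \<tau> z y" if yX: "y \<in> X" for \<tau> z y
  proof -
    obtain C where "\<And>x. norm (\<phi> \<tau> z y x) \<le> C" using periodic1_bounded[OF c\<phi>[OF yX] p\<phi>[OF yX]] by blast
    then have "\<phi> \<tau> z y \<in> bcontfun" using c\<phi>[OF yX] by (auto simp: bcontfun_def bounded_iff)
    then show ?thesis unfolding \<Phi>_def by (rule Bcontfun_inverse)
  qed
  let ?k = "complex_of_real ks"
  \<comment> \<open>The factor left of \<open>mean_symbol (\<nu> \<tau>)\<close> when one \<tau> is
    split off, so that its contribution fits into \<tau> r.\<close>
  define mt where "mt \<tau> = ?k^3 * (\<i> * of_real \<sigma>)^2 * of_real \<tau>^3 + of_real \<delta> * (?k^2 * (\<i> * of_real \<sigma>) * of_real \<tau> + ?k^4 * (\<i> * of_real \<sigma>)^3 * of_real \<tau>^5)" for \<tau>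
  have mt: "mean_symbol (\<nu> \<tau>) = of_real \<tau> * mt \<tau>" for \<tau>
    unfolding mean_symbol_def \<nu>_def mt_def of_real_mult of_real_power by algebra
  \<comment> \<open>The mean of the residual in the normal form of the iteration: its leading factor
    - ks / 6 is divided out and what accompanies the polynomial is \<tau> r.\<close>
  define r where "r \<tau> z y = - (6 / ?k) * (?k * avg (\<lambda>x. of_real (6 * V x - s) * corrector y x) + (?k * z + mean_symbol (\<nu> \<tau>)) * avg (corrector y) + mt \<tau> * b0 z)" for \<tau> z y
  have ur: "ulip z0 Y (\<lambda>\<tau> z y x. r \<tau> z y)"
  proof -
    have c: "continuous_on UNIV (corrector y)" if "y \<in> Y" for y using sol_continuous[OF sol] that by (simp add: Y_def)
    have 1: "ulip z0 Y (\<lambda>\<tau> z y x. avg (\<lambda>x. of_real (6 * V x - s) * corrector y x))"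
      by (rule ulip_avg[of z0 Y "\<lambda>\<tau> z y x. of_real (6 * V x - s) * corrector y x"]) (intro ui continuous_intros wave_continuous c; assumption)+
    have 2: "ulip z0 Y (\<lambda>\<tau> z y x. avg (corrector y))"
      by (rule ulip_avg[of z0 Y "\<lambda>\<tau> z y x. corrector y x"]) (intro ui c; assumption)+
    show ?thesis unfolding r_def mean_symbol_def mt_def divide_inverse[of 6] of_real_mult by (intro ui ub 1 2)
  qed
  have avgR: "avg (R \<tau> z y) = - (?k / 6) * ((z - z0) * (z - cnj z0) + of_real \<tau> * r \<tau> z y)" if "y \<in> X" for \<tau> z y
    unfolding R_def avg_bloch_residual[OF sol[OF that]] dispersion_factor[OF root im] r_def mt
    using ks by (simp add: field_simps)
  obtain C1 where "ulip_with C1 z0 Y \<phi>" using u\<phi> unfolding ulip_def by blast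
  note C1 = ulip_withD[OF this]
  obtain C2 where "ulip_with C2 z0 Y (\<lambda>\<tau> z y x. r \<tau> z y)" using ur unfolding ulip_def by blast
  note C2 = ulip_withD[OF this]
  have YX: "y \<in> X" if "y \<in> Y" for y using that by (simp add: Y_def)
  \<comment> \<open>Staying within half the distance of z0 from the real axis preserves the sign of
    Im z0.\<close>
  define \<rho> where "\<rho> = min 1 (\<bar>Im z0\<bar> / 2)"
  have \<rho>: "\<rho> > 0" "\<rho> \<le> 1" "\<rho> \<le> \<bar>Im z0\<bar> / 2" using im by (auto simp: \<rho>_def)
  obtain \<tau>0 where \<tau>0: "\<tau>0 > 0" "\<And>\<tau>. 0 < \<tau> \<Longrightarrow> \<tau> \<le> \<tau>0 \<Longrightarrow> \<tau> \<le> 1 \<and>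
     (\<exists>z\<in>cball z0 \<rho>. \<exists>y\<in>X \<inter> cball 0 1. y = \<tau> *\<^sub>R \<Phi> \<tau> z y \<and> (z - z0) * (z - cnj z0) + of_real \<tau> * r \<tau> z y = 0)"
  proof (rule newton_contraction[of X z0 "cnj z0" \<rho> "C1 + C2" \<Phi> r])
    show "closed X" unfolding X_def by (rule closed_periodic_bcontfun)
    show "z0 \<noteq> cnj z0" using im by (simp add: complex_eq_iff)
    show "\<tau> *\<^sub>R \<Phi> \<tau> z y \<in> X" if "y \<in> X \<inter> cball 0 1" for \<tau> z y
      using that p\<phi>[of y \<tau> z] \<Phi>[of y \<tau> z] by (simp add: X_def periodic1_def)
    show "norm (\<Phi> \<tau> z y) \<le> C1 + C2 \<and> norm (r \<tau> z y) \<le> C1 + C2"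
      if "0 < \<tau>" "\<tau> \<le> 1" "z \<in> cball z0 1" "y \<in> X \<inter> cball 0 1" for \<tau> z y
    proof -
      have y: "y \<in> Y" using that(4) by (simp add: Y_def)
      have "norm (\<Phi> \<tau> z y) \<le> C1" by (rule norm_bound) (simp only: \<Phi>[OF YX[OF y]] C1(2)[OF that(1-3) y])
      then show ?thesis using C2(2)[OF that(1-3) y] C1(1) C2(1) by linarith
    qed
    show "dist (\<Phi> \<tau> z y) (\<Phi> \<tau> z' y') \<le> (C1 + C2) * (dist z z' + dist y y') \<and>
       dist (r \<tau> z y) (r \<tau> z' y') \<le> (C1 + C2) * (dist z z' + dist y y')"
      if "0 < \<tau>" "\<tau> \<le> 1" "z \<in> cball z0 1" "y \<in> X \<inter> cball 0 1" "z' \<in> cball z0 1" "y' \<in> X \<inter> cball 0 1" for \<tau> z y z' y'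
    proof -
      have y: "y \<in> Y" "y' \<in> Y" using that by (simp_all add: Y_def)
      have "dist (\<Phi> \<tau> z y) (\<Phi> \<tau> z' y') \<le> C1 * (dist z z' + dist y y')"
        by (rule dist_bound) (simp only: \<Phi>[OF YX[OF y(1)]] \<Phi>[OF YX[OF y(2)]] dist_norm[of "\<phi> _ _ _ _"] C1(3)[OF that(1-3) y(1) that(5) y(2)])
      moreover have "dist (r \<tau> z y) (r \<tau> z' y') \<le> C2 * (dist z z' + dist y y')"
        using C2(3)[OF that(1-3) y(1) that(5) y(2)] by (simp add: dist_norm[of "r _ _ _"])
      moreover have "C1 * (dist z z' + dist y y') \<le> (C1 + C2) * (dist z z' + dist y y')"
        "C2 * (dist z z' + dist y y') \<le> (C1 + C2) * (dist z z' + dist y y')"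
        using C1(1) C2(1) by (intro mult_right_mono; simp)+
      ultimately show ?thesis by linarith
    qed
  qed (use X0 \<rho> C1(1) C2(1) in auto)
  \<comment> \<open>Bounds b0 z + ks w at \<open>x0\<close> for z within distance 1 of z0. The
    corrector vanishes at \<open>x0\<close> and V' does not, so \<tau> K < |V'(x0)| will show that
    the eigenfunction is not identically 0.\<close>
  define K where "K = (norm (of_real (ks * ck) :: complex) + norm z0 + 1) / 6 + ks * norm (cw x0)"
  have K: "K \<ge> 0" unfolding K_def using ks by (intro add_nonneg_nonneg divide_nonneg_nonneg mult_nonneg_nonneg) auto
  define \<tau> where "\<tau> = min \<tau>0 (norm (cV' x0) / (2 * (K + 1)))"
  have x0': "norm (cV' x0) > 0" using x0 by simp
  have \<tau>: "0 < \<tau>" "\<tau> \<le> \<tau>0" using \<tau>0(1) x0' K by (simp_all add: \<tau>_def)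
  have "\<tau> \<le> norm (cV' x0) / (2 * (K + 1))" by (simp add: \<tau>_def)
  then have "\<tau> * (2 * (K + 1)) \<le> norm (cV' x0)" using K by (simp add: pos_le_divide_eq)
  then have \<tau>K: "\<tau> * K < norm (cV' x0)" using K \<tau>(1) x0' by (simp add: algebra_simps)
  from \<tau>0(2)[OF \<tau>] obtain z y where t1: "\<tau> \<le> 1" and z: "z \<in> cball z0 \<rho>" and y: "y \<in> X \<inter> cball 0 1"
    and fix1: "y = \<tau> *\<^sub>R \<Phi> \<tau> z y" and fix2: "(z - z0) * (z - cnj z0) + of_real \<tau> * r \<tau> z y = 0" by blast
  have yX: "y \<in> X" using y by simp
  \<comment> \<open>The z-equation of the fixed point says exactly that the residual has mean
    zero.\<close>
  have aR: "avg (R \<tau> z y) = 0" unfolding avgR[OF yX] fix2 by simp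
  have yR: "apply_bcontfun y x = - of_real \<tau> * (\<i> * of_real \<sigma>) * R \<tau> z y x" for x
  proof -
    have "apply_bcontfun y x = apply_bcontfun (\<tau> *\<^sub>R \<Phi> \<tau> z y) x" using fix1 by simp
    also have "\<dots> = \<tau> *\<^sub>R \<phi> \<tau> z y x" by (simp add: \<Phi>[OF yX])
    finally show ?thesis by (simp add: \<phi>_def aR scaleR_conv_of_real)
  qed
  have "avg (apply_bcontfun y) = avg (\<lambda>x. - of_real \<tau> * (\<i> * of_real \<sigma>) * R \<tau> z y x)"
    by (rule arg_cong[of _ _ avg]) (rule ext, rule yR)
  then have "avg (apply_bcontfun y) = 0" by (simp only: avg_cmult) (simp add: aR)
  then have pry: "pr y x = apply_bcontfun y x" for x by (simp add: pr_def)
  have hy: "of_real \<tau> * pr y x = - \<nu> \<tau> * bloch_residual (\<nu> \<tau>) z \<tau> (corrector y) x" for x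
  proof -
    have "of_real \<tau> * apply_bcontfun y x = - \<nu> \<tau> * R \<tau> z y x"
      by (simp add: yR \<nu>_def power2_eq_square)
    then show ?thesis by (simp only: pry R_def)
  qed
  note BA = bloch_ansatz[OF sol[OF yX] hy]
  let ?f = "\<lambda>x. cV' x + \<nu> \<tau> * (b0 z + ?k * cw x + of_real \<tau> * corrector y x)"
  have "corrector y x0 = 0" using sol[OF yX] by (simp add: is_sol_def)
  moreover have "cV' x0 + \<nu> \<tau> * (b0 z + ?k * cw x0) \<noteq> 0"
  proof
    assume "cV' x0 + \<nu> \<tau> * (b0 z + ?k * cw x0) = 0"
    then have "cV' x0 = - (\<nu> \<tau> * (b0 z + ?k * cw x0))" by (simp add: eq_neg_iff_add_eq_0)
    then have "norm (cV' x0) = norm (\<nu> \<tau>) * norm (b0 z + ?k * cw x0)" by (simp only: norm_minus_cancel norm_mult)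
    also have "\<dots> \<le> \<tau> * K"
    proof (rule mult_mono)
      show "norm (\<nu> \<tau>) \<le> \<tau>" using \<tau>(1) t1 \<sigma>(1) by (simp add: \<nu>_def norm_mult norm_power abs_mult power2_eq_square mult_left_le)
      have "norm z \<le> norm z0 + 1" using z \<rho>(2) norm_triangle_sub[of z z0] by (simp add: dist_norm norm_minus_commute)
      then have "norm (of_real (ks * ck) + z) \<le> norm (of_real (ks * ck) :: complex) + norm z0 + 1"
        using norm_triangle_ineq[of "of_real (ks * ck)" z] by linarith
      then have "norm (b0 z) \<le> (norm (of_real (ks * ck) :: complex) + norm z0 + 1) / 6"
        by (simp only: norm_divide norm_minus_cancel norm_numeral) simp
      moreover have "norm (?k * cw x0) = ks * norm (cw x0)" using ks by (simp add: norm_mult)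
      ultimately show "norm (b0 z + ?k * cw x0) \<le> K" unfolding K_def using norm_triangle_ineq[of "b0 z" "?k * cw x0"] by linarith
    qed (use \<tau> in auto)
    finally show False using \<tau>K by simp
  qed
  ultimately have nz: "?f x0 \<noteq> 0" by simp
  have "\<bar>Im z - Im z0\<bar> \<le> \<bar>Im z0\<bar> / 2"
    using z \<rho>(3) abs_Im_le_cmod[of "z - z0"] by (simp add: dist_norm norm_minus_commute)
  then have "\<sigma> * Im z < 0"
  proof (cases "Im z0 > 0")
    case True
    then have "Im z > 0" using \<open>\<bar>Im z - Im z0\<bar> \<le> \<bar>Im z0\<bar> / 2\<close> by linarith
    then show ?thesis using True by (simp add: \<sigma>_def)
  next
    case False
    then have "Im z < 0" using \<open>\<bar>Im z - Im z0\<bar> \<le> \<bar>Im z0\<bar> / 2\<close> im by linarith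
    then show ?thesis using False im by (simp add: \<sigma>_def)
  qed
  then have "Re (\<nu> \<tau> * ?k * z) > 0"
    using \<tau>(1) ks by (simp add: \<nu>_def mult_less_0_iff zero_less_mult_iff)
  moreover have "Re (\<nu> \<tau>) = 0" by (simp add: \<nu>_def)
  ultimately show ?thesis unfolding spectrally_stable_def using BA nz by (meson not_le)
qed

text \<open>A characteristic speed a corresponds to the root s - a of the dispersion polynomial. The
  entry 6 ks of the flux derivative is non-zero, so an eigenvector has non-zero first component, as
  the elimination of the second one requires.\<close>

lemma hyperbolic:
  assumes "spectrally_stable \<delta> ks V s"
  shows "hyperbolic_at (whitham_flux U c) (ks, Ms)"
  unfolding hyperbolic_at_def
proof (intro allI impI)
  fix a assume "characteristic_speed (whitham_flux U c) (ks, Ms) a"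
  then obtain v where v: "v \<noteq> 0" "cderiv (whitham_flux U c) (ks, Ms) v = (a * fst v, a * snd v)"
    by (auto simp: characteristic_speed_def)
  have e: "of_real (s + ks * ck) * fst v + of_real (6 * ks) * snd v = a * fst v" "of_real qk * fst v + of_real (6 * Ms) * snd v = a * snd v"
    using v(2) by (simp_all add: cderiv_flux)
  have nz: "fst v \<noteq> 0"
  proof
    assume 0: "fst v = 0"
    then have "of_real (6 * ks) * snd v = 0" using e(1) by simp
    then have "snd v = 0" using ks by simp
    then show False using v(1) 0 by (simp add: prod_eq_iff)
  qed
  have "modulation_eqs U c ks Ms (of_real s - a) (fst v) (snd v)"
    unfolding modulation_iff using e by (auto simp: s_eq algebra_simps)
  from dispersion_iff[OF nz this] have "dispersion_poly c0 U0 ks (of_real s - a) = 0" .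
  then have "Im (of_real s - a) = 0" using unstable assms by blast
  then show "a \<in> \<real>" by (simp add: complex_is_Real_iff)
qed

end

section \<open>The Whitham modulation system\<close>

text \<open>The equivalence with plane waves is asserted for \<nu> \<noteq> 0: at \<nu> = 0 the
  plane wave is constant and solves the linearization for all l, \<kappa>, \<mu>.\<close>

theorem mainTheorem4:
  fixes \<delta> ks Ms :: real
    and \<Omega> :: "(real \<times> real) set"
    and U :: "real \<Rightarrow> real \<Rightarrow> real \<Rightarrow> real"
    and c :: "real \<Rightarrow> real \<Rightarrow> real"
    and U0 :: "real \<Rightarrow> real \<Rightarrow> real"
    and c0 :: "real \<Rightarrow> real"
  assumes "\<delta> > 0"
    and "open \<Omega>"
    and "\<And>k M. (k, M) \<in> \<Omega> \<Longrightarrow> k > 0"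
    and "smooth_on (\<Omega> \<times> UNIV) (\<lambda>((k, M), x). U k M x)"
    and "smooth_on \<Omega> (\<lambda>(k, M). c k M)"
    and "\<And>k M. (k, M) \<in> \<Omega> \<Longrightarrow> periodic1 (U k M)"
    and "\<And>k M. (k, M) \<in> \<Omega> \<Longrightarrow> \<exists>x y. U k M x \<noteq> U k M y"
    and "\<And>k M. (k, M) \<in> \<Omega> \<Longrightarrow> avg (U k M) = M"
    and "\<And>k M. (k, M) \<in> \<Omega> \<Longrightarrow> profile_eq \<delta> k (U k M) (c k M)"
    and "\<And>k M x. (k, M) \<in> \<Omega> \<Longrightarrow> U k M x = M + U0 k x"
    and "\<And>k M. (k, M) \<in> \<Omega> \<Longrightarrow> c k M = 6 * M + c0 k"
    and "\<And>k M. (k, M) \<in> \<Omega> \<Longrightarrow> spectral_assumption \<delta> k (U k M) (c k M)"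
    and "(ks, Ms) \<in> \<Omega>"
  shows
    "(\<forall>\<epsilon> lam uhat l0 u0 u1.
        bloch_curve \<delta> ks (U ks Ms) (c ks Ms) \<epsilon> lam uhat \<and>
        curve_expansions ks lam uhat l0 u0 u1 \<and> (\<exists>x. u0 x \<noteq> 0) \<longrightarrow>
        (\<exists>k0. k0 \<noteq> 0 \<and>
           (\<forall>x. u0 x = k0 / of_real ks * of_real (Dx (U ks Ms) x)) \<and>
           modulation_eqs U c ks Ms l0 k0 (avg u1) \<and>
           (\<forall>\<nu>. Re \<nu> = 0 \<longrightarrow>
              solves_linearization_comoving (whitham_flux U c) (ks, Ms) (c ks Ms)
                (plane_wave \<nu> l0 k0 (avg u1)))) \<and>
        dispersion_poly c0 U0 ks l0 = 0)
     \<and> (\<forall>l \<kappa> \<mu> \<nu>. Re \<nu> = 0 \<and> \<nu> \<noteq> 0 \<longrightarrow>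
          (modulation_eqs U c ks Ms l \<kappa> \<mu> \<longleftrightarrow>
           solves_linearization_comoving (whitham_flux U c) (ks, Ms) (c ks Ms)
             (plane_wave \<nu> l \<kappa> \<mu>)))
     \<and> ((c0 ks + ks * deriv c0 ks)^2 + 24 * ks * deriv (qbar0 U0) ks > 0 \<longrightarrow>
          (\<exists>r1 r2 :: real. r1 \<noteq> r2 \<and>
             (\<forall>z. dispersion_poly c0 U0 ks z = 0 \<longleftrightarrow> z = of_real r1 \<or> z = of_real r2)))
     \<and> (spectrally_stable \<delta> ks (U ks Ms) (c ks Ms) \<longrightarrow>
          hyperbolic_at (whitham_flux U c) (ks, Ms))"
proof -
  interpret wave_family \<delta> ks Ms \<Omega> U c U0 c0 by (rule wave_family.intro[OF assms])
  show ?thesis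
  proof (intro conjI allI impI)
    fix \<epsilon> lam uhat l0 u0 u1
    assume a: "bloch_curve \<delta> ks (U ks Ms) (c ks Ms) \<epsilon> lam uhat \<and>
      curve_expansions ks lam uhat l0 u0 u1 \<and> (\<exists>x. u0 x \<noteq> 0)"
    then obtain k0 where k0: "k0 \<noteq> 0" "\<forall>x. u0 x = k0 / of_real ks * of_real (Dx (U ks Ms) x)"
      "modulation_eqs U c ks Ms l0 k0 (avg u1)"
      using bloch_curve_modulation by blast
    then show "\<exists>k0. k0 \<noteq> 0 \<and>
       (\<forall>x. u0 x = k0 / of_real ks * of_real (Dx (U ks Ms) x)) \<and>
       modulation_eqs U c ks Ms l0 k0 (avg u1) \<and>
       (\<forall>\<nu>. Re \<nu> = 0 \<longrightarrow>
          solves_linearization_comoving (whitham_flux U c) (ks, Ms) (c ks Ms)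
            (plane_wave \<nu> l0 k0 (avg u1)))"
      using plane_wave_iff by blast
    show "dispersion_poly c0 U0 ks l0 = 0" using dispersion_iff k0(1,3) by blast
  next
    fix l \<kappa> \<mu> \<nu> :: complex assume "Re \<nu> = 0 \<and> \<nu> \<noteq> 0"
    then show "modulation_eqs U c ks Ms l \<kappa> \<mu> \<longleftrightarrow>
      solves_linearization_comoving (whitham_flux U c) (ks, Ms) (c ks Ms) (plane_wave \<nu> l \<kappa> \<mu>)"
      using plane_wave_iff by blast
  next
    assume "(c0 ks + ks * deriv c0 ks)^2 + 24 * ks * deriv (qbar0 U0) ks > 0"
    then show "\<exists>r1 r2 :: real. r1 \<noteq> r2 \<and>
      (\<forall>z. dispersion_poly c0 U0 ks z = 0 \<longleftrightarrow> z = of_real r1 \<or> z = of_real r2)"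
      by (intro real_roots) (simp add: ck_def qk_def)
  next
    assume "spectrally_stable \<delta> ks (U ks Ms) (c ks Ms)"
    then show "hyperbolic_at (whitham_flux U c) (ks, Ms)" by (rule hyperbolic)
  qed
qed

end
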